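(* Let $G$ be an $m$-uniform hypergraph on $n$ nodes in which the connected components are properly connected. Let $c$ be the number of connected components of $G$ and $p$ the number of pivot equivalence classes of $G$. Then the analytic spread of the edge ideal of $G$ is $$\ell(I(G))=n-p+c.$$
   Context: A hypergraph $G$ has a finite node set $V(G)=\{x_1,\dots,x_n\}$ and an edge set $E(G)$ consisting of finitely many subsets of $V(G)$; it is $m$-uniform if every edge has size $m$. Standing assumptions: $G$ has no isolated nodes (every node lies in some edge), and each connected component of $G$ has at least as many edges as nodes. Fix a field $\Bbbk$ and view the nodes as indeterminates; the edge ideal is $I(G)=(x_{i_1}\cdots x_{i_m}:\{x_{i_1},\dots,x_{i_m}\}\in E(G))\subset R=\Bbbk[x_1,\dots,x_n]_{(x_1,\dots,x_n)}$. The analytic spread $\ell(I)$ of an ideal $I$ in a Noetherian local ring $(R,\mathfrak m)$ is the Krull dimension of the special fiber ring $\mathcal G/\mathfrak m\mathcal G$, where $\mathcal G=\bigoplus_{t\ge0}I^t/I^{t+1}$ is the associated graded ring of $R$ with respect to $I$. $G$ is connected if for any two nodes there is a sequence of edges such that the two nodes belong to the first and the last edge of the sequence respectively, and consecutive edges have a common node. An $m$-uniform hypergraph is properly connected if for any two edges $u,v$ there is a sequence of edges starting with $u$ and ending with $v$ such that the intersection of consecutive edges has size $m-1$. Pivot equivalence is defined on the set of all nodes of $G$: $x_i\approx x_j$ if there is a subset $A\subset V(G)\setminus\{x_i,x_j\}$ such that $\{x_i\}\cup A$ and $\{x_j\}\cup A$ are edges of $G$; and $x_i\sim x_j$ if there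 is a sequence of nodes $x_i=x_{i_1}\approx x_{i_2}\approx\cdots\approx x_{i_r}=x_j$. The equivalence classes of $\sim$ are the pivot equivalence classes of $G$.
   Formalization: The formal statement assumes m ≥ 2; for m = 1 the claim fails, e.g. two nodes with edges {x1},{x2} give p = 1, c = 2, n−p+c = 3 while the analytic spread is 2. *)

theory Defs
  imports
    "HOL-Algebra.QuotRing"
    "HOL-Algebra.Ideal_Product"
    "HOL-Library.Poly_Mapping"
    "HOL-Library.Extended_Nat"
begin

section \<open>Hypergraphs\<close>

definition hypergraph :: "'v set \<Rightarrow> 'v set set \<Rightarrow> bool" where
  "hypergraph V E \<longleftrightarrow> finite V \<and> E \<subseteq> Pow V"

definition uniform :: "nat \<Rightarrow> 'v set set \<Rightarrow> bool" where
  "uniform m E \<longleftrightarrow> (\<forall>e\<in>E. card e = m)"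

definition no_isolated_nodes :: "'v set \<Rightarrow> 'v set set \<Rightarrow> bool" where
  "no_isolated_nodes V E \<longleftrightarrow> (\<forall>x\<in>V. \<exists>e\<in>E. x \<in> e)"

definition linked :: "'v set set \<Rightarrow> 'v \<Rightarrow> 'v \<Rightarrow> bool" where
  "linked E x y \<longleftrightarrow>
     (\<exists>es. es \<noteq> [] \<and> set es \<subseteq> E \<and> x \<in> hd es \<and> y \<in> last es \<and>
           successively (\<lambda>e f. e \<inter> f \<noteq> {}) es)"

text \<open>A connected component is represented by its node set; its edges are given by
  \<open>edges_in\<close>. On a hypergraph without isolated nodes, \<open>linked\<close> is reflexive.\<close>

definition components :: "'v set \<Rightarrow> 'v set set \<Rightarrow> 'v set set" where
  "components V E = V // {(x, y). x \<in> V \<and> y \<in> V \<and> linked E x y}"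

definition edges_in :: "'v set set \<Rightarrow> 'v set \<Rightarrow> 'v set set" where
  "edges_in E C = {e \<in> E. e \<subseteq> C}"

definition properly_connected :: "nat \<Rightarrow> 'v set set \<Rightarrow> bool" where
  "properly_connected m E \<longleftrightarrow>
     (\<forall>u\<in>E. \<forall>v\<in>E. \<exists>es. es \<noteq> [] \<and> set es \<subseteq> E \<and> hd es = u \<and> last es = v \<and>
        successively (\<lambda>e f. card (e \<inter> f) = m - 1) es)"

definition pivot :: "'v set \<Rightarrow> 'v set set \<Rightarrow> ('v \<times> 'v) set" where
  "pivot V E = {(x, y). x \<in> V \<and> y \<in> V \<and>
     (\<exists>A. A \<subseteq> V - {x, y} \<and> {x} \<union> A \<in> E \<and> {y} \<union> A \<in> E)}"

definition pivot_classes :: "'v set \<Rightarrow> 'v set set \<Rightarrow> 'v set set" where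
  "pivot_classes V E = V // {(x, y). x \<in> V \<and> y \<in> V \<and> (x, y) \<in> (pivot V E)\<^sup>*}"


section \<open>Krull dimension and analytic spread\<close>

text \<open>The supremum over the empty set is \<open>0\<close> in \<^typ>\<open>enat\<close>, so the zero ring gets
  dimension \<open>0\<close> here. The special fiber ring of a proper ideal in a local ring is never zero.\<close>

definition krull_dim :: "('a, 'b) ring_scheme \<Rightarrow> enat" where
  "krull_dim R =
     Sup {enat n | n. \<exists>P :: nat \<Rightarrow> 'a set.
            (\<forall>i\<le>n. primeideal (P i) R) \<and> (\<forall>i<n. P i \<subset> P (Suc i))}"

abbreviation ideal_pow :: "('a, 'b) ring_scheme \<Rightarrow> 'a set \<Rightarrow> nat \<Rightarrow> 'a set" where
  "ideal_pow R I t \<equiv> I [^]\<^bsub>ideals_set R\<^esub> t"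

text \<open>The degree-zero element of the associated graded ring represented by \<open>a\<close>.\<close>

definition gr_of :: "('a, 'b) ring_scheme \<Rightarrow> 'a set \<Rightarrow> 'a \<Rightarrow> nat \<Rightarrow> 'a set" where
  "gr_of R I a = (\<lambda>t. ideal_pow R I (Suc t) +>\<^bsub>R\<^esub> (if t = 0 then a else \<zero>\<^bsub>R\<^esub>))"

text \<open>An element of \<open>\<Oplus>\<^sub>t I\<^sup>t / I\<^sup>t\<^sup>+\<^sup>1\<close> is the sequence of its homogeneous parts: the part in
  degree \<open>t\<close> is a coset \<open>a + I\<^sup>t\<^sup>+\<^sup>1\<close> with \<open>a \<in> I\<^sup>t\<close>, and all but finitely many
  parts are zero. The product of \<open>a + I\<^sup>i\<^sup>+\<^sup>1\<close> and \<open>b + I\<^sup>j\<^sup>+\<^sup>1\<close> is \<open>ab + I\<^sup>t\<^sup>+\<^sup>1\<close> for \<open>t = i + j\<close>;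
  the sum of these over \<open>i + j = t\<close> is taken in \<open>R / I\<^sup>t\<^sup>+\<^sup>1\<close>, which contains \<open>I\<^sup>t / I\<^sup>t\<^sup>+\<^sup>1\<close>.\<close>

definition assoc_graded :: "('a, 'b) ring_scheme \<Rightarrow> 'a set \<Rightarrow> (nat \<Rightarrow> 'a set) ring" where
  "assoc_graded R I =
     \<lparr>carrier = {f. (\<forall>t. \<exists>a\<in>ideal_pow R I t. f t = ideal_pow R I (Suc t) +>\<^bsub>R\<^esub> a) \<and>
                    finite {t. f t \<noteq> ideal_pow R I (Suc t)}},
      mult = (\<lambda>f g t. \<Oplus>\<^bsub>R Quot ideal_pow R I (Suc t)\<^esub>i\<in>{..t}.
                        rcoset_mult R (ideal_pow R I (Suc t)) (f i) (g (t - i))),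
      one = gr_of R I \<one>\<^bsub>R\<^esub>,
      zero = gr_of R I \<zero>\<^bsub>R\<^esub>,
      add = (\<lambda>f g t. f t <+>\<^bsub>R\<^esub> g t)\<rparr>"

definition max_ideal :: "('a, 'b) ring_scheme \<Rightarrow> 'a set" where
  "max_ideal R = (THE M. maximalideal M R)"

definition special_fiber :: "('a, 'b) ring_scheme \<Rightarrow> 'a set \<Rightarrow> (nat \<Rightarrow> 'a set) set ring" where
  "special_fiber R I =
     assoc_graded R I Quot (Idl\<^bsub>assoc_graded R I\<^esub> (gr_of R I ` max_ideal R))"

text \<open>Meaningful for Noetherian local rings \<open>R\<close>.\<close>

definition analytic_spread :: "('a, 'b) ring_scheme \<Rightarrow> 'a set \<Rightarrow> enat" where
  "analytic_spread R I = krull_dim (special_fiber R I)"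


section \<open>Localization\<close>

definition loc_rel :: "('a, 'b) ring_scheme \<Rightarrow> 'a set \<Rightarrow> (('a \<times> 'a) \<times> ('a \<times> 'a)) set" where
  "loc_rel R S =
     {((a, s), (b, t)). a \<in> carrier R \<and> s \<in> S \<and> b \<in> carrier R \<and> t \<in> S \<and>
        (\<exists>u\<in>S. u \<otimes>\<^bsub>R\<^esub> (a \<otimes>\<^bsub>R\<^esub> t) = u \<otimes>\<^bsub>R\<^esub> (b \<otimes>\<^bsub>R\<^esub> s))}"

definition frac :: "('a, 'b) ring_scheme \<Rightarrow> 'a set \<Rightarrow> 'a \<Rightarrow> 'a \<Rightarrow> ('a \<times> 'a) set" where
  "frac R S a s = loc_rel R S `` {(a, s)}"

definition localization :: "('a, 'b) ring_scheme \<Rightarrow> 'a set \<Rightarrow> ('a \<times> 'a) set ring" where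
  "localization R S =
     \<lparr>carrier = (carrier R \<times> S) // loc_rel R S,
      mult = (\<lambda>X Y. \<Union>(a, s)\<in>X. \<Union>(b, t)\<in>Y. frac R S (a \<otimes>\<^bsub>R\<^esub> b) (s \<otimes>\<^bsub>R\<^esub> t)),
      one = frac R S \<one>\<^bsub>R\<^esub> \<one>\<^bsub>R\<^esub>,
      zero = frac R S \<zero>\<^bsub>R\<^esub> \<one>\<^bsub>R\<^esub>,
      add = (\<lambda>X Y. \<Union>(a, s)\<in>X. \<Union>(b, t)\<in>Y.
               frac R S ((a \<otimes>\<^bsub>R\<^esub> t) \<oplus>\<^bsub>R\<^esub> (b \<otimes>\<^bsub>R\<^esub> s)) (s \<otimes>\<^bsub>R\<^esub> t))\<rparr>"


section \<open>Edge ideals\<close>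

text \<open>Polynomials over the field \<^typ>\<open>'k\<close> whose indeterminates are of type \<^typ>\<open>'v\<close>:
  finitely supported maps from exponent vectors to coefficients.\<close>

type_synonym ('v, 'k) mpoly = "('v \<Rightarrow>\<^sub>0 nat) \<Rightarrow>\<^sub>0 'k"

definition var :: "'v \<Rightarrow> ('v, 'k::field) mpoly" where
  "var x = Poly_Mapping.single (Poly_Mapping.single x 1) 1"

text \<open>The type argument of the following functions fixes the coefficient field.\<close>

definition node_poly_ring :: "'k::field itself \<Rightarrow> 'v set \<Rightarrow> ('v, 'k) mpoly ring" where
  "node_poly_ring K V =
     \<lparr>carrier = {p. \<forall>t\<in>Poly_Mapping.keys p. Poly_Mapping.keys t \<subseteq> V},
      mult = (*), one = 1, zero = 0, add = (+)\<rparr>"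

definition node_denominators :: "'k::field itself \<Rightarrow> 'v set \<Rightarrow> ('v, 'k) mpoly set" where
  "node_denominators K V =
     carrier (node_poly_ring K V) - Idl\<^bsub>node_poly_ring K V\<^esub> (var ` V)"

definition node_local_ring ::
    "'k::field itself \<Rightarrow> 'v set \<Rightarrow> (('v, 'k) mpoly \<times> ('v, 'k) mpoly) set ring" where
  "node_local_ring K V = localization (node_poly_ring K V) (node_denominators K V)"

definition edge_ideal ::
    "'k::field itself \<Rightarrow> 'v set \<Rightarrow> 'v set set \<Rightarrow> (('v, 'k) mpoly \<times> ('v, 'k) mpoly) set set" where
  "edge_ideal K V E =
     Idl\<^bsub>node_local_ring K V\<^esub>
       ((\<lambda>e. frac (node_poly_ring K V) (node_denominators K V) (\<Prod>x\<in>e. var x) 1) ` E)"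

end

(* The special fiber ring is isomorphic to the monoid algebra k[M] of the submonoid M of N^n
   generated by the incidence vectors of the edges: all generators of I have the same degree m, so
   the degree-t part of the special fiber is spanned by the monomials of degree m t in M, and these
   stay independent because an element of m I^t + I^(t+1) has order greater than m t.

   The Krull dimension of k[M] is the rank of the group generated by M. If r coordinates determine
   the elements of M, then at most (B + 1)^r of them have entries bounded by B, so any r + 1
   elements of k[M] are algebraically dependent; along a strict chain of r + 2 prime ideals such a
   relation would put a unit into the last one. Conversely, setting ever more of the r variables
   to 1 gives a chain of r + 1 prime ideals.

   Here r = n - p + c. Differences of pivot equivalent nodes lie in the group generated by M, and
   in a properly connected component all edges meet a pivot class in the same number of nodes.
   Hence an element of M is determined by its entries at all nodes except a representative of each
   pivot class, together with one of the representatives for each component. *)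

theory Submission
  imports Defs "HOL-Algebra.UnivPoly" "HOL-Algebra.Subrings"
begin

section \<open>Krull dimension and ring homomorphisms\<close>

text \<open>The product of the associated graded ring adds up cosets of varying ideals, so its ring
  axioms are awkward to check directly. They are inherited from the Rees ring of polynomials
  \<open>\<Sum> a_t T^t\<close> with \<open>a_t\<close> in \<open>I^t\<close>, a subring of a
  polynomial ring that maps onto the graded ring by reducing \<open>a_t\<close> modulo
  \<open>I^(t+1)\<close>. The same surjection gives an induction principle for the special fiber,
  with generators in degrees 0 and 1, and lets kernel elements be compared through elements of the
  local ring instead of cosets.

  Both bounds on the Krull dimension avoid transcendence degree. They need one enumeration of
  \<open>r\<close> nodes with two properties: the \<open>r\<close> entries determine an element of
  \<open>M\<close>, and each entry separates two elements of \<open>M\<close> that agree in the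
  earlier entries. The triangular second property replaces linear independence; it already makes
  consecutive kernels different. For the first, the number of edges in each component is recovered
  from a pivot class all of whose entries are known.\<close>

lemma cring_image:
  assumes "cring R" "h \<in> ring_hom R S" "h ` carrier R = carrier S" "h \<zero>\<^bsub>R\<^esub> = \<zero>\<^bsub>S\<^esub>"
  shows "cring S"
proof -
  interpret R: cring R by fact
  \<comment> \<open>The fact on images yields the record with carrier and zero replaced by their
    images. Since \<open>S\<close> is not known to be a ring yet, preservation of zero has to be
    assumed; with surjectivity it identifies this record with \<open>S\<close>.\<close>
  have "ring (S \<lparr>carrier := h ` carrier R, zero := h \<zero>\<^bsub>R\<^esub>\<rparr>)"
    by (rule R.ring_hom_imp_img_ring[OF assms(2)])
  then have S: "ring S" using assms(3,4) by simp
  show ?thesis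
  proof (intro cring.intro comm_monoid.intro comm_monoid_axioms.intro)
    show "ring S" by (fact S)
    show "monoid S" using S by (simp add: ring_def)
    fix x y assume "x \<in> carrier S" "y \<in> carrier S"
    then obtain a b where "a \<in> carrier R" "x = h a" "b \<in> carrier R" "y = h b"
      using assms(3) by (metis imageE)
    then show "x \<otimes>\<^bsub>S\<^esub> y = y \<otimes>\<^bsub>S\<^esub> x"
      using ring_hom_mult[OF assms(2)] R.m_comm by metis
  qed
qed

text \<open>Preimages of prime ideals are prime, and surjectivity of \<open>h\<close> keeps
  inclusions strict, so every chain of \<open>S\<close> pulls back to a chain of the same
  length.\<close>

lemma krull_dim_mono_iso:
  assumes "cring R" "cring S" "h \<in> ring_iso R S"
  shows "krull_dim S \<le> krull_dim R"
  unfolding krull_dim_def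
proof (rule Sup_subset_mono, safe)
  fix n and P :: "nat \<Rightarrow> 'c set"
  assume P: "\<forall>i\<le>n. primeideal (P i) S" "\<forall>i<n. P i \<subset> P (Suc i)"
  interpret R: cring R by fact
  interpret S: cring S by fact
  have hom: "h \<in> ring_hom R S" and surj: "h ` carrier R = carrier S"
    using assms(3) by (auto simp: ring_iso_def bij_betw_def)
  interpret h: ring_hom_ring R S h
    using hom by (rule ring_hom_ringI2[OF R.ring_axioms S.ring_axioms])
  let ?Q = "\<lambda>i. {r \<in> carrier R. h r \<in> P i}"
  have "\<forall>i\<le>n. primeideal (?Q i) R"
    using P h.primeideal_vimage[OF R.is_cring] by blast
  moreover have "?Q i \<subset> ?Q (Suc i)" if "i < n" for i
  proof -
    have "P i \<subset> P (Suc i)" using P(2) that by simp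
    then obtain y where y: "y \<in> P (Suc i)" "y \<notin> P i" by blast
    have "ideal (P (Suc i)) S" using P(1) that by (simp add: primeideal.axioms(1))
    then have "y \<in> carrier S" using y(1) by (rule ideal.Icarr)
    then obtain x where "x \<in> carrier R" "h x = y" using surj by (metis imageE)
    then have "x \<in> ?Q (Suc i)" "x \<notin> ?Q i" using y by auto
    moreover have "?Q i \<subseteq> ?Q (Suc i)" using \<open>P i \<subset> P (Suc i)\<close> by auto
    ultimately show ?thesis by (metis psubsetI)
  qed
  ultimately show "\<exists>m. enat n = enat m \<and> (\<exists>P. (\<forall>i\<le>m. primeideal (P i) R) \<and> (\<forall>i<m. P i \<subset> P (Suc i)))"
    by (intro exI[of _ n] conjI refl exI[of _ ?Q]) blast+
qed

lemma krull_dim_iso: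
  assumes "cring R" "cring S" "h \<in> ring_iso R S"
  shows "krull_dim R = krull_dim S"
proof (rule antisym)
  show "krull_dim S \<le> krull_dim R" by (rule krull_dim_mono_iso[OF assms])
  have "inv_into (carrier R) h \<in> ring_iso S R"
    using assms by (intro ring_iso_set_sym) (auto simp: cring_def)
  then show "krull_dim R \<le> krull_dim S" by (rule krull_dim_mono_iso[OF assms(2,1)])
qed

text \<open>Surjectivity lets every element of \<open>S\<close> be lifted before multiplying. This
  carries an ideal of the Rees ring down to the associated graded ring.\<close>

lemma ideal_image_surj:
  assumes "ring R" "ring S" "h \<in> ring_hom R S" "h ` carrier R = carrier S" "ideal J R"
  shows "ideal (h ` J) S"
proof -
  interpret h: ring_hom_ring R S h by (rule ring_hom_ringI2[OF assms(1-3)])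
  interpret J: ideal J R by fact
  have Jc: "a \<in> carrier R" if "a \<in> J" for a using that by (rule J.Icarr)
  show ?thesis
  proof (rule idealI)
    show "ring S" by fact
    show "subgroup (h ` J) (add_monoid S)"
      using h.img_is_add_subgroup[OF J.a_subgroup] .
    fix a x assume "a \<in> h ` J" "x \<in> carrier S"
    then obtain b y where *: "b \<in> J" "a = h b" "y \<in> carrier R" "x = h y" using assms(4) by (metis imageE)
    have "x \<otimes>\<^bsub>S\<^esub> a = h (y \<otimes>\<^bsub>R\<^esub> b)" "a \<otimes>\<^bsub>S\<^esub> x = h (b \<otimes>\<^bsub>R\<^esub> y)" using * Jc by simp_all
    then show "x \<otimes>\<^bsub>S\<^esub> a \<in> h ` J" "a \<otimes>\<^bsub>S\<^esub> x \<in> h ` J"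
      using * J.I_l_closed J.I_r_closed by blast+
  qed
qed

section \<open>Monoid algebras\<close>

text \<open>The semigroup ring \<open>k[M]\<close>: the product of finitely supported maps is
  convolution over the ambient monoid, so only supports have to be restricted. Both the polynomial
  ring on the nodes and, up to isomorphism, the special fiber have this form.\<close>

definition monoid_algebra :: "'k::field itself \<Rightarrow> 'a::comm_monoid_add set \<Rightarrow> ('a \<Rightarrow>\<^sub>0 'k) ring" where
  "monoid_algebra K M =
     \<lparr>carrier = {p. Poly_Mapping.keys p \<subseteq> M}, mult = (*), one = 1, zero = 0, add = (+)\<rparr>"

lemma monoid_algebra_simps [simp]:
  "carrier (monoid_algebra K M) = {p. Poly_Mapping.keys p \<subseteq> M}"
  "mult (monoid_algebra K M) = (*)" "one (monoid_algebra K M) = 1"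
  "zero (monoid_algebra K M) = 0" "add (monoid_algebra K M) = (+)"
  by (auto simp: monoid_algebra_def)

definition add_submonoid :: "'a::comm_monoid_add set \<Rightarrow> bool" where
  "add_submonoid M \<longleftrightarrow> 0 \<in> M \<and> (\<forall>x\<in>M. \<forall>y\<in>M. x + y \<in> M)"

lemma keys_mult_add_submonoid:
  assumes "add_submonoid M" "Poly_Mapping.keys p \<subseteq> M" "Poly_Mapping.keys q \<subseteq> M"
  shows "Poly_Mapping.keys (p * q) \<subseteq> M"
  using keys_mult[of p q] assms unfolding add_submonoid_def by blast

lemma keys_prod_add_submonoid:
  assumes "add_submonoid M" "\<And>i. i \<in> I \<Longrightarrow> Poly_Mapping.keys (f i :: _ \<Rightarrow>\<^sub>0 'k::field) \<subseteq> M"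
  shows "Poly_Mapping.keys (prod f I) \<subseteq> M"
  using assms(2)
proof (induction I rule: infinite_finite_induct)
  case (insert x F)
  then show ?case by (simp add: keys_mult_add_submonoid[OF assms(1)])
qed (use assms in \<open>auto simp: add_submonoid_def\<close>)

lemma cring_monoid_algebra:
  assumes "add_submonoid M"
  shows "cring (monoid_algebra (K :: 'k::field itself) M)"
proof (rule cringI)
  show "abelian_group (monoid_algebra K M)"
  proof (rule abelian_groupI)
    fix x assume "x \<in> carrier (monoid_algebra K M)"
    then show "\<exists>y\<in>carrier (monoid_algebra K M). y \<oplus>\<^bsub>monoid_algebra K M\<^esub> x = \<zero>\<^bsub>monoid_algebra K M\<^esub>"
      by (intro bexI[of _ "- x"]) (auto simp: keys_def)
  qed (use keys_add in \<open>force simp: algebra_simps\<close>)+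
  show "comm_monoid (monoid_algebra K M)"
    using assms
    by (intro comm_monoidI) (simp_all add: keys_mult_add_submonoid mult_ac add_submonoid_def)
qed (auto simp: algebra_simps)

lemma finsum_monoid_algebra:
  assumes "add_submonoid M" "finite I" "\<And>i. i \<in> I \<Longrightarrow> Poly_Mapping.keys (f i) \<subseteq> M"
  shows "finsum (monoid_algebra (K :: 'k::field itself) M) f I = sum f I"
proof -
  interpret cring "monoid_algebra K M" by (rule cring_monoid_algebra[OF assms(1)])
  show ?thesis using assms(2,3)
    by (induction I rule: finite_induct) (auto simp: Pi_iff)
qed

lemma node_poly_ring_eq: "node_poly_ring K V = monoid_algebra K {t. Poly_Mapping.keys t \<subseteq> V}"
  by (auto simp: node_poly_ring_def monoid_algebra_def)

lemma add_submonoid_exponents: "add_submonoid {t :: 'v \<Rightarrow>\<^sub>0 nat. Poly_Mapping.keys t \<subseteq> V}"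
  using keys_add unfolding add_submonoid_def by fastforce

section \<open>Linear extension of maps of monomials\<close>

text \<open>A ring homomorphism when \<open>g\<close> is additive with \<open>g 0 = 0\<close>.
  Coefficients of monomials with the same image are added up, which is where kernels come
  from.\<close>

definition monomial_map :: "('a \<Rightarrow> 'b) \<Rightarrow> ('a \<Rightarrow>\<^sub>0 'k::comm_monoid_add) \<Rightarrow> 'b \<Rightarrow>\<^sub>0 'k" where
  "monomial_map g p = (\<Sum>u\<in>Poly_Mapping.keys p. Poly_Mapping.single (g u) (Poly_Mapping.lookup p u))"

lemma monomial_map_superset:
  assumes "finite A" "Poly_Mapping.keys p \<subseteq> A"
  shows "monomial_map g p = (\<Sum>u\<in>A. Poly_Mapping.single (g u) (Poly_Mapping.lookup p u))"
  unfolding monomial_map_def using assms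
  by (intro sum.mono_neutral_left) (auto simp: in_keys_iff)

lemma monomial_map_single [simp]:
  "monomial_map g (Poly_Mapping.single u c) = Poly_Mapping.single (g u) c"
  by (subst monomial_map_superset[of "{u}"]) auto

lemma monomial_map_0 [simp]: "monomial_map g 0 = 0"
  by (simp add: monomial_map_def)

lemma monomial_map_add: "monomial_map g (p + q) = monomial_map g p + monomial_map g q"
proof -
  let ?A = "Poly_Mapping.keys p \<union> Poly_Mapping.keys q"
  have "Poly_Mapping.keys (p + q) \<subseteq> ?A" by (rule keys_add)
  then have "monomial_map g (p + q) =
      (\<Sum>u\<in>?A. Poly_Mapping.single (g u) (Poly_Mapping.lookup p u) +
        Poly_Mapping.single (g u) (Poly_Mapping.lookup q u))"
    by (subst monomial_map_superset[of ?A]) (auto simp: lookup_add single_add)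
  also have "\<dots> = monomial_map g p + monomial_map g q"
    by (simp add: sum.distrib monomial_map_superset[of ?A])
  finally show ?thesis .
qed

lemma monomial_map_sum: "monomial_map g (sum f I) = (\<Sum>i\<in>I. monomial_map g (f i))"
  by (induction I rule: infinite_finite_induct) (auto simp: monomial_map_add)

lemma poly_mapping_sum_single:
  "(p :: 'a \<Rightarrow>\<^sub>0 'k::comm_monoid_add) =
    (\<Sum>u\<in>Poly_Mapping.keys p. Poly_Mapping.single u (Poly_Mapping.lookup p u))"
  by (rule poly_mapping_eqI) (auto simp: lookup_sum lookup_single when_def in_keys_iff)

lemma monomial_map_mult:
  fixes p q :: "'a::comm_monoid_add \<Rightarrow>\<^sub>0 'k::comm_semiring_1"
  assumes g: "\<And>u v. g (u + v) = g u + g v"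
  shows "monomial_map g (p * q) = monomial_map g p * monomial_map g q"
proof -
  have "monomial_map g (p * q) = monomial_map g
      ((\<Sum>u\<in>Poly_Mapping.keys p. Poly_Mapping.single u (Poly_Mapping.lookup p u)) *
       (\<Sum>v\<in>Poly_Mapping.keys q. Poly_Mapping.single v (Poly_Mapping.lookup q v)))"
    using poly_mapping_sum_single[of p] poly_mapping_sum_single[of q] by simp
  also have "\<dots> = monomial_map g p * monomial_map g q"
    by (simp add: sum_product monomial_map_sum mult_single g)
      (simp add: monomial_map_def sum_product mult_single)
  finally show ?thesis .
qed

lemma monomial_map_comp: "monomial_map g (monomial_map h p) = monomial_map (\<lambda>u. g (h u)) p"
  by (subst (2) monomial_map_def) (simp add: monomial_map_sum, simp add: monomial_map_def)

lemma monomial_map_one: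
  assumes "g 0 = 0"
  shows "monomial_map g (1 :: 'a::zero \<Rightarrow>\<^sub>0 'k::comm_semiring_1) = 1"
  using assms by (metis monomial_map_single single_one)

lemma lookup_scalar_mult:
  "Poly_Mapping.lookup (Poly_Mapping.single 0 c * (p :: 'a::comm_monoid_add \<Rightarrow>\<^sub>0 'k::comm_semiring_1)) u =
    c * Poly_Mapping.lookup p u"
  by (simp add: map.rep_eq when_def flip: mult_map_scale_conv_mult)

text \<open>The kernels are prime ideals because \<^typ>\<open>(nat \<Rightarrow>\<^sub>0 nat) \<Rightarrow>\<^sub>0 'k\<close> is an integral domain.\<close>

lemma primeideal_monomial_kernel:
  fixes g :: "'a::comm_monoid_add \<Rightarrow> (nat \<Rightarrow>\<^sub>0 nat)"
  assumes M: "add_submonoid M" and g: "\<And>u v. g (u + v) = g u + g v" "g 0 = 0"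
  shows "primeideal {p. Poly_Mapping.keys p \<subseteq> M \<and> monomial_map g p = 0}
    (monoid_algebra (K :: 'k::field itself) M)"
proof (rule primeidealI2)
  let ?A = "monoid_algebra K M" and ?P = "{p :: 'a \<Rightarrow>\<^sub>0 'k. Poly_Mapping.keys p \<subseteq> M \<and> monomial_map g p = 0}"
  interpret A: cring ?A by (rule cring_monoid_algebra[OF M])
  show "cring ?A" by (rule A.is_cring)
  have uminus: "\<ominus>\<^bsub>?A\<^esub> p = - p" if "Poly_Mapping.keys p \<subseteq> M" for p
    using that by (intro A.minus_equality) auto
  have neg: "monomial_map g (- p :: 'a \<Rightarrow>\<^sub>0 'k) = - monomial_map g p" for p
    using monomial_map_add[of g p "- p"] by (simp add: eq_neg_iff_add_eq_0 add.commute)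
  show "additive_subgroup ?P ?A"
  proof (rule additive_subgroup.intro, rule subgroup.intro)
    show "?P \<subseteq> carrier (add_monoid ?A)" by auto
    show "\<one>\<^bsub>add_monoid ?A\<^esub> \<in> ?P" by simp
    show "inv\<^bsub>add_monoid ?A\<^esub> a \<in> ?P" if "a \<in> ?P" for a
      using that uminus neg unfolding a_inv_def[symmetric] by simp
    show "a \<otimes>\<^bsub>add_monoid ?A\<^esub> b \<in> ?P" if "a \<in> ?P" "b \<in> ?P" for a b
      using that keys_add[of a b] by (auto simp: monomial_map_add)
  qed
  show "x \<otimes>\<^bsub>?A\<^esub> a \<in> ?P" "a \<otimes>\<^bsub>?A\<^esub> x \<in> ?P" if "a \<in> ?P" "x \<in> carrier ?A" for a x
    using that keys_mult_add_submonoid[OF M, of x a] keys_mult_add_submonoid[OF M, of a x]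
    by (simp_all add: monomial_map_mult g)
  show "carrier ?A \<noteq> ?P"
  proof
    assume "carrier ?A = ?P"
    moreover have "1 \<in> carrier ?A" using M by (simp add: add_submonoid_def)
    ultimately have "1 \<in> ?P" by simp
    then show False using monomial_map_one[of g] g(2) by (metis (mono_tags, lifting) mem_Collect_eq zero_neq_one)
  qed
  show "a \<in> ?P \<or> b \<in> ?P" if "a \<in> carrier ?A" "b \<in> carrier ?A" "a \<otimes>\<^bsub>?A\<^esub> b \<in> ?P" for a b
    using that by (auto simp: monomial_map_mult g)
qed

section \<open>Lower bound: prime ideals from coordinate projections\<close>

text \<open>On polynomials this sets the variables other than \<open>s 0\<close>, ...,
  \<open>s (j - 1)\<close> to 1. The node type carries no linear order; indexing the target by
  \<open>nat\<close> makes it an integral domain all the same.\<close>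

definition coord_proj :: "(nat \<Rightarrow> 'v) \<Rightarrow> nat \<Rightarrow> ('v \<Rightarrow>\<^sub>0 nat) \<Rightarrow> (nat \<Rightarrow>\<^sub>0 nat)" where
  "coord_proj s j u = (\<Sum>i<j. Poly_Mapping.single i (Poly_Mapping.lookup u (s i)))"

lemma lookup_coord_proj:
  "Poly_Mapping.lookup (coord_proj s j u) i = (if i < j then Poly_Mapping.lookup u (s i) else 0)"
  by (auto simp: coord_proj_def lookup_sum lookup_single when_def)

lemma coord_proj_add: "coord_proj s j (u + v) = coord_proj s j u + coord_proj s j v"
  by (rule poly_mapping_eqI) (simp add: lookup_coord_proj lookup_add)

lemma coord_proj_0: "coord_proj s j 0 = 0"
  by (rule poly_mapping_eqI) (simp add: lookup_coord_proj)

lemma coord_proj_comp: "i \<le> j \<Longrightarrow> coord_proj id i (coord_proj s j u) = coord_proj s i u"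
  by (rule poly_mapping_eqI) (simp add: lookup_coord_proj)

text \<open>Each projection factors through those that keep more coordinates, so the kernels are
  nested. Strictness asks only that coordinate \<open>s j\<close> tell apart two elements of
  \<open>M\<close> that the earlier coordinates do not.\<close>

lemma krull_dim_monoid_algebra_ge:
  fixes M :: "('v \<Rightarrow>\<^sub>0 nat) set"
  assumes M: "add_submonoid M"
    and sep: "\<And>j. j < r \<Longrightarrow> \<exists>u\<in>M. \<exists>v\<in>M.
      (\<forall>i<j. Poly_Mapping.lookup u (s i) = Poly_Mapping.lookup v (s i)) \<and>
      Poly_Mapping.lookup u (s j) \<noteq> Poly_Mapping.lookup v (s j)"
  shows "enat r \<le> krull_dim (monoid_algebra (K :: 'k::field itself) M)"
  unfolding krull_dim_def
proof (rule Sup_upper, intro CollectI exI conjI allI impI)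
  \<comment> \<open>Fewer coordinates are kept as the index grows, so that the ideals increase; at
    index \<open>r\<close> none is left and the kernel is the augmentation ideal.\<close>
  let ?P = "\<lambda>i. {p :: _ \<Rightarrow>\<^sub>0 'k. Poly_Mapping.keys p \<subseteq> M \<and> monomial_map (coord_proj s (r - i)) p = 0}"
  show "enat r = enat r" ..
  fix i
  show "primeideal (?P i) (monoid_algebra K M)"
    by (rule primeideal_monomial_kernel[OF M]) (auto simp: coord_proj_add coord_proj_0)
  assume "i < r"
  then obtain j where j: "j < r" "r - Suc i = j" "r - i = Suc j"
    by (metis Suc_diff_Suc diff_Suc_less less_trans_Suc not_less0 bot_nat_0.not_eq_extremum)
  have "?P i \<subseteq> ?P (Suc i)"
  proof safe
    fix p :: "('v \<Rightarrow>\<^sub>0 nat) \<Rightarrow>\<^sub>0 'k" assume *: "monomial_map (coord_proj s (r - i)) p = 0"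
    have "monomial_map (coord_proj s j) p =
        monomial_map (coord_proj id j) (monomial_map (coord_proj s (Suc j)) p)"
      by (simp add: monomial_map_comp coord_proj_comp)
    then show "monomial_map (coord_proj s (r - Suc i)) p = 0" using * j by simp
  qed
  moreover obtain u v where uv: "u \<in> M" "v \<in> M"
    "\<And>i. i < j \<Longrightarrow> Poly_Mapping.lookup u (s i) = Poly_Mapping.lookup v (s i)"
    "Poly_Mapping.lookup u (s j) \<noteq> Poly_Mapping.lookup v (s j)"
    using sep[OF j(1)] by blast
  \<comment> \<open>The binomial \<open>X^u - X^v\<close> is killed by a projection exactly when
    \<open>u\<close> and \<open>v\<close> have the same image, so it separates the two
    kernels.\<close>
  let ?z = "Poly_Mapping.single u (1::'k) + Poly_Mapping.single v (-1)"
  have "coord_proj s j u = coord_proj s j v"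
    by (rule poly_mapping_eqI) (simp add: lookup_coord_proj uv)
  then have "monomial_map (coord_proj s j) ?z = 0"
    by (simp add: monomial_map_add flip: single_add)
  moreover have "Poly_Mapping.keys ?z \<subseteq> M"
    using keys_add[of "Poly_Mapping.single u (1::'k)" "Poly_Mapping.single v (-1)"] uv by auto
  moreover have "monomial_map (coord_proj s (Suc j)) ?z \<noteq> 0"
  proof
    assume "monomial_map (coord_proj s (Suc j)) ?z = 0"
    then have "Poly_Mapping.lookup (monomial_map (coord_proj s (Suc j)) ?z) (coord_proj s (Suc j) u) = 0"
      by simp
    moreover have "coord_proj s (Suc j) u \<noteq> coord_proj s (Suc j) v"
      using uv(4) by (metis lookup_coord_proj lessI)
    ultimately show False
      by (simp add: monomial_map_add lookup_add lookup_single when_def)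
  qed
  ultimately have "?P i \<subseteq> ?P (Suc i)" "?z \<in> ?P (Suc i)" "?z \<notin> ?P i" using j by auto
  then show "?P i \<subset> ?P (Suc i)" by blast
qed

section \<open>Upper bound: algebraic dependence by counting monomials\<close>

text \<open>Gaussian elimination, by induction on the equations \<open>T\<close>: an unknown
  \<open>s0\<close> with nonzero coefficient in equation \<open>t\<close> is eliminated, which
  removes one unknown and one equation.\<close>

lemma linear_relation_exists:
  fixes a :: "'s \<Rightarrow> 't \<Rightarrow> 'k::field"
  assumes "finite T" "finite S" "card T < card S"
  shows "\<exists>c. (\<exists>s\<in>S. c s \<noteq> 0) \<and> (\<forall>t\<in>T. (\<Sum>s\<in>S. c s * a s t) = 0)"
  using assms
proof (induction T arbitrary: S a rule: finite_induct)
  case empty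
  then obtain s where "s \<in> S" by fastforce
  then show ?case by (intro exI[of _ "\<lambda>_. 1"]) auto
next
  case (insert t T)
  show ?case
  proof (cases "\<forall>s\<in>S. a s t = 0")
    case True
    have "card T < card S" using insert by simp
    then obtain c where "(\<exists>s\<in>S. c s \<noteq> 0) \<and> (\<forall>t\<in>T. (\<Sum>s\<in>S. c s * a s t) = 0)"
      using insert.IH[OF insert.prems(1)] by blast
    then show ?thesis using True by (intro exI[of _ c]) auto
  next
    case False
    then obtain s0 where s0: "s0 \<in> S" "a s0 t \<noteq> 0" by blast
    let ?S = "S - {s0}"
    define b where "b s t' = a s t' - a s t / a s0 t * a s0 t'" for s t'
    have "card T < card ?S" using insert s0 by (simp add: card_Diff_singleton_if)
    then obtain c where c: "\<exists>s\<in>?S. c s \<noteq> 0" "\<And>t'. t' \<in> T \<Longrightarrow> (\<Sum>s\<in>?S. c s * b s t') = 0"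
      using insert.IH[of ?S b] insert.prems(1) by blast
    \<comment> \<open>The value at \<open>s0\<close> is the one forced by equation \<open>t\<close>.
      With it the full sum equals the reduced sum for every \<open>t'\<close>.\<close>
    define d where "d s = (if s = s0 then - (\<Sum>s\<in>?S. c s * a s t / a s0 t) else c s)" for s
    have sum: "(\<Sum>s\<in>S. d s * a s t') = (\<Sum>s\<in>?S. c s * b s t')" for t'
    proof -
      have "(\<Sum>s\<in>S. d s * a s t') = d s0 * a s0 t' + (\<Sum>s\<in>?S. c s * a s t')"
        using insert.prems(1) s0(1) by (subst sum.remove[of _ s0]) (auto simp: d_def intro!: sum.cong)
      also have "\<dots> = (\<Sum>s\<in>?S. c s * b s t')"
        by (simp add: d_def b_def algebra_simps sum_subtractf sum_distrib_left sum_distrib_right sum_negf)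
      finally show ?thesis .
    qed
    have "b s t = 0" for s using s0 by (simp add: b_def)
    then have "\<forall>t'\<in>insert t T. (\<Sum>s\<in>S. d s * a s t') = 0"
      unfolding sum using c(2) by auto
    moreover have "\<exists>s\<in>S. d s \<noteq> 0" using c(1) by (auto simp: d_def)
    ultimately show ?thesis by blast
  qed
qed

text \<open>Bounding each exponent separately, not the total degree, makes the number of monomials
  at most a plain power: \<open>(B + 1) ^ r\<close> if \<open>r\<close> coordinates determine
  them.\<close>

definition exp_bounded :: "nat \<Rightarrow> (('v \<Rightarrow>\<^sub>0 nat) \<Rightarrow>\<^sub>0 'k::zero) \<Rightarrow> bool" where
  "exp_bounded B p \<longleftrightarrow> (\<forall>u\<in>Poly_Mapping.keys p. \<forall>x. Poly_Mapping.lookup u x \<le> B)"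

lemma exp_bounded_ex:
  fixes p :: "('v \<Rightarrow>\<^sub>0 nat) \<Rightarrow>\<^sub>0 'k::zero"
  shows "\<exists>B. exp_bounded B p"
proof -
  have "\<exists>B. \<forall>x. Poly_Mapping.lookup u x \<le> B" for u :: "'v \<Rightarrow>\<^sub>0 nat"
  proof -
    have "Poly_Mapping.lookup u x \<le> (\<Sum>y\<in>Poly_Mapping.keys u. Poly_Mapping.lookup u y)" for x
      by (cases "x \<in> Poly_Mapping.keys u") (auto intro: member_le_sum simp: in_keys_iff)
    then show ?thesis by blast
  qed
  then obtain B where B: "\<And>u x. Poly_Mapping.lookup (u :: 'v \<Rightarrow>\<^sub>0 nat) x \<le> B u" by metis
  have "exp_bounded (\<Sum>u\<in>Poly_Mapping.keys p. B u) p"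
    unfolding exp_bounded_def
  proof safe
    fix u x assume "u \<in> Poly_Mapping.keys p"
    then have "B u \<le> (\<Sum>u\<in>Poly_Mapping.keys p. B u)" by (intro member_le_sum) auto
    then show "Poly_Mapping.lookup u x \<le> (\<Sum>u\<in>Poly_Mapping.keys p. B u)" using B le_trans by blast
  qed
  then show ?thesis by blast
qed

lemma exp_bounded_mono: "exp_bounded B p \<Longrightarrow> B \<le> C \<Longrightarrow> exp_bounded C p"
  unfolding exp_bounded_def by (meson le_trans)

lemma exp_bounded_mult:
  assumes "exp_bounded B p" "exp_bounded C q"
  shows "exp_bounded (B + C) (p * q)"
  unfolding exp_bounded_def
proof safe
  fix w x assume "w \<in> Poly_Mapping.keys (p * q)"
  then obtain u v where "w = u + v" "u \<in> Poly_Mapping.keys p" "v \<in> Poly_Mapping.keys q"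
    using keys_mult by blast
  then show "Poly_Mapping.lookup w x \<le> B + C"
    using assms by (simp add: exp_bounded_def lookup_add add_mono)
qed

lemma exp_bounded_one: "exp_bounded 0 (1 :: ('v \<Rightarrow>\<^sub>0 nat) \<Rightarrow>\<^sub>0 'k::comm_semiring_1)"
  by (simp add: exp_bounded_def)

lemma exp_bounded_power:
  fixes p :: "('v \<Rightarrow>\<^sub>0 nat) \<Rightarrow>\<^sub>0 'k::comm_semiring_1"
  shows "exp_bounded B p \<Longrightarrow> exp_bounded (k * B) (p ^ k)"
  by (induction k) (auto simp: exp_bounded_one exp_bounded_mult)

lemma exp_bounded_prod:
  assumes "\<And>i. i < N \<Longrightarrow> exp_bounded B (f i)"
  shows "exp_bounded (N * B) (\<Prod>i<N. f i :: ('v \<Rightarrow>\<^sub>0 nat) \<Rightarrow>\<^sub>0 'k::comm_semiring_1)"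
  using assms
proof (induction N)
  case (Suc N)
  then have "exp_bounded (N * B + B) ((\<Prod>i<N. f i) * f N)" by (intro exp_bounded_mult) auto
  then show ?case by (simp add: add.commute)
qed (simp add: exp_bounded_one)

lemma keys_power_add_submonoid:
  assumes "add_submonoid M" "Poly_Mapping.keys (p :: _ \<Rightarrow>\<^sub>0 'k::field) \<subseteq> M"
  shows "Poly_Mapping.keys (p ^ n) \<subseteq> M"
  using assms by (induction n) (auto simp: keys_mult_add_submonoid add_submonoid_def simp del: subset_iff)

lemma primeideal_monoid_algebraD:
  assumes "primeideal P (monoid_algebra (K :: 'k::field itself) M)"
  shows "\<And>x. x \<in> P \<Longrightarrow> Poly_Mapping.keys x \<subseteq> M"
    "\<And>x y. x \<in> P \<Longrightarrow> y \<in> P \<Longrightarrow> x + y \<in> P"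
    "\<And>x y. x \<in> P \<Longrightarrow> Poly_Mapping.keys y \<subseteq> M \<Longrightarrow> y * x \<in> P"
    "\<And>x y. Poly_Mapping.keys x \<subseteq> M \<Longrightarrow> Poly_Mapping.keys y \<subseteq> M \<Longrightarrow> x * y \<in> P \<Longrightarrow> x \<in> P \<or> y \<in> P"
    "0 \<in> P" "1 \<notin> P"
proof -
  interpret P: primeideal P "monoid_algebra K M" by fact
  show "\<And>x. x \<in> P \<Longrightarrow> Poly_Mapping.keys x \<subseteq> M" using P.Icarr by simp
  show "\<And>x y. x \<in> P \<Longrightarrow> y \<in> P \<Longrightarrow> x + y \<in> P"
    using additive_subgroup.a_closed[OF ideal.axioms(1)[OF P.is_ideal]] by simp
  show "\<And>x y. x \<in> P \<Longrightarrow> Poly_Mapping.keys y \<subseteq> M \<Longrightarrow> y * x \<in> P" using P.I_l_closed by simp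
  show "\<And>x y. Poly_Mapping.keys x \<subseteq> M \<Longrightarrow> Poly_Mapping.keys y \<subseteq> M \<Longrightarrow> x * y \<in> P \<Longrightarrow> x \<in> P \<or> y \<in> P"
    using P.I_prime by simp
  show "0 \<in> P" using additive_subgroup.zero_closed[OF ideal.axioms(1)[OF P.is_ideal]] by simp
  show "1 \<notin> P" using P.one_imp_carrier P.I_notcarr by auto
qed

lemma primeideal_power_cancel:
  assumes P: "primeideal P (monoid_algebra (K :: 'k::field itself) M)" and M: "add_submonoid M"
    and "Poly_Mapping.keys z \<subseteq> M" "z \<notin> P" "Poly_Mapping.keys w \<subseteq> M" "z ^ n * w \<in> P"
  shows "w \<in> P"
  using assms(6)
proof (induction n)
  case (Suc n)
  have "Poly_Mapping.keys (z ^ n * w) \<subseteq> M"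
    by (intro keys_mult_add_submonoid[OF M] keys_power_add_submonoid[OF M] assms)
  then have "z ^ n * w \<in> P"
    using primeideal_monoid_algebraD(4)[OF P assms(3)] Suc.prems assms(4) by (auto simp: mult.assoc)
  then show ?case by (rule Suc.IH)
qed simp

text \<open>If \<open>Q(z\<^sub>0, z\<^sub>1, \<dots>) = 0\<close>, factor out the least power of \<open>z\<^sub>0 \<notin> P\<^sub>0\<close> and
  reduce modulo \<open>z\<^sub>0 \<in> P\<^sub>1\<close>: a nontrivial relation in the remaining elements holds modulo
  \<open>P\<^sub>1\<close>. Iterating ends with a nonzero constant in the last prime ideal.\<close>

lemma prime_chain_no_relation:
  fixes z :: "nat \<Rightarrow> 'a::comm_monoid_add \<Rightarrow>\<^sub>0 'k::field"
  assumes M: "add_submonoid M"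
    and P: "\<And>i. i \<le> N \<Longrightarrow> primeideal (P i) (monoid_algebra (K :: 'k itself) M)"
    and z: "\<And>i. i < N \<Longrightarrow> z i \<in> P (Suc i)" "\<And>i. i < N \<Longrightarrow> z i \<notin> P i"
      "\<And>i. i < N \<Longrightarrow> P i \<subseteq> P (Suc i)"
    and T: "finite T" "T \<noteq> {}" "T \<subseteq> extensional {..<N}" "\<And>a. a \<in> T \<Longrightarrow> c a \<noteq> 0"
    and rel: "(\<Sum>a\<in>T. Poly_Mapping.single 0 (c a) * (\<Prod>i<N. z i ^ a i)) = 0"
  shows False
proof -
  define w where "w j a = Poly_Mapping.single 0 (c a) * (\<Prod>i\<in>{j..<N}. z i ^ a i)" for j a
  have zM: "Poly_Mapping.keys (z i) \<subseteq> M" if "i < N" for i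
    using primeideal_monoid_algebraD(1)[OF P] z(1) that by (metis Suc_leI)
  have "0 \<in> M" using M by (simp add: add_submonoid_def)
  then have scalM: "Poly_Mapping.keys (Poly_Mapping.single 0 x) \<subseteq> M" for x :: 'k by simp
  have wM: "Poly_Mapping.keys (w j a) \<subseteq> M" for j a
    unfolding w_def
    by (intro keys_mult_add_submonoid[OF M] scalM keys_prod_add_submonoid[OF M] keys_power_add_submonoid[OF M])
      (auto dest: zM)
  have sumM: "Poly_Mapping.keys (sum f A) \<subseteq> M" if "\<And>a. a \<in> A \<Longrightarrow> Poly_Mapping.keys (f a) \<subseteq> M"
    for A :: "(nat \<Rightarrow> nat) set" and f :: "_ \<Rightarrow> 'a \<Rightarrow>\<^sub>0 'k"
    using keys_sum[of f A] that by fastforce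
  \<comment> \<open>The terms \<open>w j a\<close> have lost their first \<open>j\<close> factors.
    Agreement of the survivors below \<open>j\<close> keeps distinct survivors distinct in the
    remaining exponents, so nothing is merged on the way.\<close>
  have "\<exists>T'\<subseteq>T. T' \<noteq> {} \<and> (\<forall>a\<in>T'. \<forall>b\<in>T'. \<forall>i<j. a i = b i) \<and> (\<Sum>a\<in>T'. w j a) \<in> P j" if "j \<le> N" for j
    using that
  proof (induction j)
    case 0
    have "(\<Sum>a\<in>T. w 0 a) \<in> P 0"
      using rel primeideal_monoid_algebraD(5)[OF P] by (simp add: w_def atLeast0LessThan)
    then show ?case using T(2) by blast
  next
    case (Suc j)
    then obtain T' where T': "T' \<subseteq> T" "T' \<noteq> {}" "\<And>a b i. a \<in> T' \<Longrightarrow> b \<in> T' \<Longrightarrow> i < j \<Longrightarrow> a i = b i"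
      "(\<Sum>a\<in>T'. w j a) \<in> P j" by (metis Suc_leD)
    have j: "j < N" using Suc.prems by simp
    have fin: "finite T'" using T' T(1) finite_subset by blast
    define m where "m = Min ((\<lambda>a. a j) ` T')"
    define U where "U = {a \<in> T'. a j = m}"
    have m_le: "m \<le> a j" if "a \<in> T'" for a using that fin by (simp add: m_def)
    have "m \<in> (\<lambda>a. a j) ` T'" unfolding m_def using fin T'(2) by (intro Min_in) auto
    then have "U \<noteq> {}" by (auto simp: U_def)
    define X where "X = (\<Sum>a\<in>U. w (Suc j) a)"
    \<comment> \<open>The exponent drops by \<open>Suc m\<close>: \<open>m\<close> copies of
      \<open>z j\<close> are factored out of the whole sum, and one more stays in front of
      \<open>Y\<close> so that this part vanishes modulo \<open>P (Suc j)\<close>.\<close>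
    define Y where "Y = (\<Sum>a\<in>T' - U. z j ^ (a j - Suc m) * w (Suc j) a)"
    have w_Suc: "w j a = z j ^ a j * w (Suc j) a" for a
      using j by (simp add: w_def prod.atLeast_Suc_lessThan mult_ac)
    have "(\<Sum>a\<in>T'. w j a) = (\<Sum>a\<in>U. w j a) + (\<Sum>a\<in>T' - U. w j a)"
      using fin by (subst sum.subset_diff[of U T']) (auto simp: U_def add.commute)
    also have "(\<Sum>a\<in>U. w j a) = z j ^ m * X"
      unfolding X_def sum_distrib_left by (intro sum.cong) (auto simp: w_Suc U_def)
    also have "(\<Sum>a\<in>T' - U. w j a) = z j ^ m * (z j * Y)"
      unfolding Y_def sum_distrib_left
    proof (intro sum.cong refl)
      fix a assume "a \<in> T' - U"
      then have "m < a j" using m_le[of a] by (auto simp: U_def)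
      then have "a j = m + Suc (a j - Suc m)" by simp
      then have "z j ^ a j = z j ^ m * (z j * z j ^ (a j - Suc m))" by (metis power_add power_Suc)
      then show "w j a = z j ^ m * (z j * (z j ^ (a j - Suc m) * w (Suc j) a))"
        by (simp add: w_Suc mult_ac)
    qed
    finally have "z j ^ m * (X + z j * Y) \<in> P j" using T'(4) by (simp add: distrib_left)
    have XM: "Poly_Mapping.keys X \<subseteq> M" unfolding X_def by (intro sumM wM)
    have YM: "Poly_Mapping.keys Y \<subseteq> M" unfolding Y_def
      by (intro sumM keys_mult_add_submonoid[OF M] wM keys_power_add_submonoid[OF M] zM j)
    have "Poly_Mapping.keys (X + z j * Y) \<subseteq> M"
      using keys_add[of X "z j * Y"] XM keys_mult_add_submonoid[OF M zM[OF j] YM] by blast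
    then have "X + z j * Y \<in> P j"
      using primeideal_power_cancel[OF P M zM[OF j] z(2)[OF j]] j \<open>z j ^ m * (X + z j * Y) \<in> P j\<close> by auto
    then have "X + z j * Y \<in> P (Suc j)" using z(3)[OF j] by blast
    note PS = primeideal_monoid_algebraD[OF P[OF Suc.prems]]
    have "- Y * z j \<in> P (Suc j)" using PS(3)[OF z(1)[OF j], of "- Y"] YM by simp
    then have "X + z j * Y + - Y * z j \<in> P (Suc j)" using PS(2) \<open>X + z j * Y \<in> P (Suc j)\<close> by blast
    then have "X \<in> P (Suc j)" by (simp add: mult.commute)
    moreover have "\<forall>a\<in>U. \<forall>b\<in>U. \<forall>i<Suc j. a i = b i"
      using T'(3) by (auto simp: U_def less_Suc_eq)
    moreover have "U \<subseteq> T" using T'(1) by (auto simp: U_def)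
    ultimately show ?case using \<open>U \<noteq> {}\<close> unfolding X_def by blast
  qed
  from this[OF order_refl] obtain T' where T': "T' \<subseteq> T" "T' \<noteq> {}" "(\<Sum>a\<in>T'. w N a) \<in> P N"
    "\<And>a b i. a \<in> T' \<Longrightarrow> b \<in> T' \<Longrightarrow> i < N \<Longrightarrow> a i = b i" by blast
  obtain a where a: "a \<in> T'" using T'(2) by blast
  \<comment> \<open>Extensional functions that agree on all indices below \<open>N\<close> are
    equal. A single term therefore remains, a nonzero constant that cannot be cancelled.\<close>
  have "b = a" if "b \<in> T'" for b
    using that a T'(1) T(3) T'(4)[OF that a] by (intro extensionalityI[of b "{..<N}" a]) auto
  then have "T' = {a}" using a by blast
  then have "Poly_Mapping.single 0 (c a) \<in> P N" using T'(3) by (simp add: w_def)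
  then have "Poly_Mapping.single 0 (inverse (c a)) * Poly_Mapping.single 0 (c a) \<in> P N"
    using primeideal_monoid_algebraD(3)[OF P[of N]] scalM by blast
  then show False
    using primeideal_monoid_algebraD(6)[OF P[of N]] T(4) a T'(1) by (auto simp: mult_single)
qed

lemma card_bounded_exponents:
  fixes M :: "('v \<Rightarrow>\<^sub>0 nat) set"
  assumes inj: "\<And>u v. u \<in> M \<Longrightarrow> v \<in> M \<Longrightarrow>
      (\<And>i. i < r \<Longrightarrow> Poly_Mapping.lookup u (s i) = Poly_Mapping.lookup v (s i)) \<Longrightarrow> u = v"
  defines "U \<equiv> \<lambda>B. {u \<in> M. \<forall>x. Poly_Mapping.lookup u x \<le> B}"
  shows "finite (U B)" "card (U B) \<le> (B + 1) ^ r"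
proof -
  let ?f = "\<lambda>u. \<lambda>i\<in>{..<r}. Poly_Mapping.lookup u (s i)"
  let ?X = "PiE {..<r} (\<lambda>_. {..B})"
  have f: "inj_on ?f (U B)"
  proof (rule inj_onI)
    fix u v assume "u \<in> U B" "v \<in> U B" "?f u = ?f v"
    moreover from this(3) have "Poly_Mapping.lookup u (s i) = Poly_Mapping.lookup v (s i)" if "i < r" for i
      using that by (metis lessThan_iff restrict_apply')
    ultimately show "u = v" using inj by (simp add: U_def)
  qed
  have sub: "?f ` U B \<subseteq> ?X" 
  proof (rule image_subsetI)
    fix u assume "u \<in> U B"
    then show "?f u \<in> ?X" by (subst restrict_PiE_iff) (simp add: U_def)
  qed
  have fin: "finite ?X" by (intro finite_PiE) auto
  show "finite (U B)" using f sub fin by (metis finite_imageD finite_subset)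
  have "card (U B) \<le> card ?X" using f sub fin by (rule card_inj_on_le)
  then show "card (U B) \<le> (B + 1) ^ r" by (simp add: card_PiE)
qed

lemma krull_dim_monoid_algebra_le:
  fixes M :: "('v \<Rightarrow>\<^sub>0 nat) set"
  assumes M: "add_submonoid M"
    and inj: "\<And>u v. u \<in> M \<Longrightarrow> v \<in> M \<Longrightarrow>
      (\<And>i. i < r \<Longrightarrow> Poly_Mapping.lookup u (s i) = Poly_Mapping.lookup v (s i)) \<Longrightarrow> u = v"
  shows "krull_dim (monoid_algebra (K :: 'k::field itself) M) \<le> enat r"
  unfolding krull_dim_def
proof (rule Sup_least, safe)
  fix n and P :: "nat \<Rightarrow> (('v \<Rightarrow>\<^sub>0 nat) \<Rightarrow>\<^sub>0 'k) set"
  assume P: "\<forall>i\<le>n. primeideal (P i) (monoid_algebra K M)" "\<forall>i<n. P i \<subset> P (Suc i)"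
  have "n \<le> r"
  proof (rule ccontr)
    assume "\<not> n \<le> r"
    \<comment> \<open>The first \<open>r + 1\<close> strict inclusions are enough. Each supplies one
      \<open>z i\<close>, which gives one element more than there are determining
      coordinates.\<close>
    define N where "N = Suc r"
    have N: "N \<le> n" using \<open>\<not> n \<le> r\<close> by (simp add: N_def)
    have "\<exists>z. z \<in> P (Suc i) \<and> z \<notin> P i" if "i < N" for i using P(2) that N by (metis order_less_le_trans psubset_imp_ex_mem Diff_iff)
    then obtain z where z: "\<And>i. i < N \<Longrightarrow> z i \<in> P (Suc i)" "\<And>i. i < N \<Longrightarrow> z i \<notin> P i" by metis
    have zM: "Poly_Mapping.keys (z i) \<subseteq> M" if "i < N" for i
    proof -
      have "primeideal (P (Suc i)) (monoid_algebra K M)" using P(1) N that by simp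
      from primeideal_monoid_algebraD(1)[OF this z(1)[OF that]] show ?thesis .
    qed
    have "\<forall>i. \<exists>B. exp_bounded B (z i)" using exp_bounded_ex by blast
    then obtain B where B: "\<And>i. exp_bounded (B i) (z i)" by metis
    define D where "D = (\<Sum>i<N. B i)"
    have D: "exp_bounded D (z i)" if "i < N" for i
      using B that by (auto simp: D_def intro!: exp_bounded_mono[OF B] member_le_sum)
    \<comment> \<open>There are \<open>(q + 1) ^ N\<close> products with exponents up to
      \<open>q\<close>, and they involve at most \<open>(N * q * D + 1) ^ r\<close> monomials. As
      \<open>N * q * D + 1\<close> is at most \<open>(N * D + 1) * (q + 1)\<close>, this choice of
      \<open>q\<close> bounds the monomials by \<open>q * (q + 1) ^ r\<close>, which is below
      \<open>(q + 1) ^ (r + 1)\<close>.\<close>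
    define q where "q = (N * D + 1) ^ r"
    define U where "U = {u \<in> M. \<forall>x. Poly_Mapping.lookup u x \<le> N * (q * D)}"
    define S where "S = PiE {..<N} (\<lambda>_. {..q})"
    define f where "f a = (\<Prod>i<N. z i ^ a i)" for a
    have finU: "finite U" and "card U \<le> (N * (q * D) + 1) ^ r"
      unfolding U_def by (rule card_bounded_exponents[OF inj], assumption+)+
    moreover have "(N * (q * D) + 1) ^ r \<le> ((N * D + 1) * (q + 1)) ^ r"
      by (intro power_mono) (simp_all add: algebra_simps)
    moreover have "\<dots> = q * (q + 1) ^ r" by (simp only: power_mult_distrib q_def)
    moreover have "q * (q + 1) ^ r < (q + 1) ^ N" by (simp add: N_def)
    moreover have "card S = (q + 1) ^ N" by (simp add: S_def card_PiE)
    ultimately have "card U < card S" by linarith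
    moreover have "finite S" by (auto simp: S_def intro: finite_PiE)
    ultimately obtain c where c: "\<exists>a\<in>S. c a \<noteq> 0"
      "\<And>u. u \<in> U \<Longrightarrow> (\<Sum>a\<in>S. c a * Poly_Mapping.lookup (f a) u) = 0"
      using linear_relation_exists[OF finU, of S "\<lambda>a. Poly_Mapping.lookup (f a)"] by metis
    have keys: "Poly_Mapping.keys (f a) \<subseteq> U" if "a \<in> S" for a
    proof -
      have "exp_bounded (q * D) (z i ^ a i)" if "i < N" for i
      proof (rule exp_bounded_mono[OF exp_bounded_power[OF D[OF that]]])
        show "a i * D \<le> q * D" using \<open>a \<in> S\<close> that by (auto simp: S_def PiE_def Pi_def)
      qed
      then have "exp_bounded (N * (q * D)) (f a)" unfolding f_def by (rule exp_bounded_prod)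
      moreover have "Poly_Mapping.keys (f a) \<subseteq> M"
        unfolding f_def using zM by (intro keys_prod_add_submonoid[OF M] keys_power_add_submonoid[OF M]) auto
      ultimately show ?thesis by (auto simp: U_def exp_bounded_def)
    qed
    \<comment> \<open>The system has equations only for the monomials in \<open>U\<close>. All other
      coefficients vanish because every \<open>f a\<close> is supported in \<open>U\<close>.\<close>
    have zero: "(\<Sum>a\<in>S. c a * Poly_Mapping.lookup (f a) u) = 0" for u
    proof (cases "u \<in> U")
      case False
      then have "Poly_Mapping.lookup (f a) u = 0" if "a \<in> S" for a
        using keys[OF that] by (auto simp: in_keys_iff)
      then show ?thesis by simp
    qed (rule c(2))
    let ?T = "{a \<in> S. c a \<noteq> 0}"
    have "(\<Sum>a\<in>?T. Poly_Mapping.single 0 (c a) * f a) = 0"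
    proof (rule poly_mapping_eqI)
      fix u
      have "(\<Sum>a\<in>?T. c a * Poly_Mapping.lookup (f a) u) = (\<Sum>a\<in>S. c a * Poly_Mapping.lookup (f a) u)"
        using \<open>finite S\<close> by (intro sum.mono_neutral_left) auto
      then show "Poly_Mapping.lookup (\<Sum>a\<in>?T. Poly_Mapping.single 0 (c a) * f a) u = Poly_Mapping.lookup 0 u"
        using zero[of u] by (simp add: lookup_sum lookup_scalar_mult)
    qed
    moreover have "P i \<subseteq> P (Suc i)" if "i < N" for i
      using P(2) N that by (meson order_less_le_trans psubset_imp_subset)
    moreover have "?T \<subseteq> extensional {..<N}" by (auto simp: S_def PiE_def)
    moreover have "?T \<noteq> {}" "finite ?T" using c(1) \<open>finite S\<close> by auto
    ultimately show False
      using P(1) N z unfolding f_def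
      by (intro prime_chain_no_relation[OF M, of N P K z ?T c]) simp_all
  qed
  then show "enat n \<le> enat r" by simp
qed

section \<open>Localization\<close>

locale localization_setup = cring R for R (structure) +
  fixes S
  assumes denom_carrier: "S \<subseteq> carrier R"
    and denom_one: "\<one> \<in> S"
    and denom_mult: "\<And>s t. s \<in> S \<Longrightarrow> t \<in> S \<Longrightarrow> s \<otimes> t \<in> S"
begin

abbreviation "L \<equiv> localization R S"
abbreviation "fr \<equiv> frac R S"

lemma denomD: "s \<in> S \<Longrightarrow> s \<in> carrier R"
  using denom_carrier by blast

lemma equiv_loc_rel: "equiv (carrier R \<times> S) (loc_rel R S)"
proof (rule equivI)
  show "loc_rel R S \<subseteq> (carrier R \<times> S) \<times> (carrier R \<times> S)"
    by (auto simp: loc_rel_def)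
  show "refl_on (carrier R \<times> S) (loc_rel R S)"
    using denom_one by (auto simp: loc_rel_def refl_on_def)
  show "sym (loc_rel R S)"
    by (auto simp: loc_rel_def sym_def intro: sym)
  show "trans (loc_rel R S)"
  proof (rule transI, clarsimp simp: loc_rel_def)
    fix a s b t c w u v
    assume *: "a \<in> carrier R" "s \<in> S" "b \<in> carrier R" "t \<in> S" "c \<in> carrier R" "w \<in> S" "u \<in> S" "v \<in> S"
      "u \<otimes> (a \<otimes> t) = u \<otimes> (b \<otimes> s)" "v \<otimes> (b \<otimes> w) = v \<otimes> (c \<otimes> t)"
    note [simp] = denomD[OF *(2)] denomD[OF *(4)] denomD[OF *(6)] denomD[OF *(7)] denomD[OF *(8)] *(1,3,5)
    \<comment> \<open>The middle denominator \<open>t\<close> has to be multiplied in as well, since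
      it can only be cancelled up to a witness from \<open>S\<close>; hence the witness
      \<open>u \<otimes> v \<otimes> t\<close>.\<close>
    have "(u \<otimes> v \<otimes> t) \<otimes> (a \<otimes> w) = (v \<otimes> w) \<otimes> (u \<otimes> (a \<otimes> t))" by (simp add: m_ac)
    also have "\<dots> = (u \<otimes> s) \<otimes> (v \<otimes> (b \<otimes> w))" unfolding *(9) by (simp add: m_ac)
    also have "\<dots> = (u \<otimes> v \<otimes> t) \<otimes> (c \<otimes> s)" unfolding *(10) by (simp add: m_ac)
    finally show "\<exists>u\<in>S. u \<otimes> (a \<otimes> w) = u \<otimes> (c \<otimes> s)"
      using * denom_mult by blast
  qed
qed

lemma fr_eq_iff:
  assumes "a \<in> carrier R" "s \<in> S" "b \<in> carrier R" "t \<in> S"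
  shows "fr a s = fr b t \<longleftrightarrow> (\<exists>u\<in>S. u \<otimes> (a \<otimes> t) = u \<otimes> (b \<otimes> s))"
proof -
  have "fr a s = fr b t \<longleftrightarrow> ((a, s), (b, t)) \<in> loc_rel R S"
    unfolding frac_def using equiv_loc_rel assms by (intro eq_equiv_class_iff) auto
  then show ?thesis using assms by (simp add: loc_rel_def)
qed

lemma carrier_loc: "carrier L = {fr a s | a s. a \<in> carrier R \<and> s \<in> S}"
  by (auto simp: localization_def quotient_def frac_def)

lemma fr_closed: "a \<in> carrier R \<Longrightarrow> s \<in> S \<Longrightarrow> fr a s \<in> carrier L"
  by (auto simp: carrier_loc)

lemma mem_fr: "x \<in> fr a s \<longleftrightarrow> ((a, s), x) \<in> loc_rel R S"
  by (simp add: frac_def)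

text \<open>The product in the localization is a union over all representatives. Every pair of
  representatives yields the same class, so the union collapses to that class.\<close>

lemma fr_mult:
  assumes "a \<in> carrier R" "s \<in> S" "b \<in> carrier R" "t \<in> S"
  shows "fr a s \<otimes>\<^bsub>L\<^esub> fr b t = fr (a \<otimes> b) (s \<otimes> t)"
proof -
  have eq: "frac R S (a' \<otimes> b') (s' \<otimes> t') = fr (a \<otimes> b) (s \<otimes> t)"
    if *: "(a', s') \<in> fr a s" "(b', t') \<in> fr b t" for a' s' b' t'
  proof -
    obtain u v where uv: "u \<in> S" "v \<in> S" "a' \<in> carrier R" "s' \<in> S" "b' \<in> carrier R" "t' \<in> S"
      "u \<otimes> (a \<otimes> s') = u \<otimes> (a' \<otimes> s)" "v \<otimes> (b \<otimes> t') = v \<otimes> (b' \<otimes> t)"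
      using * by (auto simp: mem_fr loc_rel_def)
    note [simp] = uv(3,5) denomD[OF uv(1)] denomD[OF uv(2)] denomD[OF uv(4)] denomD[OF uv(6)]
      denomD[OF assms(2)] denomD[OF assms(4)] assms(1,3)
    have "(u \<otimes> v) \<otimes> ((a' \<otimes> b') \<otimes> (s \<otimes> t)) = (u \<otimes> (a' \<otimes> s)) \<otimes> (v \<otimes> (b' \<otimes> t))"
      by (simp add: m_ac)
    also have "\<dots> = (u \<otimes> v) \<otimes> ((a \<otimes> b) \<otimes> (s' \<otimes> t'))"
      unfolding uv(7,8)[symmetric] by (simp add: m_ac)
    finally show ?thesis
      using assms uv denom_mult by (subst fr_eq_iff) auto
  qed
  have mem: "(a, s) \<in> fr a s" "(b, t) \<in> fr b t"
    using assms denom_one by (auto simp: mem_fr loc_rel_def)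
  show ?thesis
    unfolding localization_def by simp (use eq mem in blast)
qed

lemma fr_add:
  assumes "a \<in> carrier R" "s \<in> S" "b \<in> carrier R" "t \<in> S"
  shows "fr a s \<oplus>\<^bsub>L\<^esub> fr b t = fr (a \<otimes> t \<oplus> b \<otimes> s) (s \<otimes> t)"
proof -
  have eq: "frac R S (a' \<otimes> t' \<oplus> b' \<otimes> s') (s' \<otimes> t') = fr (a \<otimes> t \<oplus> b \<otimes> s) (s \<otimes> t)"
    if *: "(a', s') \<in> fr a s" "(b', t') \<in> fr b t" for a' s' b' t'
  proof -
    obtain u v where uv: "u \<in> S" "v \<in> S" "a' \<in> carrier R" "s' \<in> S" "b' \<in> carrier R" "t' \<in> S"
      "u \<otimes> (a \<otimes> s') = u \<otimes> (a' \<otimes> s)" "v \<otimes> (b \<otimes> t') = v \<otimes> (b' \<otimes> t)"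
      using * by (auto simp: mem_fr loc_rel_def)
    note [simp] = uv(3,5) denomD[OF uv(1)] denomD[OF uv(2)] denomD[OF uv(4)] denomD[OF uv(6)]
      denomD[OF assms(2)] denomD[OF assms(4)] assms(1,3)
    have "(u \<otimes> v) \<otimes> ((a' \<otimes> t' \<oplus> b' \<otimes> s') \<otimes> (s \<otimes> t)) =
        (u \<otimes> (a' \<otimes> s)) \<otimes> (v \<otimes> t' \<otimes> t) \<oplus> (v \<otimes> (b' \<otimes> t)) \<otimes> (u \<otimes> s' \<otimes> s)"
      by (simp add: m_ac l_distr r_distr)
    also have "\<dots> = (u \<otimes> v) \<otimes> ((a \<otimes> t \<oplus> b \<otimes> s) \<otimes> (s' \<otimes> t'))"
      unfolding uv(7,8)[symmetric] by (simp add: m_ac l_distr r_distr)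
    finally show ?thesis
      using assms uv denom_mult denomD by (subst fr_eq_iff) auto
  qed
  have mem: "(a, s) \<in> fr a s" "(b, t) \<in> fr b t"
    using assms denom_one by (auto simp: mem_fr loc_rel_def)
  show ?thesis
    unfolding localization_def by simp (use eq mem in blast)
qed

lemma loc_one: "\<one>\<^bsub>L\<^esub> = fr \<one> \<one>" and loc_zero: "\<zero>\<^bsub>L\<^esub> = fr \<zero> \<one>"
  by (auto simp: localization_def)

lemma cring_loc: "cring L"
proof (rule cringI)
  note [simp] = denomD denom_mult denom_one fr_mult fr_add fr_closed loc_one loc_zero
  show "abelian_group L"
  proof (rule abelian_groupI)
    show "\<zero>\<^bsub>L\<^esub> \<in> carrier L" by simp
    fix x y z assume "x \<in> carrier L" "y \<in> carrier L" "z \<in> carrier L"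
    then obtain a s b t c w where *: "x = fr a s" "a \<in> carrier R" "s \<in> S"
      "y = fr b t" "b \<in> carrier R" "t \<in> S" "z = fr c w" "c \<in> carrier R" "w \<in> S"
      by (auto simp: carrier_loc)
    show "x \<oplus>\<^bsub>L\<^esub> y \<in> carrier L" using * by simp
    show "x \<oplus>\<^bsub>L\<^esub> y = y \<oplus>\<^bsub>L\<^esub> x" using * by (simp add: m_comm a_comm)
    show "(x \<oplus>\<^bsub>L\<^esub> y) \<oplus>\<^bsub>L\<^esub> z = x \<oplus>\<^bsub>L\<^esub> (y \<oplus>\<^bsub>L\<^esub> z)"
      using * by (simp add: m_ac l_distr r_distr a_ac)
    show "\<zero>\<^bsub>L\<^esub> \<oplus>\<^bsub>L\<^esub> x = x" using * by simp
    show "\<exists>y\<in>carrier L. y \<oplus>\<^bsub>L\<^esub> x = \<zero>\<^bsub>L\<^esub>"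
    proof (rule bexI)
      show "fr (\<ominus> a) s \<oplus>\<^bsub>L\<^esub> x = \<zero>\<^bsub>L\<^esub>"
        using * by (auto simp: l_minus l_neg fr_eq_iff intro!: bexI[of _ \<one>])
      show "fr (\<ominus> a) s \<in> carrier L" using * by simp
    qed
  qed
  show "comm_monoid L"
  proof (rule comm_monoidI)
    show "\<one>\<^bsub>L\<^esub> \<in> carrier L" by simp
    fix x y z assume "x \<in> carrier L" "y \<in> carrier L" "z \<in> carrier L"
    then obtain a s b t c w where *: "x = fr a s" "a \<in> carrier R" "s \<in> S"
      "y = fr b t" "b \<in> carrier R" "t \<in> S" "z = fr c w" "c \<in> carrier R" "w \<in> S"
      by (auto simp: carrier_loc)
    show "x \<otimes>\<^bsub>L\<^esub> y \<in> carrier L" using * by simp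
    show "x \<otimes>\<^bsub>L\<^esub> y = y \<otimes>\<^bsub>L\<^esub> x" using * by (simp add: m_comm)
    show "(x \<otimes>\<^bsub>L\<^esub> y) \<otimes>\<^bsub>L\<^esub> z = x \<otimes>\<^bsub>L\<^esub> (y \<otimes>\<^bsub>L\<^esub> z)" using * by (simp add: m_assoc)
    show "\<one>\<^bsub>L\<^esub> \<otimes>\<^bsub>L\<^esub> x = x" using * by simp
  qed
  fix x y z assume "x \<in> carrier L" "y \<in> carrier L" "z \<in> carrier L"
  then obtain a s b t c w where *: "x = fr a s" "a \<in> carrier R" "s \<in> S"
    "y = fr b t" "b \<in> carrier R" "t \<in> S" "z = fr c w" "c \<in> carrier R" "w \<in> S"
    by (auto simp: carrier_loc)
  then show "(x \<oplus>\<^bsub>L\<^esub> y) \<otimes>\<^bsub>L\<^esub> z = x \<otimes>\<^bsub>L\<^esub> z \<oplus>\<^bsub>L\<^esub> y \<otimes>\<^bsub>L\<^esub> z"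
    by (auto simp: fr_eq_iff m_ac l_distr r_distr intro!: bexI[of _ \<one>])
qed

lemma loc_hom: "(\<lambda>a. fr a \<one>) \<in> ring_hom R L"
  using denom_one by (intro ring_hom_memI) (auto simp: fr_closed fr_mult fr_add loc_one)

lemma loc_minus:
  assumes "a \<in> carrier R" "s \<in> S"
  shows "\<ominus>\<^bsub>L\<^esub> fr a s = fr (\<ominus> a) s"
proof -
  interpret L: cring L by (rule cring_loc)
  have "fr (\<ominus> a) s \<oplus>\<^bsub>L\<^esub> fr a s = \<zero>\<^bsub>L\<^esub>"
    unfolding loc_zero using assms denomD denom_one denom_mult
    by (subst fr_add) (auto simp: l_minus l_neg fr_eq_iff intro!: bexI[of _ \<one>])
  then show ?thesis
    using assms fr_closed by (intro L.minus_equality) auto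
qed

end

section \<open>The associated graded ring\<close>

locale graded_setup = cring R + I: ideal I R for R (structure) and I
begin

definition ip :: "nat \<Rightarrow> 'a set" where
  "ip t = ideal_pow R I t"

abbreviation "G \<equiv> assoc_graded R I"

lemma ip_0: "ip 0 = carrier R"
  by (simp add: ip_def ideals_set_def nat_pow_def)

lemma ip_Suc: "ip (Suc t) = ip t \<cdot>\<^bsub>R\<^esub> I"
  by (simp add: ip_def ideals_set_def nat_pow_def)

lemma assoc_graded_ip:
  "G = \<lparr>carrier = {f. (\<forall>t. \<exists>a\<in>ip t. f t = ip (Suc t) +> a) \<and> finite {t. f t \<noteq> ip (Suc t)}},
      mult = (\<lambda>f g t. \<Oplus>\<^bsub>R Quot ip (Suc t)\<^esub>i\<in>{..t}. rcoset_mult R (ip (Suc t)) (f i) (g (t - i))),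
      one = gr_of R I \<one>, zero = gr_of R I \<zero>, add = (\<lambda>f g t. f t <+> g t)\<rparr>"
  unfolding ip_def assoc_graded_def ..

lemma gr_of_ip: "gr_of R I a = (\<lambda>t. ip (Suc t) +> (if t = 0 then a else \<zero>))"
  unfolding ip_def gr_of_def ..

lemma ip_ideal: "ideal (ip t) R"
  by (induction t) (simp_all only: ip_0 ip_Suc oneideal ideal_prod_is_ideal I.is_ideal)

lemma ip_mem_carrier: "a \<in> ip t \<Longrightarrow> a \<in> carrier R"
  using ip_ideal by (rule ideal.Icarr)

lemma ip_zero: "\<zero> \<in> ip t"
  using ip_ideal by (meson additive_subgroup.zero_closed ideal.axioms(1))

lemma ip_add: "a \<in> ip t \<Longrightarrow> b \<in> ip t \<Longrightarrow> a \<oplus> b \<in> ip t"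
  using ip_ideal by (meson additive_subgroup.a_closed ideal.axioms(1))

lemma ip_minus: "a \<in> ip t \<Longrightarrow> \<ominus> a \<in> ip t"
  using ip_ideal by (meson additive_subgroup.a_inv_closed ideal.axioms(1))

lemma ip_mult: "a \<in> ip s \<Longrightarrow> b \<in> ip t \<Longrightarrow> a \<otimes> b \<in> ip (s + t)"
proof (induction t arbitrary: b)
  case 0
  then have "b \<in> carrier R" by (simp only: ip_0)
  then show ?case using ideal.I_r_closed[OF ip_ideal 0(1)] by simp
next
  case (Suc t)
  have "b \<in> ip t \<cdot>\<^bsub>R\<^esub> I" using Suc.prems(2) by (simp only: ip_Suc)
  then show ?case
  proof (induction b rule: ideal_prod.induct)
    case (prod i j)
    have "a \<otimes> (i \<otimes> j) = (a \<otimes> i) \<otimes> j"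
      using prod Suc.prems(1) ip_mem_carrier I.Icarr by (simp add: m_assoc)
    moreover have "(a \<otimes> i) \<otimes> j \<in> ip (s + t) \<cdot>\<^bsub>R\<^esub> I"
      using prod Suc by (intro ideal_prod.prod) auto
    ultimately show ?case by (simp only: add_Suc_right ip_Suc)
  next
    case (sum s1 s2)
    then have "s1 \<in> carrier R" "s2 \<in> carrier R"
      using ideal_prod_in_carrier[OF ip_ideal I.is_ideal] by auto
    then show ?case using sum Suc.prems(1) ip_mem_carrier ip_add by (simp add: r_distr)
  qed
qed

lemma ip_decr: "a \<in> ip (Suc t) \<Longrightarrow> a \<in> ip t"
  using ideal_prod_inter[OF ip_ideal I.is_ideal] by (auto simp only: ip_Suc)

lemma ip_finsum:
  assumes "finite A" "\<And>i. i \<in> A \<Longrightarrow> f i \<in> ip n"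
  shows "(\<Oplus>i\<in>A. f i) \<in> ip n"
  using assms
proof (induction A rule: finite_induct)
  case empty
  then show ?case using ip_zero by simp
next
  case (insert x F)
  then show ?case using ip_add by (subst finsum_insert) (auto intro: ip_mem_carrier)
qed

section \<open>The Rees ring\<close>

text \<open>The Rees algebra of \<open>I\<close>, as polynomials in one indeterminate over
  \<open>R\<close> whose coefficient in degree \<open>t\<close> lies in \<open>I^t\<close>.\<close>

definition rees :: "(nat \<Rightarrow> 'a) set" where
  "rees = {a \<in> up R. \<forall>t. a t \<in> ip t}"

text \<open>The operations of \<open>UP R\<close> are restricted to \<open>up R\<close>. Written out
  without the restriction they agree on \<open>rees\<close> and can be evaluated componentwise
  without side conditions.\<close>

definition rees_ring :: "(nat \<Rightarrow> 'a) ring" where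
  "rees_ring = \<lparr>carrier = rees, mult = (\<lambda>p q n. \<Oplus>i \<in> {..n}. p i \<otimes> q (n - i)),
     one = (\<lambda>i. if i = 0 then \<one> else \<zero>), zero = (\<lambda>i. \<zero>), add = (\<lambda>p q i. p i \<oplus> q i)\<rparr>"

sublocale UP: UP_cring R "UP R" by unfold_locales

lemma rees_ops:
  assumes "p \<in> up R" "q \<in> up R"
  shows "p \<otimes>\<^bsub>UP R\<^esub> q = p \<otimes>\<^bsub>rees_ring\<^esub> q" "p \<oplus>\<^bsub>UP R\<^esub> q = p \<oplus>\<^bsub>rees_ring\<^esub> q"
  using assms by (auto simp: UP_def rees_ring_def)

lemma subcring_rees: "subcring rees (UP R)"
proof (rule UP.P.subcringI'[OF UP.P.subringI])
  have up: "carrier (UP R) = up R" by (simp add: UP_def)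
  show "rees \<subseteq> carrier (UP R)" by (auto simp: rees_def UP_def)
  show "\<one>\<^bsub>UP R\<^esub> \<in> rees" using ip_zero by (auto simp: rees_def UP_def ip_0 up_one_closed)
  fix p assume p: "p \<in> rees"
  have "\<ominus>\<^bsub>UP R\<^esub> p = (\<lambda>i. \<ominus> p i)"
  proof (rule UP.P.minus_equality)
    show "(\<lambda>i. \<ominus> p i) \<oplus>\<^bsub>UP R\<^esub> p = \<zero>\<^bsub>UP R\<^esub>"
      using p up_a_inv_closed[of p] by (auto simp: UP_def rees_def fun_eq_iff mem_upD intro!: l_neg)
  qed (use p up_a_inv_closed up in \<open>auto simp: rees_def\<close>)
  then show "\<ominus>\<^bsub>UP R\<^esub> p \<in> rees" using p up_a_inv_closed ip_minus by (auto simp: rees_def)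
  fix q assume q: "q \<in> rees"
  show "p \<oplus>\<^bsub>UP R\<^esub> q \<in> rees"
    using p q up_add_closed ip_add by (auto simp: rees_def UP_def)
  have "(\<Oplus>i \<in> {..n}. p i \<otimes> q (n - i)) \<in> ip n" for n
  proof -
    have "p i \<otimes> q (n - i) \<in> ip n" if "i \<le> n" for i
      using ip_mult[of "p i" i "q (n - i)" "n - i"] p q that by (auto simp: rees_def)
    then show ?thesis by (intro ip_finsum) auto
  qed
  then show "p \<otimes>\<^bsub>UP R\<^esub> q \<in> rees"
    using p q up_mult_closed by (auto simp: rees_def UP_def)
qed

lemma cring_rees: "cring rees_ring"
proof (rule cring_image)
  show "cring (UP R\<lparr>carrier := rees\<rparr>)"
    using UP.P.subcring_iff subcring_rees subcringE(1) by metis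
  have up: "p \<in> up R" if "p \<in> rees" for p using that by (simp add: rees_def)
  show "id \<in> ring_hom (UP R\<lparr>carrier := rees\<rparr>) rees_ring"
    by (rule ring_hom_memI) (auto simp: rees_ops up, auto simp: rees_ring_def UP_def)
qed (auto simp: rees_ring_def UP_def)

definition gr :: "(nat \<Rightarrow> 'a) \<Rightarrow> nat \<Rightarrow> 'a set" where
  "gr a = (\<lambda>t. ip (Suc t) +> a t)"

lemma coset_eq: "a \<in> ip t \<Longrightarrow> ip t +> a = ip t"
  by (metis ip_ideal ideal.rcos_const_imp_mem ip_mem_carrier a_rcos_zero)

lemma gr_image: "gr ` rees = carrier G"
proof safe
  fix a assume a: "a \<in> rees"
  then obtain n where n: "bound \<zero> n a" by (auto simp: rees_def up_def)
  have "{t. gr a t \<noteq> ip (Suc t)} \<subseteq> {..n}"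
  proof (rule subsetI, unfold mem_Collect_eq atMost_iff)
    fix t assume t: "gr a t \<noteq> ip (Suc t)"
    show "t \<le> n"
    proof (rule ccontr)
      assume "\<not> t \<le> n"
      then have "a t = \<zero>" using bound.bound[OF n] by simp
      then have "gr a t = ip (Suc t)" using coset_eq[OF ip_zero] by (simp only: gr_def)
      then show False using t by contradiction
    qed
  qed
  then have "finite {t. gr a t \<noteq> ip (Suc t)}" using finite_subset by blast
  then show "gr a \<in> carrier G"
    using a by (auto simp: assoc_graded_ip gr_def rees_def)
next
  fix f assume f: "f \<in> carrier G"
  then obtain a where a: "\<And>t. a t \<in> ip t" "\<And>t. f t = ip (Suc t) +> a t"
    unfolding assoc_graded_ip by simp metis
  have fin: "finite {t. f t \<noteq> ip (Suc t)}" using f by (simp add: assoc_graded_ip)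
  \<comment> \<open>A representative of a zero component may be nonzero. Replacing it by zero gives
    the sequence finite support, as a polynomial must have.\<close>
  define b where "b t = (if f t = ip (Suc t) then \<zero> else a t)" for t
  have "gr b = f"
    using a coset_eq[OF ip_zero] by (auto simp: gr_def b_def fun_eq_iff)
  obtain n where "{t. f t \<noteq> ip (Suc t)} \<subseteq> {..n}" using fin finite_nat_iff_bounded_le by blast
  then have "bound \<zero> n b" by (auto simp: bound_def b_def)
  moreover have "b t \<in> ip t" for t using a(1) ip_zero by (simp add: b_def)
  ultimately have "b \<in> rees" unfolding rees_def by (blast intro: ip_mem_carrier mem_upI)
  then show "f \<in> gr ` rees" using \<open>gr b = f\<close> by blast
qed

text \<open>For products the factors are cosets of \<open>I^(i+1)\<close> and
  \<open>I^(t-i+1)\<close>, the result a coset of \<open>I^(t+1)\<close>. Changing the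
  representatives alters the product by terms with at least \<open>t + 1\<close> factors from
  \<open>I\<close>.\<close>

lemma gr_hom: "gr \<in> ring_hom rees_ring G"
proof (rule ring_hom_memI)
  show "gr x \<in> carrier G" if "x \<in> carrier rees_ring" for x
    using that gr_image by (auto simp: rees_ring_def)
  show "gr \<one>\<^bsub>rees_ring\<^esub> = \<one>\<^bsub>G\<^esub>"
    by (auto simp: rees_ring_def assoc_graded_ip gr_def gr_of_ip)
  fix x y assume "x \<in> carrier rees_ring" "y \<in> carrier rees_ring"
  then have xr: "\<And>t. x t \<in> ip t" and yr: "\<And>t. y t \<in> ip t"
    by (auto simp: rees_ring_def rees_def)
  then have x: "\<And>t. x t \<in> carrier R" and y: "\<And>t. y t \<in> carrier R"
    by (blast intro: ip_mem_carrier)+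
  show "gr (x \<oplus>\<^bsub>rees_ring\<^esub> y) = gr x \<oplus>\<^bsub>G\<^esub> gr y"
  proof
    fix t
    interpret ideal "ip (Suc t)" R by (rule ip_ideal)
    show "gr (x \<oplus>\<^bsub>rees_ring\<^esub> y) t = (gr x \<oplus>\<^bsub>G\<^esub> gr y) t"
      using x y by (simp add: rees_ring_def gr_def assoc_graded_ip a_rcos_sum)
  qed
  show "gr (x \<otimes>\<^bsub>rees_ring\<^esub> y) = gr x \<otimes>\<^bsub>G\<^esub> gr y"
  proof
    fix t
    interpret J: ideal "ip (Suc t)" R by (rule ip_ideal)
    interpret q: ring_hom_ring R "R Quot ip (Suc t)" "(+>) (ip (Suc t))"
      by (rule J.rcos_ring_hom_ring)
    have *: "rcoset_mult R (ip (Suc t)) (gr x i) (gr y (t - i)) = ip (Suc t) +> (x i \<otimes> y (t - i))"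
      if "i \<le> t" for i
    proof -
      have coset: "ip (Suc t) +> a \<otimes> b = ip (Suc t) +> x i \<otimes> y (t - i)"
        if a: "a \<in> ip (Suc i) +> x i" and b: "b \<in> ip (Suc (t - i)) +> y (t - i)" for a b
      proof -
        obtain h where h: "h \<in> ip (Suc i)" "a = h \<oplus> x i" using a by (auto simp: a_r_coset_def')
        obtain k where k: "k \<in> ip (Suc (t - i))" "b = k \<oplus> y (t - i)"
          using b by (auto simp: a_r_coset_def')
        have carr: "h \<in> carrier R" "k \<in> carrier R" using h k ip_mem_carrier by auto
        have "Suc i + Suc (t - i) = Suc (Suc t)" "Suc i + (t - i) = Suc t" "i + Suc (t - i) = Suc t"
          using \<open>i \<le> t\<close> by auto
        then have "h \<otimes> y (t - i) \<in> ip (Suc t)" "x i \<otimes> k \<in> ip (Suc t)"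
          using ip_mult h(1) k(1) xr yr by metis+
        moreover have "h \<otimes> k \<in> ip (Suc t)"
          using ip_mult[of h "Suc i" k "t - i"] h(1)
            ip_decr[OF k(1)] \<open>Suc i + (t - i) = Suc t\<close> by metis
        ultimately have *: "h \<otimes> k \<oplus> (h \<otimes> y (t - i) \<oplus> x i \<otimes> k) \<in> ip (Suc t)"
          using ip_add by blast
        have "a \<otimes> b = (h \<otimes> k \<oplus> (h \<otimes> y (t - i) \<oplus> x i \<otimes> k)) \<oplus> x i \<otimes> y (t - i)"
          unfolding h k using carr x y by (simp add: l_distr r_distr a_ac)
        then have "a \<otimes> b \<in> ip (Suc t) +> x i \<otimes> y (t - i)"
          using * by (auto simp: a_r_coset_def')
        then show ?thesis
          using J.a_repr_independence' x y by (metis m_closed)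
      qed
      have "x i \<in> ip (Suc i) +> x i" "y (t - i) \<in> ip (Suc (t - i)) +> y (t - i)"
        using x y ip_zero by (auto simp: a_r_coset_def' intro!: bexI[of _ \<zero>])
      \<comment> \<open>The union over representatives collapses to its constant value only if both
        cosets are inhabited.\<close>
      then have ne: "gr x i \<noteq> {}" "gr y (t - i) \<noteq> {}" unfolding gr_def by (metis empty_iff)+
      have "(\<Union>a\<in>gr x i. \<Union>b\<in>gr y (t - i). ip (Suc t) +> a \<otimes> b) =
          (\<Union>a\<in>gr x i. \<Union>b\<in>gr y (t - i). ip (Suc t) +> x i \<otimes> y (t - i))"
        by (intro SUP_cong refl) (simp only: gr_def coset)
      then show ?thesis unfolding rcoset_mult_def using ne by simp
    qed
    have "(gr x \<otimes>\<^bsub>G\<^esub> gr y) t = (\<Oplus>\<^bsub>R Quot ip (Suc t)\<^esub>i\<in>{..t}. ip (Suc t) +> (x i \<otimes> y (t - i)))"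
      unfolding assoc_graded_ip using * x y
      by (simp) (intro q.S.finsum_cong', auto)
    also have "\<dots> = ip (Suc t) +> (\<Oplus>i\<in>{..t}. x i \<otimes> y (t - i))"
      using x y by (subst q.hom_finsum) (auto simp: o_def)
    finally show "gr (x \<otimes>\<^bsub>rees_ring\<^esub> y) t = (gr x \<otimes>\<^bsub>G\<^esub> gr y) t"
      by (simp add: rees_ring_def gr_def)
  qed
qed

lemma gr_zero: "gr \<zero>\<^bsub>rees_ring\<^esub> = \<zero>\<^bsub>G\<^esub>"
  by (auto simp: rees_ring_def assoc_graded_ip gr_def gr_of_ip)

lemma carrier_rees_ring: "carrier rees_ring = rees"
  by (simp add: rees_ring_def)

lemma cring_assoc_graded: "cring G"
  by (rule cring_image[OF cring_rees gr_hom]) (simp_all only: carrier_rees_ring gr_image gr_zero)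

abbreviation mon :: "'a \<Rightarrow> nat \<Rightarrow> nat \<Rightarrow> 'a" where
  "mon a n \<equiv> (\<lambda>t. if t = n then a else \<zero>)"

lemma mon_rees: "a \<in> ip n \<Longrightarrow> mon a n \<in> rees"
  unfolding rees_def using ip_mem_carrier ip_zero
  by (auto simp: up_def bound_def intro!: exI[of _ n])

lemma mon_add:
  "a \<in> ip n \<Longrightarrow> b \<in> ip n \<Longrightarrow> mon (a \<oplus> b) n = mon a n \<oplus>\<^bsub>rees_ring\<^esub> mon b n"
  by (auto simp: rees_ring_def fun_eq_iff)

lemma mon_mult:
  assumes "a \<in> ip i" "b \<in> ip j"
  shows "mon (a \<otimes> b) (i + j) = mon a i \<otimes>\<^bsub>rees_ring\<^esub> mon b j"
proof -
  have carr: "a \<in> carrier R" "b \<in> carrier R" using assms ip_mem_carrier by auto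
  have mon: "mon c n = up_ring.monom (UP R) c n" if "c \<in> carrier R" for c n
    using that by (auto simp: UP_def fun_eq_iff)
  have up: "mon a i \<in> up R" "mon b j \<in> up R" using mon_rees assms by (auto simp: rees_def)
  show ?thesis
    unfolding rees_ops(1)[OF up, symmetric] using carr UP.monom_mult[OF carr, of i j] by (simp add: mon)
qed

text \<open>An induction principle: the Rees ring is generated by its part of degree 0 and the
  generators of \<open>I\<close> placed in degree 1. The elements of \<open>I\<close> that may be
  placed in degree 1 form an ideal containing \<open>B\<close>, and powers of \<open>I\<close>
  follow by induction. It serves to show that the map onto the special fiber is surjective.\<close>

lemma rees_generated:
  assumes I: "I = Idl B" "B \<subseteq> carrier R"
    and add: "\<And>x y. x \<in> T \<Longrightarrow> y \<in> T \<Longrightarrow> x \<oplus>\<^bsub>rees_ring\<^esub> y \<in> T"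
    and mult: "\<And>x y. x \<in> T \<Longrightarrow> y \<in> T \<Longrightarrow> x \<otimes>\<^bsub>rees_ring\<^esub> y \<in> T"
    and deg0: "\<And>r. r \<in> carrier R \<Longrightarrow> mon r 0 \<in> T"
    and deg1: "\<And>b. b \<in> B \<Longrightarrow> mon b 1 \<in> T"
  shows "rees \<subseteq> T"
proof
  have ip1: "ip 1 = I"
    using ideal_prod_one[OF I.is_ideal] ideal_prod_commute[OF I.is_ideal oneideal]
    by (simp only: One_nat_def ip_Suc ip_0)
  let ?H = "{a \<in> I. mon a 1 \<in> T}"
  have scale: "mon (r \<otimes> a) 1 \<in> T" if "a \<in> ?H" "r \<in> carrier R" for a r
  proof -
    have "mon (r \<otimes> a) (0 + 1) = mon r 0 \<otimes>\<^bsub>rees_ring\<^esub> mon a 1"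
      using that by (intro mon_mult) (simp_all only: ip_0 ip1, simp)
    then show ?thesis using that mult deg0 by auto
  qed
  have "ideal ?H R"
  proof (rule idealI)
    show "ring R" by (rule ring_axioms)
    show "subgroup ?H (add_monoid R)"
    proof (rule subgroup.intro)
      show "?H \<subseteq> carrier (add_monoid R)" using I.Icarr by auto
      fix x y assume xy: "x \<in> ?H" "y \<in> ?H"
      have "mon (x \<oplus> y) 1 = mon x 1 \<oplus>\<^bsub>rees_ring\<^esub> mon y 1"
        using xy by (intro mon_add) (simp_all only: ip1, simp_all)
      then show "x \<otimes>\<^bsub>add_monoid R\<^esub> y \<in> ?H" using xy add I.a_closed by auto
    next
      have "mon \<zero> 1 = mon \<zero> 0" by (simp add: fun_eq_iff)
      then have "mon \<zero> 1 \<in> T" using deg0[OF zero_closed] by metis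
      then show "\<one>\<^bsub>add_monoid R\<^esub> \<in> ?H" by simp
    next
      fix x assume x: "x \<in> ?H"
      \<comment> \<open>\<open>T\<close> is closed only under sums and products; a negative is
        obtained by multiplying with \<open>\<ominus> \<one>\<close> in degree 0.\<close>
      have "\<ominus> \<one> \<otimes> x = \<ominus> x" using x I.Icarr by (simp add: l_minus)
      then have "mon (\<ominus> x) 1 \<in> T" using scale[OF x, of "\<ominus> \<one>"] a_inv_closed[OF one_closed] by metis
      then show "inv\<^bsub>add_monoid R\<^esub> x \<in> ?H"
        unfolding a_inv_def[symmetric] using x I.a_inv_closed by auto
    qed
    fix a x assume ax: "a \<in> ?H" "x \<in> carrier R"
    then show "x \<otimes> a \<in> ?H" using scale I.I_l_closed by auto
    moreover have "a \<otimes> x = x \<otimes> a" using ax I.Icarr by (simp add: m_comm)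
    ultimately show "a \<otimes> x \<in> ?H" by metis
  qed
  moreover have "B \<subseteq> ?H" using deg1 I genideal_self by auto
  ultimately have "I \<subseteq> ?H" using genideal_minimal I(1) by blast
  then have I1: "mon a 1 \<in> T" if "a \<in> I" for a using that by blast
  have mon_T: "mon a n \<in> T" if "a \<in> ip n" for a n
    using that
  proof (induction n arbitrary: a)
    case 0
    then show ?case by (intro deg0) (simp only: ip_0)
  next
    case (Suc n)
    have "a \<in> ip n \<cdot>\<^bsub>R\<^esub> I" using Suc.prems by (simp only: ip_Suc)
    then show ?case
    proof (induction a rule: ideal_prod.induct)
      case (prod i j)
      have "mon (i \<otimes> j) (n + 1) = mon i n \<otimes>\<^bsub>rees_ring\<^esub> mon j 1"
        using prod by (intro mon_mult) (simp_all only: ip1)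
      then show ?case using mult[OF Suc.IH[OF prod(1)] I1[OF prod(2)]] by simp
    next
      case (sum s1 s2)
      then have "mon (s1 \<oplus> s2) (Suc n) = mon s1 (Suc n) \<oplus>\<^bsub>rees_ring\<^esub> mon s2 (Suc n)"
        by (intro mon_add) (simp_all only: ip_Suc)
      then show ?case using sum add by simp
    qed
  qed
  fix z assume z: "z \<in> rees"
  then obtain N where N: "bound \<zero> N z" by (auto simp: rees_def up_def)
  have zi: "z i \<in> ip i" for i using z by (simp add: rees_def)
  have "(\<lambda>t. if t < k then z t else \<zero>) \<in> T" for k
  proof (induction k)
    case 0
    have "mon \<zero> 0 \<in> T" by (rule deg0) (rule zero_closed)
    then show ?case by simp
  next
    case (Suc k)
    have "(\<lambda>t. if t < Suc k then z t else \<zero>) = (\<lambda>t. if t < k then z t else \<zero>) \<oplus>\<^bsub>rees_ring\<^esub> mon (z k) k"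
      using ip_mem_carrier[OF zi] by (auto simp: rees_ring_def fun_eq_iff less_Suc_eq)
    then show ?case using add[OF Suc.IH mon_T[OF zi]] by simp
  qed
  moreover have "(\<lambda>t. if t < Suc N then z t else \<zero>) = z"
    using bound.bound[OF N] by (auto simp: fun_eq_iff)
  ultimately show "z \<in> T" by metis
qed

end

section \<open>Edge monoids and pivot classes\<close>

definition edge_exponent :: "'v set \<Rightarrow> ('v \<Rightarrow>\<^sub>0 nat)" where
  "edge_exponent e = (\<Sum>x\<in>e. Poly_Mapping.single x 1)"

text \<open>The index counts the edges used, with repetition. It records the power of the edge ideal
  in which the monomial lies.\<close>

inductive edge_sum :: "'v set set \<Rightarrow> nat \<Rightarrow> ('v \<Rightarrow>\<^sub>0 nat) \<Rightarrow> bool" for E where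
  zero: "edge_sum E 0 0"
| step: "edge_sum E t u \<Longrightarrow> e \<in> E \<Longrightarrow> edge_sum E (Suc t) (u + edge_exponent e)"

definition edge_monoid :: "'v set set \<Rightarrow> ('v \<Rightarrow>\<^sub>0 nat) set" where
  "edge_monoid E = {u. \<exists>t. edge_sum E t u}"

lemma edge_sum_add: "edge_sum E t u \<Longrightarrow> edge_sum E s v \<Longrightarrow> edge_sum E (s + t) (v + u)"
  by (induction rule: edge_sum.induct) (auto simp: add.assoc[symmetric] intro: edge_sum.step)

lemma add_submonoid_edge_monoid: "add_submonoid (edge_monoid E)"
  unfolding add_submonoid_def edge_monoid_def using edge_sum_add edge_sum.zero by blast

lemma lookup_edge_exponent:
  "finite e \<Longrightarrow> Poly_Mapping.lookup (edge_exponent e) x = (if x \<in> e then 1 else 0)"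
  by (auto simp: edge_exponent_def lookup_sum lookup_single when_def)

lemma edge_exponent_in_monoid: "e \<in> E \<Longrightarrow> edge_exponent e \<in> edge_monoid E"
  using edge_sum.step[OF edge_sum.zero] unfolding edge_monoid_def by fastforce

section \<open>Representatives of equivalence classes\<close>

text \<open>A function that stays inside classes and is constant on them picks one node of each.
  This turns the numbers of components and of pivot classes into cardinalities of sets of
  nodes.\<close>

lemma card_quotient_image:
  assumes r: "equiv V r" and f: "\<And>x. x \<in> V \<Longrightarrow> (x, f x) \<in> r" "\<And>x y. (x, y) \<in> r \<Longrightarrow> f x = f y"
  shows "card (V // r) = card (f ` V)"
proof -
  have rV: "r \<subseteq> V \<times> V" using r by (auto simp: equiv_def refl_on_def)
  have "(\<lambda>y. r `` {y}) ` (f ` V) = V // r"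
  proof -
    have "r `` {f x} = r `` {x}" if "x \<in> V" for x using equiv_class_eq[OF r f(1)[OF that]] by simp
    then have "(\<lambda>x. r `` {f x}) ` V = (\<lambda>x. r `` {x}) ` V" by simp
    then show ?thesis unfolding quotient_def by (auto simp: image_image)
  qed
  moreover have "inj_on (\<lambda>y. r `` {y}) (f ` V)"
  proof (rule inj_onI, clarify)
    fix x y assume "x \<in> V" "y \<in> V" "r `` {f x} = r `` {f y}"
    then have "(f x, f y) \<in> r" using rV f(1) eq_equiv_class[OF _ r] by blast
    then have "(x, y) \<in> r" using f(1) \<open>x \<in> V\<close> \<open>y \<in> V\<close> r by (meson equivE symD transD)
    then show "f x = f y" by (rule f(2))
  qed
  ultimately show ?thesis by (metis card_image)
qed

text \<open>The choice depends on the class only, not on the node it is reached from, so equivalent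
  nodes get the same representative.\<close>

lemma equiv_representative:
  assumes r: "equiv V r"
  obtains f where "\<And>x. x \<in> V \<Longrightarrow> (x, f x) \<in> r" "\<And>x y. (x, y) \<in> r \<Longrightarrow> f x = f y"
proof
  let ?f = "\<lambda>x. SOME y. y \<in> r `` {x}"
  show "(x, ?f x) \<in> r" if "x \<in> V" for x
    using someI[of "\<lambda>y. y \<in> r `` {x}" x] equiv_class_self[OF r that] by auto
  show "?f x = ?f y" if "(x, y) \<in> r" for x y using equiv_class_eq[OF r that] by simp
qed

section \<open>Components, pivot classes and their intersections with edges\<close>

locale edge_hypergraph =
  fixes V :: "'v set" and E :: "'v set set" and m :: nat
  assumes finite_nodes: "finite V"
    and edges_subset: "E \<subseteq> Pow V"
    and covered: "no_isolated_nodes V E"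
    and m_ge: "m \<ge> 2"
    and uniform: "uniform m E"
    and proper: "\<And>C. C \<in> components V E \<Longrightarrow> properly_connected m (edges_in E C)"
begin

definition link :: "('v \<times> 'v) set" where
  "link = {(x, y). x \<in> V \<and> y \<in> V \<and> linked E x y}"

definition piv :: "('v \<times> 'v) set" where
  "piv = {(x, y). x \<in> V \<and> y \<in> V \<and> (x, y) \<in> (pivot V E)\<^sup>*}"

lemma finite_edge: "e \<in> E \<Longrightarrow> finite e"
  using edges_subset finite_nodes by (metis Pow_iff finite_subset subsetD)

lemma card_edge: "e \<in> E \<Longrightarrow> card e = m"
  using uniform by (auto simp: uniform_def)

lemma edge_node: "e \<in> E \<Longrightarrow> x \<in> e \<Longrightarrow> x \<in> V"
  using edges_subset by blast

lemma node_edge: assumes "x \<in> V" obtains e where "e \<in> E" "x \<in> e"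
  using assms covered by (auto simp: no_isolated_nodes_def)

lemma link_edge: "e \<in> E \<Longrightarrow> x \<in> e \<Longrightarrow> y \<in> e \<Longrightarrow> (x, y) \<in> link"
  unfolding link_def linked_def using edge_node by (auto intro!: exI[of _ "[e]"])

lemma equiv_link: "equiv V link"
proof (rule equivI)
  show "link \<subseteq> V \<times> V" by (auto simp: link_def)
  show "refl_on V link"
    using node_edge link_edge by (metis refl_onI)
  show "sym link"
  proof (rule symI)
    fix x y assume "(x, y) \<in> link"
    then obtain es where es: "x \<in> V" "y \<in> V" "es \<noteq> []" "set es \<subseteq> E" "x \<in> hd es" "y \<in> last es"
      "successively (\<lambda>e f. e \<inter> f \<noteq> {}) es" by (auto simp: link_def linked_def)
    then show "(y, x) \<in> link"
      unfolding link_def linked_def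
      by (auto intro!: exI[of _ "rev es"] simp: hd_rev last_rev Int_commute)
  qed
  show "trans link"
  proof (rule transI)
    fix x y z assume "(x, y) \<in> link" "(y, z) \<in> link"
    then obtain es fs where es: "x \<in> V" "y \<in> V" "es \<noteq> []" "set es \<subseteq> E" "x \<in> hd es" "y \<in> last es"
      "successively (\<lambda>e f. e \<inter> f \<noteq> {}) es" "z \<in> V" "fs \<noteq> []" "set fs \<subseteq> E" "y \<in> hd fs" "z \<in> last fs"
      "successively (\<lambda>e f. e \<inter> f \<noteq> {}) fs" by (auto simp: link_def linked_def)
    then show "(x, z) \<in> link"
      unfolding link_def linked_def
      by (auto intro!: exI[of _ "es @ fs"] simp: successively_append_iff)
  qed
qed

lemma pivot_sym: "(x, y) \<in> pivot V E \<Longrightarrow> (y, x) \<in> pivot V E"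
  by (auto simp: pivot_def insert_commute)

lemma equiv_piv: "equiv V piv"
proof (rule equivI)
  show "piv \<subseteq> V \<times> V" "refl_on V piv" "trans piv"
    by (auto simp: piv_def refl_on_def trans_def)
  have "sym ((pivot V E)\<^sup>*)" using pivot_sym by (intro sym_rtrancl symI)
  then show "sym piv" by (auto simp: piv_def sym_def)
qed

text \<open>This is where \<open>m \<ge> 2\<close> matters: for \<open>m = 1\<close> any two
  singleton edges would form a pivot with empty \<open>A\<close>, and nodes of different components
  would be pivot equivalent.\<close>

lemma pivotE:
  assumes "(x, y) \<in> pivot V E"
  obtains A where "x \<notin> A" "y \<notin> A" "insert x A \<in> E" "insert y A \<in> E" "A \<noteq> {}"
proof -
  obtain A where A: "A \<subseteq> V - {x, y}" "{x} \<union> A \<in> E" "{y} \<union> A \<in> E"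
    using assms by (auto simp: pivot_def)
  have "A \<noteq> {}"
  proof
    assume "A = {}"
    then show False using card_edge[OF A(2)] m_ge by simp
  qed
  then show ?thesis using A that[of A] by auto
qed

text \<open>Both edges of a pivot contain the nonempty set \<open>A\<close>, and any node of
  \<open>A\<close> links the exchanged nodes. Hence each pivot class lies within one
  component.\<close>

lemma piv_subset_link: "piv \<subseteq> link"
proof clarify
  fix x y assume "(x, y) \<in> piv"
  then have "(x, y) \<in> (pivot V E)\<^sup>*" "x \<in> V" by (auto simp: piv_def)
  then show "(x, y) \<in> link"
  proof (induction rule: rtrancl_induct)
    case base
    then show ?case using equiv_link by (meson equivE refl_onD)
  next
    case (step y z)
    obtain A where A: "insert y A \<in> E" "insert z A \<in> E" "A \<noteq> {}" using step.hyps(2) by (metis pivotE)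
    then obtain a where "a \<in> A" by blast
    then have "(y, a) \<in> link" "(a, z) \<in> link" using A by (auto intro: link_edge)
    then show ?case using step equiv_link by (meson equivE transD)
  qed
qed

text \<open>Consecutive edges of a proper chain differ by exchanging one node \<open>a\<close> for
  one node \<open>b\<close>. The common part makes \<open>a\<close> and \<open>b\<close> a pivot, so
  both or neither lie in the class and the count is unchanged along the chain.\<close>

lemma card_edge_Int_class:
  assumes "e \<in> E" "f \<in> E" "x \<in> e" "y \<in> f" "(x, y) \<in> link"
  shows "card (e \<inter> piv `` {z}) = card (f \<inter> piv `` {z})"
proof -
  let ?C = "link `` {x}" and ?K = "piv `` {z}"
  have "?C \<in> components V E"
    using assms edge_node unfolding components_def link_def[symmetric] by (auto intro: quotientI)
  moreover have "e \<in> edges_in E ?C" using assms by (auto simp: edges_in_def intro: link_edge)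
  moreover have "f \<in> edges_in E ?C"
    using assms equiv_link by (auto simp: edges_in_def) (meson equivE link_edge transD)
  ultimately obtain es where es: "es \<noteq> []" "set es \<subseteq> edges_in E ?C" "hd es = e" "last es = f"
    "successively (\<lambda>e f. card (e \<inter> f) = m - 1) es"
    using proper unfolding properly_connected_def by meson
  have "card (hd es \<inter> ?K) = card (last es \<inter> ?K)"
    if "es \<noteq> []" "set es \<subseteq> E" "successively (\<lambda>e f. card (e \<inter> f) = m - 1) es" for es
    using that
  proof (induction es rule: induct_list012)
    case (3 g h es)
    let ?A = "g \<inter> h"
    have gh: "g \<in> E" "h \<in> E" "card ?A = m - 1" using 3 by auto
    have "card (g - h) = 1" "card (h - g) = 1"
      using card_Diff_subset_Int[of g h] card_Diff_subset_Int[of h g] finite_edge card_edge gh m_ge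
      by (auto simp: Int_commute)
    then obtain a b where ab: "g - h = {a}" "h - g = {b}" by (metis card_1_singletonE)
    then have g: "g = insert a ?A" and h: "h = insert b ?A" and nin: "a \<notin> ?A" "b \<notin> ?A" by auto
    have V: "a \<in> V" "b \<in> V" "?A \<subseteq> V - {a, b}" using g h gh(1,2) nin edge_node by auto
    then have "(a, b) \<in> pivot V E"
      unfolding pivot_def using g h gh(1,2) by (auto intro!: exI[of _ ?A])
    then have "(a, b) \<in> piv" using V by (auto simp: piv_def)
    then have K: "a \<in> ?K \<longleftrightarrow> b \<in> ?K" using equiv_piv by (meson Image_singleton_iff equivE symD transD)
    have fin: "finite (?A \<inter> ?K)" using finite_edge gh by auto
    have "card (g \<inter> ?K) = (if a \<in> ?K then 1 else 0) + card (?A \<inter> ?K)"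
      using nin fin by (subst g) (auto simp: Int_insert_left)
    moreover have "card (h \<inter> ?K) = (if b \<in> ?K then 1 else 0) + card (?A \<inter> ?K)"
      using nin fin by (subst h) (auto simp: Int_insert_left)
    ultimately have "card (g \<inter> ?K) = card (h \<inter> ?K)" using K by simp
    then show ?case using 3 by simp
  qed auto
  moreover have "set es \<subseteq> E" using es(2) by (auto simp: edges_in_def)
  ultimately show ?thesis using es by metis
qed

section \<open>The group generated by the edge vectors\<close>

text \<open>The differences of elements of the monoid already form the group that it generates;
  their entries may be negative, hence integers.\<close>

definition exponent_diff :: "('v \<Rightarrow> int) \<Rightarrow> bool" where
  "exponent_diff d \<longleftrightarrow> (\<exists>u\<in>edge_monoid E. \<exists>v\<in>edge_monoid E.
     \<forall>x. d x = int (Poly_Mapping.lookup u x) - int (Poly_Mapping.lookup v x))"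

lemma exponent_diff_add:
  assumes "exponent_diff d" "exponent_diff d'"
  shows "exponent_diff (\<lambda>x. d x + d' x)"
proof -
  obtain u v where uv: "u \<in> edge_monoid E" "v \<in> edge_monoid E"
    "\<And>x. d x = int (Poly_Mapping.lookup u x) - int (Poly_Mapping.lookup v x)"
    using assms(1) by (auto simp: exponent_diff_def)
  obtain u' v' where uv': "u' \<in> edge_monoid E" "v' \<in> edge_monoid E"
    "\<And>x. d' x = int (Poly_Mapping.lookup u' x) - int (Poly_Mapping.lookup v' x)"
    using assms(2) by (auto simp: exponent_diff_def)
  have "u + u' \<in> edge_monoid E" "v + v' \<in> edge_monoid E"
    using uv uv' add_submonoid_edge_monoid[of E] by (auto simp: add_submonoid_def)
  then show ?thesis
    unfolding exponent_diff_def
    by (intro bexI[of _ "u + u'"] bexI[of _ "v + v'"]) (simp_all add: lookup_add uv uv')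
qed

lemma exponent_diff_edges:
  assumes "e \<in> E" "f \<in> E"
  shows "exponent_diff (\<lambda>x. of_bool (x \<in> e) - of_bool (x \<in> f))"
  unfolding exponent_diff_def
  using edge_exponent_in_monoid[OF assms(1)] edge_exponent_in_monoid[OF assms(2)]
  by (intro bexI[of _ "edge_exponent e"] bexI[of _ "edge_exponent f"]) (auto simp: lookup_edge_exponent finite_edge assms)

lemma exponent_diff_edge:
  assumes "e \<in> E"
  shows "exponent_diff (\<lambda>x. of_bool (x \<in> e))"
  unfolding exponent_diff_def
  using edge_exponent_in_monoid[OF assms(1)] add_submonoid_edge_monoid[of E]
  by (intro bexI[of _ "edge_exponent e"] bexI[of _ 0])
    (auto simp: lookup_edge_exponent finite_edge assms add_submonoid_def)

lemma exponent_diff_0: "exponent_diff (\<lambda>x. 0)"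
  unfolding exponent_diff_def using add_submonoid_edge_monoid
  by (intro bexI[of _ 0]) (auto simp: add_submonoid_def)

text \<open>The common part \<open>A\<close> cancels in the difference of the two edges of a pivot,
  and the differences telescope along a path of pivots.\<close>

lemma exponent_diff_piv:
  assumes "(x, y) \<in> piv"
  shows "exponent_diff (\<lambda>z. of_bool (z = x) - of_bool (z = y))"
proof -
  have "(x, y) \<in> (pivot V E)\<^sup>*" using assms by (simp add: piv_def)
  then show ?thesis
  proof (induction rule: rtrancl_induct)
    case base
    then show ?case using exponent_diff_0 by simp
  next
    case (step y z)
    obtain A where A: "y \<notin> A" "z \<notin> A" "insert y A \<in> E" "insert z A \<in> E"
      using step.hyps(2) by (metis pivotE)
    have "(\<lambda>w. of_bool (w \<in> insert y A) - of_bool (w \<in> insert z A)) =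
        (\<lambda>w. of_bool (w = y) - of_bool (w = z) :: int)"
      using A by (auto simp: fun_eq_iff)
    then have "exponent_diff (\<lambda>w. of_bool (w = y) - of_bool (w = z))"
      using exponent_diff_edges[OF A(3,4)] by simp
    from exponent_diff_add[OF step.IH this] show ?case by simp
  qed
qed

lemma exponent_diff_sum:
  "finite A \<Longrightarrow> (\<And>a. a \<in> A \<Longrightarrow> exponent_diff (d a)) \<Longrightarrow> exponent_diff (\<lambda>x. \<Sum>a\<in>A. d a x)"
  by (induction A rule: finite_induct) (auto intro: exponent_diff_0 exponent_diff_add)

text \<open>\<open>a x\<close> is the number of nodes that each edge in the component of
  \<open>x\<close> has in the pivot class of \<open>x\<close>; \<open>N\<close> counts, component by
  component, the edges in a decomposition of \<open>u\<close>. So all class sums in a component are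
  governed by a single unknown.\<close>

lemma class_sum:
  assumes rep: "\<And>x. x \<in> V \<Longrightarrow> (x, cr x) \<in> link" "\<And>x y. (x, y) \<in> link \<Longrightarrow> cr x = cr y"
  obtains a where "\<And>x. x \<in> V \<Longrightarrow> a x \<ge> (1::nat)"
    "\<And>u. u \<in> edge_monoid E \<Longrightarrow> \<exists>N. \<forall>x\<in>V. (\<Sum>y\<in>piv `` {x}. Poly_Mapping.lookup u y) = N (cr x) * a x"
proof -
  have "\<forall>x\<in>V. \<exists>e\<in>E. x \<in> e" using node_edge by blast
  then obtain ed where ed: "\<And>x. x \<in> V \<Longrightarrow> ed x \<in> E" "\<And>x. x \<in> V \<Longrightarrow> x \<in> ed x" by metis
  define a where "a x = card (ed x \<inter> piv `` {x})" for x
  have "a x \<ge> 1" if "x \<in> V" for x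
  proof -
    have "x \<in> ed x \<inter> piv `` {x}" using ed that equiv_class_self[OF equiv_piv] by blast
    moreover have "finite (ed x \<inter> piv `` {x})" using ed that finite_edge by blast
    ultimately show ?thesis unfolding a_def by (metis One_nat_def Suc_leI card_gt_0_iff empty_iff)
  qed
  moreover have "\<exists>N. \<forall>x\<in>V. (\<Sum>y\<in>piv `` {x}. Poly_Mapping.lookup u y) = N (cr x) * a x"
    if u: "u \<in> edge_monoid E" for u
  proof -
    obtain t where "edge_sum E t u" using u by (auto simp: edge_monoid_def)
    then show ?thesis
    proof (induction rule: edge_sum.induct)
      case zero
      then show ?case by (intro exI[of _ "\<lambda>_. 0"]) simp
    next
      case (step t u e)
      then obtain N where N: "\<And>x. x \<in> V \<Longrightarrow> (\<Sum>y\<in>piv `` {x}. Poly_Mapping.lookup u y) = N (cr x) * a x"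
        by blast
      have "e \<noteq> {}" using card_edge[OF step(2)] m_ge by auto
      then obtain z where z: "z \<in> e" by blast
      \<comment> \<open>The new edge is counted at the representative of its own component; it does
        not meet the classes of other components.\<close>
      let ?N = "N(cr z := Suc (N (cr z)))"
      have "(\<Sum>y\<in>piv `` {x}. Poly_Mapping.lookup (u + edge_exponent e) y) = ?N (cr x) * a x"
        if x: "x \<in> V" for x
      proof -
        have fin: "finite (piv `` {x})"
          by (rule finite_subset[OF _ finite_nodes]) (auto simp: piv_def)
        have "(\<Sum>y\<in>piv `` {x}. Poly_Mapping.lookup (edge_exponent e) y) = card (e \<inter> piv `` {x})"
          using fin by (simp add: lookup_edge_exponent finite_edge step(2) sum.If_cases Int_commute)
        moreover have "card (e \<inter> piv `` {x}) = (if cr x = cr z then a x else 0)"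
        proof (cases "cr x = cr z")
          case True
          have "(x, z) \<in> link"
            using rep(1)[OF x] rep(1)[of z] z edge_node[OF step(2)] True equiv_link
            by (metis equivE symD transD)
          then show ?thesis
            using card_edge_Int_class[OF ed(1)[OF x] step(2) ed(2)[OF x] z] True by (simp add: a_def)
        next
          case False
          have "e \<inter> piv `` {x} = {}"
          proof (rule ccontr)
            assume "e \<inter> piv `` {x} \<noteq> {}"
            then obtain y where "y \<in> e" "(x, y) \<in> link" using piv_subset_link by blast
            then have "cr x = cr y" "cr y = cr z" using rep(2) link_edge[OF step(2) _ z] by auto
            then show False using False by simp
          qed
          then show ?thesis using False by simp
        qed
        ultimately show ?thesis using N[OF x] by (simp add: lookup_add sum.distrib)
      qed
      then show ?case by blast
    qed
  qed
  ultimately show ?thesis by (rule that)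
qed

lemma edge_monoid_support:
  assumes "u \<in> edge_monoid E" "x \<notin> V"
  shows "Poly_Mapping.lookup u x = 0"
proof -
  obtain t where "edge_sum E t u" using assms(1) by (auto simp: edge_monoid_def)
  then show ?thesis using assms(2)
    by (induction rule: edge_sum.induct) (auto simp: lookup_add lookup_edge_exponent finite_edge dest: edge_node)
qed

text \<open>The same enumeration \<open>s\<close> serves both bounds: the first property feeds the
  upper bound on the Krull dimension, the second the lower bound.\<close>

lemma coordinate_system:
  defines "r \<equiv> card V - card (pivot_classes V E) + card (components V E)"
  obtains s where
    "\<And>u v. u \<in> edge_monoid E \<Longrightarrow> v \<in> edge_monoid E \<Longrightarrow>
      (\<And>i. i < r \<Longrightarrow> Poly_Mapping.lookup u (s i) = Poly_Mapping.lookup v (s i)) \<Longrightarrow> u = v"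
    "\<And>j. j < r \<Longrightarrow> \<exists>u\<in>edge_monoid E. \<exists>v\<in>edge_monoid E.
      (\<forall>i<j. Poly_Mapping.lookup u (s i) = Poly_Mapping.lookup v (s i)) \<and>
      Poly_Mapping.lookup u (s j) \<noteq> Poly_Mapping.lookup v (s j)"
proof -
  obtain rp where rp: "\<And>x. x \<in> V \<Longrightarrow> (x, rp x) \<in> piv" "\<And>x y. (x, y) \<in> piv \<Longrightarrow> rp x = rp y"
    using equiv_representative[OF equiv_piv] by blast
  obtain cr0 where cr0: "\<And>x. x \<in> V \<Longrightarrow> (x, cr0 x) \<in> link" "\<And>x y. (x, y) \<in> link \<Longrightarrow> cr0 x = cr0 y"
    using equiv_representative[OF equiv_link] by blast
  \<comment> \<open>The representative of a component is made a pivot representative too. This keeps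
    \<open>R1\<close> disjoint from \<open>R0\<close>, so that the two cardinalities add up to
    \<open>r\<close>.\<close>
  define cr where "cr x = rp (cr0 x)" for x
  have inV: "x \<in> V" "y \<in> V" if "(x, y) \<in> link" for x y using that by (auto simp: link_def)
  have rpV: "rp x \<in> V" "rp (rp x) = rp x" if "x \<in> V" for x
    using rp(1)[OF that] rp(2)[OF rp(1)[OF that]] by (auto simp: piv_def)
  have cr: "(x, cr x) \<in> link" if "x \<in> V" for x
  proof -
    have "(cr0 x, rp (cr0 x)) \<in> link" using rp(1) inV(2)[OF cr0(1)[OF that]] piv_subset_link by blast
    then show ?thesis unfolding cr_def using cr0(1)[OF that] equiv_link by (meson equivE transD)
  qed
  have cr2: "cr x = cr y" if "(x, y) \<in> link" for x y using cr0(2)[OF that] by (simp add: cr_def)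
  have crcr: "cr (cr x) = cr x" if "x \<in> V" for x using cr2[OF cr[OF that]] by simp
  have rpcr: "rp (cr x) = cr x" if "x \<in> V" for x
    unfolding cr_def using rpV(2) inV(2)[OF cr0(1)[OF that]] by blast
  define R0 where "R0 = {x \<in> V. rp x \<noteq> x}"
  define R1 where "R1 = cr ` V"
  have R1V: "R1 \<subseteq> V" using inV(2)[OF cr] by (auto simp: R1_def)
  have fin: "finite R0" "finite R1" using finite_nodes by (auto simp: R0_def R1_def)
  have disj: "R0 \<inter> R1 = {}" using rpcr by (auto simp: R0_def R1_def)
  have "pivot_classes V E = V // piv" "components V E = V // link"
    by (auto simp: pivot_classes_def piv_def components_def link_def)
  then have cards: "card (pivot_classes V E) = card (rp ` V)" "card (components V E) = card R1"
    using card_quotient_image[OF equiv_piv rp] card_quotient_image[OF equiv_link cr cr2]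
    by (simp_all add: R1_def)
  have "rp x = x \<longleftrightarrow> x \<in> rp ` V" if "x \<in> V" for x using that rpV(2) by (metis imageE imageI)
  then have "R0 = V - rp ` V" by (auto simp: R0_def)
  \<comment> \<open>Pivot representatives are nodes, so the truncated subtraction of cardinalities
    is exact.\<close>
  moreover have "rp ` V \<subseteq> V" using rpV by auto
  ultimately have "card R0 = card V - card (rp ` V)"
    using finite_nodes by (simp add: card_Diff_subset)
  then have r: "r = card R0 + card R1" by (simp add: r_def cards)
  obtain s0 where s0: "bij_betw s0 {0..<card R0} R0" using ex_bij_betw_nat_finite[OF fin(1)] by blast
  obtain s1 where s1: "bij_betw s1 {0..<card R1} R1" using ex_bij_betw_nat_finite[OF fin(2)] by blast
  \<comment> \<open>The order matters for separation: differences used for nodes of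
    \<open>R0\<close> may be nonzero on \<open>R1\<close>, while those used for \<open>R1\<close>
    vanish on all of \<open>R0\<close>.\<close>
  define s where "s i = (if i < card R0 then s0 i else s1 (i - card R0))" for i
  have sR0: "s i \<in> R0" if "i < card R0" for i
    using that s0 by (auto simp: s_def bij_betw_def)
  have sR1: "s i \<in> R1" if "i < r" "\<not> i < card R0" for i
    using that s1 r by (auto simp: s_def bij_betw_def)
  have s_inj: "i = j" if "i < r" "j < r" "s i = s j" for i j
  proof (cases "i < card R0"; cases "j < card R0")
    assume "i < card R0" "j < card R0"
    then show ?thesis using that s0 by (auto simp: s_def bij_betw_def inj_on_def)
  next
    assume "\<not> i < card R0" "\<not> j < card R0"
    moreover from this have "s1 (i - card R0) = s1 (j - card R0)" using that by (simp add: s_def)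
    then have "i - card R0 = j - card R0"
      using s1 that r calculation by (auto simp: bij_betw_def inj_on_def)
    ultimately show ?thesis by simp
  qed (use that sR0 sR1 disj in \<open>fastforce\<close>)+
  have s_surj: "\<exists>i<r. x = s i" if "x \<in> R0 \<union> R1" for x
  proof (cases "x \<in> R0")
    case True
    then have "x \<in> s0 ` {0..<card R0}" using s0 by (simp add: bij_betw_def)
    then obtain i where "i < card R0" "x = s0 i" by auto
    then show ?thesis using r by (intro exI[of _ i]) (auto simp: s_def)
  next
    case False
    then have "x \<in> s1 ` {0..<card R1}" using s1 that by (simp add: bij_betw_def)
    then obtain i where "i < card R1" "x = s1 i" by auto
    then show ?thesis using r by (intro exI[of _ "card R0 + i"]) (auto simp: s_def)
  qed
  obtain a where a: "\<And>x. x \<in> V \<Longrightarrow> a x \<ge> (1::nat)"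
    "\<And>u. u \<in> edge_monoid E \<Longrightarrow> \<exists>N. \<forall>x\<in>V. (\<Sum>y\<in>piv `` {x}. Poly_Mapping.lookup u y) = N (cr x) * a x"
    using class_sum[OF cr cr2] by blast
  have inj: "u = v" if uv: "u \<in> edge_monoid E" "v \<in> edge_monoid E"
    and eq: "\<And>i. i < r \<Longrightarrow> Poly_Mapping.lookup u (s i) = Poly_Mapping.lookup v (s i)" for u v
  proof -
    obtain N where N: "\<And>x. x \<in> V \<Longrightarrow> (\<Sum>y\<in>piv `` {x}. Poly_Mapping.lookup u y) = N (cr x) * a x"
      using a(2)[OF uv(1)] by blast
    obtain N' where N': "\<And>x. x \<in> V \<Longrightarrow> (\<Sum>y\<in>piv `` {x}. Poly_Mapping.lookup v y) = N' (cr x) * a x"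
      using a(2)[OF uv(2)] by blast
    have eqS: "Poly_Mapping.lookup u x = Poly_Mapping.lookup v x" if "x \<in> R0 \<union> R1" for x
      using s_surj[OF that] eq by blast
    have classV: "piv `` {x} \<subseteq> V" for x by (auto simp: piv_def)
    \<comment> \<open>In the pivot class of a component representative every node lies in
      \<open>R0\<close> or \<open>R1\<close>, so the class sums of \<open>u\<close> and
      \<open>v\<close> agree there. Cancelling the positive factor \<open>a (cr x)\<close> leaves
      the edge counts of the component.\<close>
    have NN: "N (cr x) = N' (cr x)" if x: "x \<in> V" for x
    proof -
      have crV: "cr x \<in> V" using x R1V by (auto simp: R1_def)
      have "piv `` {cr x} \<subseteq> R0 \<union> R1"
      proof
        fix y assume y: "y \<in> piv `` {cr x}"
        then have "rp y = cr x" using rp(2)[of "cr x" y] rpcr[OF x] by simp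
        then show "y \<in> R0 \<union> R1" using y classV x by (cases "y = cr x") (auto simp: R0_def R1_def)
      qed
      then have "(\<Sum>y\<in>piv `` {cr x}. Poly_Mapping.lookup u y) = (\<Sum>y\<in>piv `` {cr x}. Poly_Mapping.lookup v y)"
        by (intro sum.cong refl eqS) blast
      then have "N (cr x) * a (cr x) = N' (cr x) * a (cr x)"
        using N[OF crV] N'[OF crV] crcr[OF x] by simp
      then show ?thesis using a(1)[OF crV] by simp
    qed
    have "Poly_Mapping.lookup u x = Poly_Mapping.lookup v x" if x: "x \<in> V" for x
    proof (cases "rp x = x")
      case False
      then show ?thesis using eqS x by (simp add: R0_def)
    next
      case True
      \<comment> \<open>Equal edge counts give equal class sums. All entries of the class other than
        the one at its representative are known, and that one is the remainder.\<close>
      let ?K = "piv `` {x}"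
      have K: "finite ?K" "x \<in> ?K"
        using classV finite_nodes finite_subset equiv_class_self[OF equiv_piv x] by blast+
      have "y \<in> R0" if "y \<in> ?K - {x}" for y
        using that rp(2)[of x y] True classV by (auto simp: R0_def)
      then have "(\<Sum>y\<in>?K - {x}. Poly_Mapping.lookup u y) = (\<Sum>y\<in>?K - {x}. Poly_Mapping.lookup v y)"
        by (intro sum.cong refl eqS) blast
      moreover have "(\<Sum>y\<in>?K. Poly_Mapping.lookup u y) = (\<Sum>y\<in>?K. Poly_Mapping.lookup v y)"
        using N[OF x] N'[OF x] NN[OF x] by simp
      ultimately show ?thesis using K by (simp add: sum.remove[of ?K x])
    qed
    then show "u = v"
      using edge_monoid_support[OF uv(1)] edge_monoid_support[OF uv(2)]
      by (intro poly_mapping_eqI) metis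
  qed
  have sep: "\<exists>d. exponent_diff d \<and> (\<forall>i<j. d (s i) = 0) \<and> d (s j) \<noteq> 0" if j: "j < r" for j
  proof (cases "j < card R0")
    case True
    let ?x = "s j"
    \<comment> \<open>Besides \<open>s j\<close> only its pivot representative has a nonzero value;
      it lies outside \<open>R0\<close> and so cannot be an earlier coordinate.\<close>
    let ?d = "\<lambda>z. of_bool (z = ?x) - of_bool (z = rp ?x) :: int"
    have x: "?x \<in> V" "rp ?x \<noteq> ?x" using sR0[OF True] by (auto simp: R0_def)
    have "?d (s i) = 0" if "i < j" for i
    proof -
      have "s i \<in> R0" using sR0 that True by simp
      then have "s i \<noteq> rp ?x" using rpV[OF x(1)] by (auto simp: R0_def)
      moreover have "s i \<noteq> s j" using s_inj[of i j] that j by auto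
      ultimately show ?thesis by simp
    qed
    moreover have "exponent_diff ?d" by (rule exponent_diff_piv[OF rp(1)[OF x(1)]])
    ultimately show ?thesis using x(2) by (intro exI[of _ ?d]) auto
  next
    case False
    let ?x = "s j"
    have x: "?x \<in> R1" "?x \<in> V" "cr ?x = ?x" "rp ?x = ?x"
      using sR1[OF j False] R1V crcr rpcr by (auto simp: R1_def)
    obtain e where e: "e \<in> E" "?x \<in> e" using node_edge x by metis
    \<comment> \<open>Every node of \<open>e\<close> is moved to its pivot representative, which
      stays inside the group. The value at \<open>z\<close> becomes the number of nodes of
      \<open>e\<close> represented by \<open>z\<close>, so nothing can cancel at
      \<open>s j\<close>.\<close>
    let ?d = "\<lambda>z. of_bool (z \<in> e) + (\<Sum>y\<in>e. of_bool (z = rp y) - of_bool (z = y)) :: int"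
    have fin_e: "finite e" by (rule finite_edge[OF e(1)])
    have d: "?d z = int (card {y \<in> e. z = rp y})" for z
    proof -
      have "(\<Sum>y\<in>e. of_bool (z = y) :: int) = of_bool (z \<in> e)"
        using fin_e by (simp add: of_bool_def)
      moreover have "(\<Sum>y\<in>e. of_bool (z = rp y) :: int) = int (card {y \<in> e. z = rp y})"
        using fin_e by (simp add: Int_def)
      ultimately show ?thesis by (simp add: sum_subtractf)
    qed
    have "exponent_diff (\<lambda>z. of_bool (z = rp y) - of_bool (z = y))" if "y \<in> e" for y
      using rp(1)[OF edge_node[OF e(1) that]] equiv_piv by (intro exponent_diff_piv) (meson equivE symD)
    then have "exponent_diff ?d"
      by (intro exponent_diff_add[OF exponent_diff_edge[OF e(1)]] exponent_diff_sum fin_e)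
    moreover have "?d (s i) = 0" if i: "i < j" for i
    proof -
      \<comment> \<open>A node of \<open>R1\<close> that represents a node of \<open>e\<close> lies
        in the component of \<open>e\<close>, whose only member of \<open>R1\<close> is
        \<open>s j\<close>.\<close>
      have "s i \<noteq> rp y" if y: "y \<in> e" for y
      proof
        assume si: "s i = rp y"
        have yV: "y \<in> V" by (rule edge_node[OF e(1) y])
        have "\<not> i < card R0" using sR0[of i] si rpV(2)[OF yV] by (auto simp: R0_def)
        then have "s i \<in> R1" using sR1 i j by simp
        then have "cr (s i) = s i" using crcr by (auto simp: R1_def)
        moreover have "cr y = cr (s i)" using rp(1)[OF yV] piv_subset_link si by (metis cr2 subsetD)
        moreover have "cr y = cr ?x" by (rule cr2[OF link_edge[OF e(1) y e(2)]])
        ultimately have "s i = s j" using x by simp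
        then show False using s_inj[of i j] i j by simp
      qed
      then have "{y \<in> e. s i = rp y} = {}" by blast
      then show ?thesis unfolding d by (simp only: card.empty of_nat_0)
    qed
    moreover have "?d ?x \<noteq> 0" unfolding d using e(2) x(4) fin_e by (auto simp: card_eq_0_iff)
    ultimately show ?thesis by blast
  qed
  show thesis
  proof (rule that[of s])
    show "u = v" if "u \<in> edge_monoid E" "v \<in> edge_monoid E"
      "\<And>i. i < r \<Longrightarrow> Poly_Mapping.lookup u (s i) = Poly_Mapping.lookup v (s i)" for u v
      using inj that by blast
    fix j assume "j < r"
    from sep[OF this] obtain d where d: "exponent_diff d" "\<And>i. i < j \<Longrightarrow> d (s i) = 0" "d (s j) \<noteq> 0" by blast
    from d(1) obtain u v where uv: "u \<in> edge_monoid E" "v \<in> edge_monoid E"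
      "\<And>x. d x = int (Poly_Mapping.lookup u x) - int (Poly_Mapping.lookup v x)"
      by (auto simp: exponent_diff_def)
    show "\<exists>u\<in>edge_monoid E. \<exists>v\<in>edge_monoid E.
      (\<forall>i<j. Poly_Mapping.lookup u (s i) = Poly_Mapping.lookup v (s i)) \<and>
      Poly_Mapping.lookup u (s j) \<noteq> Poly_Mapping.lookup v (s j)"
      using d(2,3) uv by (intro bexI[OF _ uv(1)] bexI[OF _ uv(2)]) simp
  qed
qed

end

section \<open>The special fiber ring\<close>

locale edge_ring = edge_hypergraph V E m
  for V :: "'v set" and E m +
  fixes K :: "'k::field itself"
begin

abbreviation "X \<equiv> {t :: 'v \<Rightarrow>\<^sub>0 nat. Poly_Mapping.keys t \<subseteq> V}"
abbreviation "A0 \<equiv> monoid_algebra K X"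
abbreviation "D \<equiv> node_denominators K V"
abbreviation "L \<equiv> node_local_ring K V"
abbreviation "I \<equiv> edge_ideal K V E"
abbreviation "M \<equiv> edge_monoid E"

definition supp :: "('v, 'k) mpoly \<Rightarrow> bool" where
  "supp p \<longleftrightarrow> Poly_Mapping.keys p \<subseteq> X"

lemma carrier_A0 [simp]: "carrier A0 = {p. supp p}"
  by (simp add: supp_def)

declare monoid_algebra_simps(1) [simp del]

section \<open>Degrees, orders at the origin and the denominators\<close>

definition tdeg :: "('v \<Rightarrow>\<^sub>0 nat) \<Rightarrow> nat" where
  "tdeg u = (\<Sum>x\<in>V. Poly_Mapping.lookup u x)"

text \<open>Membership in the power \<open>(x_1, ..., x_n)^d\<close>, read off the monomials; the
  zero polynomial has every order.\<close>

definition order_ge :: "nat \<Rightarrow> ('v, 'k) mpoly \<Rightarrow> bool" where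
  "order_ge d p \<longleftrightarrow> (\<forall>u\<in>Poly_Mapping.keys p. d \<le> tdeg u)"

lemma tdeg_add: "tdeg (u + v) = tdeg u + tdeg v"
  by (simp add: tdeg_def lookup_add sum.distrib)

lemma tdeg_0 [simp]: "tdeg 0 = 0"
  by (simp add: tdeg_def)

lemma tdeg_pos: "u \<in> X \<Longrightarrow> u \<noteq> 0 \<Longrightarrow> tdeg u \<ge> 1"
proof (rule ccontr)
  assume u: "u \<in> X" "u \<noteq> 0" "\<not> tdeg u \<ge> 1"
  then have "(\<Sum>x\<in>V. Poly_Mapping.lookup u x) = 0" by (simp add: tdeg_def)
  then have "\<forall>x\<in>V. Poly_Mapping.lookup u x = 0" using finite_nodes by simp
  then have "u = 0" using u(1) by (intro poly_mapping_eqI) (auto simp: in_keys_iff)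
  then show False using u by simp
qed

lemma tdeg_edge_exponent:
  assumes "e \<in> E" shows "tdeg (edge_exponent e) = m"
proof -
  have "e \<subseteq> V" using assms edge_node by blast
  then have "tdeg (edge_exponent e) = card (V \<inter> e)"
    using finite_nodes by (simp add: tdeg_def lookup_edge_exponent finite_edge assms sum.If_cases)
  then show ?thesis using \<open>e \<subseteq> V\<close> card_edge[OF assms] by (simp add: Int_absorb1)
qed

lemma tdeg_edge_sum: "edge_sum E t u \<Longrightarrow> tdeg u = m * t"
  by (induction rule: edge_sum.induct) (auto simp: tdeg_add tdeg_edge_exponent)

lemma edge_monoid_subset: "M \<subseteq> X"
  using edge_monoid_support by (auto simp: in_keys_iff)

lemma add_submonoid_X: "add_submonoid X"
  by (rule add_submonoid_exponents)

sublocale A0: cring A0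
  by (rule cring_monoid_algebra[OF add_submonoid_X])

lemma supp_mult: "supp p \<Longrightarrow> supp q \<Longrightarrow> supp (p * q)"
  unfolding supp_def by (rule keys_mult_add_submonoid[OF add_submonoid_X])

lemma supp_add: "supp p \<Longrightarrow> supp q \<Longrightarrow> supp (p + q)"
  unfolding supp_def using keys_add[of p q] by blast

lemma supp_single [simp]: "u \<in> X \<Longrightarrow> supp (Poly_Mapping.single u c)"
  by (simp add: supp_def)

lemma supp_0 [simp]: "supp 0" and supp_1 [simp]: "supp 1"
  by (simp_all add: supp_def)

lemma supp_uminus [simp]: "supp (- p) \<longleftrightarrow> supp p"
  by (simp add: supp_def)

lemma supp_keys: "supp p \<Longrightarrow> u \<in> Poly_Mapping.keys p \<Longrightarrow> u \<in> X"
  unfolding supp_def by blast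

lemma A0_uminus: "supp p \<Longrightarrow> \<ominus>\<^bsub>A0\<^esub> p = - p"
  by (intro A0.minus_equality) auto

lemma order_ge_mult: "order_ge d p \<Longrightarrow> order_ge e q \<Longrightarrow> order_ge (d + e) (p * q)"
  unfolding order_ge_def using keys_mult[of p q] by (fastforce simp: tdeg_add intro: add_mono)

lemma order_ge_add: "order_ge d p \<Longrightarrow> order_ge d q \<Longrightarrow> order_ge d (p + q)"
  unfolding order_ge_def using keys_add[of p q] by blast

lemma order_ge_mult_left: "order_ge d q \<Longrightarrow> order_ge d (p * q)"
  using order_ge_mult[of 0 p d q] by (simp add: order_ge_def)

lemma order_ge_uminus: "order_ge d p \<Longrightarrow> order_ge d (- p)"
  by (simp add: order_ge_def)

lemma order_ge_mono: "order_ge d p \<Longrightarrow> e \<le> d \<Longrightarrow> order_ge e p"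
  unfolding order_ge_def by (meson le_trans)

lemma order_ge_1_iff:
  assumes "supp p" shows "order_ge 1 p \<longleftrightarrow> Poly_Mapping.lookup p 0 = 0"
proof
  assume "order_ge 1 p"
  then show "Poly_Mapping.lookup p 0 = 0"
    unfolding order_ge_def by (metis in_keys_iff not_one_le_zero tdeg_0)
next
  assume *: "Poly_Mapping.lookup p 0 = 0"
  show "order_ge 1 p"
    unfolding order_ge_def
  proof
    fix u assume u: "u \<in> Poly_Mapping.keys p"
    then have "u \<noteq> 0" using * by (auto simp: in_keys_iff)
    then show "1 \<le> tdeg u" using tdeg_pos supp_keys[OF assms u] by blast
  qed
qed

lemma split_constant:
  obtains p' where "p = Poly_Mapping.single 0 (Poly_Mapping.lookup p 0) + (p' :: ('v, 'k) mpoly)"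
    "Poly_Mapping.lookup p' 0 = 0" "supp p \<Longrightarrow> supp p'"
proof
  let ?c = "Poly_Mapping.single 0 (Poly_Mapping.lookup p 0) :: ('v, 'k) mpoly"
  show "p = ?c + (p - ?c)" by simp
  show "Poly_Mapping.lookup (p - ?c) 0 = 0" by (simp add: lookup_minus)
  show "supp (p - ?c)" if "supp p"
    unfolding supp_def
  proof
    fix u assume u: "u \<in> Poly_Mapping.keys (p - ?c)"
    have "Poly_Mapping.lookup (p - ?c) u \<noteq> 0" using u by (simp add: in_keys_iff)
    then have "u \<in> Poly_Mapping.keys p \<or> u = 0"
      by (auto simp: lookup_minus in_keys_iff lookup_single when_def split: if_splits)
    then show "u \<in> X" using supp_keys[OF that] by auto
  qed
qed

text \<open>Exponents are natural numbers, so a sum of exponent vectors is 0 only if both are.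
  Evaluation at the origin is thus multiplicative, and the denominators are closed under
  products.\<close>

lemma lookup_mult_0:
  "Poly_Mapping.lookup (p * q :: ('v, 'k) mpoly) 0 = Poly_Mapping.lookup p 0 * Poly_Mapping.lookup q 0"
proof -
  obtain p' where p': "p = Poly_Mapping.single 0 (Poly_Mapping.lookup p 0) + p'" "Poly_Mapping.lookup p' 0 = 0"
    by (rule split_constant)
  have "Poly_Mapping.lookup (p' * q) 0 = 0"
  proof (rule ccontr)
    assume "Poly_Mapping.lookup (p' * q) 0 \<noteq> 0"
    then have "0 \<in> Poly_Mapping.keys (p' * q)" by (simp add: in_keys_iff)
    then obtain u v where "u \<in> Poly_Mapping.keys p'" "0 = u + v" using keys_mult[of p' q] by blast
    moreover from this(2) have "u = 0"
      by (metis add_is_0 lookup_add lookup_zero poly_mapping_eqI)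
    ultimately show False using p'(2) by (simp add: in_keys_iff)
  qed
  then show ?thesis
    by (subst p'(1)) (simp add: distrib_right lookup_add lookup_scalar_mult)
qed

lemma var_in: "x \<in> V \<Longrightarrow> supp (var x)"
  unfolding var_def by (rule supp_single) simp

text \<open>Every nonconstant monomial is divisible by a node. The explicit form reduces membership
  in \<open>D\<close> to a nonzero constant coefficient.\<close>

lemma Idl_var: "Idl\<^bsub>A0\<^esub> (var ` V) = {p. supp p \<and> Poly_Mapping.lookup p 0 = 0}" (is "_ = ?Z")
proof
  have var: "var ` V \<subseteq> carrier A0" using var_in by auto
  have "ideal ?Z A0"
  proof (rule idealI)
    show "ring A0" by (rule A0.ring_axioms)
    show "subgroup ?Z (add_monoid A0)"
    proof (rule subgroup.intro)
      show "inv\<^bsub>add_monoid A0\<^esub> x \<in> ?Z" if "x \<in> ?Z" for x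
        using that A0_uminus[of x] unfolding a_inv_def[symmetric] by simp
    qed (use supp_add in \<open>auto simp: lookup_add\<close>)
  qed (use supp_mult in \<open>auto simp: lookup_mult_0\<close>)
  moreover have "var ` V \<subseteq> ?Z" 
  proof clarify
    fix x assume "x \<in> V"
    have "Poly_Mapping.single x (1::nat) \<noteq> 0" by (metis lookup_single_eq lookup_zero one_neq_zero)
    then show "supp (var x) \<and> Poly_Mapping.lookup (var x :: ('v, 'k) mpoly) 0 = 0"
      using var_in[OF \<open>x \<in> V\<close>] by (simp add: var_def lookup_single when_def)
  qed
  ultimately show "Idl\<^bsub>A0\<^esub> (var ` V) \<subseteq> ?Z" by (rule A0.genideal_minimal)
  interpret J: ideal "Idl\<^bsub>A0\<^esub> (var ` V)" A0 by (rule A0.genideal_ideal[OF var])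
  show "?Z \<subseteq> Idl\<^bsub>A0\<^esub> (var ` V)"
  proof
    fix p assume p: "p \<in> ?Z"
    have single: "Poly_Mapping.single u c \<in> Idl\<^bsub>A0\<^esub> (var ` V)" if u: "u \<in> X" "u \<noteq> 0" for u and c :: 'k
    proof -
      obtain x where x: "Poly_Mapping.lookup u x \<noteq> 0" using u(2) by (metis lookup_zero poly_mapping_eqI)
      then have xV: "x \<in> V" using u(1) by (auto simp: in_keys_iff)
      \<comment> \<open>Subtraction of exponent vectors is truncated; it is exact here because
        \<open>x\<close> occurs in \<open>u\<close>.\<close>
      let ?v = "u - Poly_Mapping.single x 1"
      have v: "u = ?v + Poly_Mapping.single x 1"
        using x by (intro poly_mapping_eqI) (auto simp: lookup_add lookup_minus lookup_single when_def)
      have "?v \<in> X"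
      proof safe
        fix y assume "y \<in> Poly_Mapping.keys ?v"
        then have "y \<in> Poly_Mapping.keys u" by (auto simp: in_keys_iff lookup_minus)
        then show "y \<in> V" using u(1) by auto
      qed
      then have "Poly_Mapping.single ?v c \<otimes>\<^bsub>A0\<^esub> var x \<in> Idl\<^bsub>A0\<^esub> (var ` V)"
        using xV A0.genideal_self[OF var] by (intro J.I_l_closed) auto
      moreover have "Poly_Mapping.single ?v c * var x = Poly_Mapping.single u c"
        using v by (simp add: var_def mult_single)
      ultimately show ?thesis by simp
    qed
    have "(\<Sum>u\<in>U. Poly_Mapping.single u (Poly_Mapping.lookup p u)) \<in> Idl\<^bsub>A0\<^esub> (var ` V)"
      if "finite U" "U \<subseteq> Poly_Mapping.keys p" for U
      using that
    proof (induction U rule: finite_induct)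
      case empty
      then show ?case using additive_subgroup.zero_closed[OF J.additive_subgroup_axioms] by simp
    next
      case (insert u U)
      then have "u \<in> X" "u \<noteq> 0" using p supp_keys[of p u] by (auto simp: in_keys_iff)
      then show ?case
        using insert additive_subgroup.a_closed[OF J.additive_subgroup_axioms single] by simp
    qed
    from this[of "Poly_Mapping.keys p"] show "p \<in> Idl\<^bsub>A0\<^esub> (var ` V)"
      using poly_mapping_sum_single[of p] by simp
  qed
qed

lemma denom_iff: "s \<in> D \<longleftrightarrow> supp s \<and> Poly_Mapping.lookup s 0 \<noteq> 0"
  unfolding node_denominators_def node_poly_ring_eq Idl_var by auto

sublocale loc: localization_setup A0 D
  by unfold_locales (use supp_mult in \<open>auto simp: denom_iff lookup_mult_0\<close>)

lemma L_eq: "L = localization A0 D"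
  by (simp add: node_local_ring_def node_poly_ring_eq)

sublocale L: cring L
  unfolding L_eq by (rule loc.cring_loc)

abbreviation "fr \<equiv> frac A0 D"
abbreviation "\<iota> p \<equiv> fr p 1"

lemmas fr_mult = loc.fr_mult[folded L_eq, simplified]
lemmas fr_add = loc.fr_add[folded L_eq, simplified]
lemmas fr_closed = loc.fr_closed[folded L_eq, simplified]
lemmas fr_eq_iff = loc.fr_eq_iff[simplified]

lemma one_D: "1 \<in> D"
  using loc.denom_one by simp

lemma supp_D: "s \<in> D \<Longrightarrow> supp s"
  by (simp add: denom_iff)

lemma mult_D: "s \<in> D \<Longrightarrow> t \<in> D \<Longrightarrow> s * t \<in> D"
  using loc.denom_mult by simp

lemma carrierE: assumes "x \<in> carrier L" obtains a s where "x = fr a s" "supp a" "s \<in> D"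
  using assms that unfolding L_eq loc.carrier_loc by auto

lemma L_minus: "supp a \<Longrightarrow> s \<in> D \<Longrightarrow> \<ominus>\<^bsub>L\<^esub> fr a s = fr (- a) s"
  unfolding L_eq using loc.loc_minus by (simp add: A0_uminus)

lemma L_one: "\<one>\<^bsub>L\<^esub> = fr 1 1" and L_zero: "\<zero>\<^bsub>L\<^esub> = fr 0 1"
  unfolding L_eq using loc.loc_one loc.loc_zero by simp_all

lemma \<iota>_hom: "\<iota> \<in> ring_hom A0 L"
  unfolding L_eq using loc.loc_hom by simp

section \<open>The order filtration of the local ring\<close>

text \<open>The \<open>d\<close>-th power of the maximal ideal of \<open>L\<close>, described
  through numerators so that membership can be tested on monomials.\<close>

definition order_ideal :: "nat \<Rightarrow> (('v, 'k) mpoly \<times> ('v, 'k) mpoly) set set" where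
  "order_ideal d = {fr a s | a s. supp a \<and> s \<in> D \<and> order_ge d a}"

lemma order_ideal_I: "supp a \<Longrightarrow> s \<in> D \<Longrightarrow> order_ge d a \<Longrightarrow> fr a s \<in> order_ideal d"
  by (auto simp: order_ideal_def)

lemma order_ideal_carrier: "order_ideal d \<subseteq> carrier L"
  using fr_closed by (auto simp: order_ideal_def)

lemma order_ideal_mono: "e \<le> d \<Longrightarrow> order_ideal d \<subseteq> order_ideal e"
  unfolding order_ideal_def using order_ge_mono by blast

lemma order_ideal_0: "order_ideal 0 = carrier L"
  using order_ideal_carrier[of 0] by (auto elim!: carrierE intro!: order_ideal_I simp: order_ge_def)

lemma order_ideal_add: "x \<in> order_ideal d \<Longrightarrow> y \<in> order_ideal d \<Longrightarrow> x \<oplus>\<^bsub>L\<^esub> y \<in> order_ideal d"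
proof -
  assume "x \<in> order_ideal d" "y \<in> order_ideal d"
  then obtain a s b t where *: "x = fr a s" "supp a" "s \<in> D" "order_ge d a"
    "y = fr b t" "supp b" "t \<in> D" "order_ge d b" by (auto simp: order_ideal_def)
  then have "order_ge d (a * t + b * s)"
    using order_ge_mult_left[of d a t] order_ge_mult_left[of d b s]
    by (intro order_ge_add) (simp_all add: mult.commute)
  then show ?thesis
    using * by (auto simp: fr_add supp_D intro!: order_ideal_I supp_add supp_mult mult_D)
qed

lemma order_ideal_mult: "x \<in> order_ideal d \<Longrightarrow> y \<in> order_ideal e \<Longrightarrow> x \<otimes>\<^bsub>L\<^esub> y \<in> order_ideal (d + e)"
proof -
  assume "x \<in> order_ideal d" "y \<in> order_ideal e"
  then obtain a s b t where *: "x = fr a s" "supp a" "s \<in> D" "order_ge d a"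
    "y = fr b t" "supp b" "t \<in> D" "order_ge e b" by (auto simp: order_ideal_def)
  then show ?thesis
    by (auto simp: fr_mult intro!: order_ideal_I supp_mult mult_D order_ge_mult)
qed

lemma ideal_order_ideal: "ideal (order_ideal d) L"
proof (rule idealI)
  show "ring L" by (rule L.ring_axioms)
  show "subgroup (order_ideal d) (add_monoid L)"
  proof (rule subgroup.intro)
    show "\<one>\<^bsub>add_monoid L\<^esub> \<in> order_ideal d" using order_ideal_I[of 0 1 d] one_D by (simp add: L_zero order_ge_def)
    show "inv\<^bsub>add_monoid L\<^esub> x \<in> order_ideal d" if "x \<in> order_ideal d" for x
    proof -
      obtain a s where "x = fr a s" "supp a" "s \<in> D" "order_ge d a" using \<open>x \<in> order_ideal d\<close> by (auto simp: order_ideal_def)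
      then show ?thesis
        unfolding a_inv_def[symmetric] by (auto simp: L_minus intro!: order_ideal_I order_ge_uminus)
    qed
  qed (use order_ideal_carrier order_ideal_add in auto)
  fix a x assume "a \<in> order_ideal d" "x \<in> carrier L"
  then show "x \<otimes>\<^bsub>L\<^esub> a \<in> order_ideal d" "a \<otimes>\<^bsub>L\<^esub> x \<in> order_ideal d"
    using order_ideal_mult[of x 0 a d] order_ideal_mult[of a d x 0] by (auto simp: order_ideal_0)
qed

text \<open>Clearing denominators gives an equation \<open>h * p = u * a\<close> with nonzero
  constant coefficient of \<open>h\<close>. The part of \<open>h * p\<close> in degree
  \<open>d\<close> is \<open>p\<close> times that coefficient, while the right side has order above
  \<open>d\<close>.\<close>

lemma homogeneous_order:
  assumes p: "supp p" "\<And>u. u \<in> Poly_Mapping.keys p \<Longrightarrow> tdeg u = d" and "\<iota> p \<in> order_ideal (Suc d)"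
  shows "p = 0"
proof -
  obtain a s where as: "\<iota> p = fr a s" "supp a" "s \<in> D" "order_ge (Suc d) a"
    using assms(3) by (auto simp: order_ideal_def)
  then obtain u where u: "u \<in> D" "u * (p * s) = u * (a * 1)"
    using fr_eq_iff[of p 1 a s] p(1) one_D by auto
  let ?h = "u * s"
  have h: "Poly_Mapping.lookup ?h 0 \<noteq> 0" "supp ?h" using mult_D[OF u(1) as(3)] by (auto simp: denom_iff)
  have "order_ge (Suc d) (u * a)" by (rule order_ge_mult_left[OF as(4)])
  moreover have "u * a = ?h * p" using u(2) by (simp add: mult_ac)
  ultimately have hp: "order_ge (Suc d) (?h * p)" by simp
  obtain h' where h': "?h = Poly_Mapping.single 0 (Poly_Mapping.lookup ?h 0) + h'"
    "Poly_Mapping.lookup h' 0 = 0" "supp ?h \<Longrightarrow> supp h'"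
    using split_constant[of ?h] by blast
  have "order_ge 1 h'" using h' h order_ge_1_iff by blast
  moreover have "order_ge d p" using p(2) by (simp add: order_ge_def)
  ultimately have "order_ge (Suc d) (h' * p)" using order_ge_mult[of 1 h' d p] by simp
  then have "order_ge (Suc d) (?h * p + - (h' * p))" using hp order_ge_uminus order_ge_add by blast
  moreover have "?h * p + - (h' * p) = Poly_Mapping.single 0 (Poly_Mapping.lookup ?h 0) * p"
    by (subst h'(1)) (simp add: distrib_right)
  ultimately have ord: "order_ge (Suc d) (Poly_Mapping.single 0 (Poly_Mapping.lookup ?h 0) * p)" by simp
  show "p = 0"
  proof (rule ccontr)
    assume "p \<noteq> 0"
    then obtain v where v: "v \<in> Poly_Mapping.keys p" by fastforce
    then have "v \<in> Poly_Mapping.keys (Poly_Mapping.single 0 (Poly_Mapping.lookup ?h 0) * p)"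
      using h(1) by (simp add: in_keys_iff lookup_scalar_mult)
    then have "Suc d \<le> tdeg v" using ord by (simp add: order_ge_def)
    then show False using p(2)[OF v] by simp
  qed
qed

lemma one_notin_order_ideal_1: "\<one>\<^bsub>L\<^esub> \<notin> order_ideal 1"
proof
  assume "\<one>\<^bsub>L\<^esub> \<in> order_ideal 1"
  then have "\<iota> 1 \<in> order_ideal (Suc 0)" by (simp add: L_one)
  then have "(1 :: ('v, 'k) mpoly) = 0" by (intro homogeneous_order[of 1 0]) auto
  then show False by simp
qed

text \<open>A fraction outside \<open>order_ideal 1\<close> has a numerator with nonzero constant
  coefficient, so its reciprocal exists in \<open>L\<close>. This makes \<open>order_ideal 1\<close>
  the only maximal ideal.\<close>

lemma ideal_not_subset_order_ideal_1:
  assumes "ideal J L" "\<not> J \<subseteq> order_ideal 1" shows "J = carrier L"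
proof -
  interpret J: ideal J L by fact
  obtain x where x: "x \<in> J" "x \<notin> order_ideal 1" using assms by blast
  obtain a s where as: "x = fr a s" "supp a" "s \<in> D" using carrierE J.Icarr x by metis
  then have aD: "a \<in> D" using x(2) order_ge_1_iff order_ideal_I by (auto simp: denom_iff)
  have "fr s a \<otimes>\<^bsub>L\<^esub> x \<in> J" using as aD supp_D fr_closed by (intro J.I_l_closed x) auto
  moreover have "fr s a \<otimes>\<^bsub>L\<^esub> x = \<one>\<^bsub>L\<^esub>"
    unfolding L_one as(1) using as aD supp_D one_D supp_1
    by (auto simp: fr_mult fr_eq_iff supp_mult mult_D mult.commute intro!: bexI[of _ 1])
  ultimately show ?thesis using J.one_imp_carrier by simp
qed

lemma max_ideal_local_ring: "max_ideal L = order_ideal 1"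
  unfolding max_ideal_def
proof (rule the_equality)
  have proper: "carrier L \<noteq> order_ideal 1" using one_notin_order_ideal_1 L.one_closed by metis
  show "maximalideal (order_ideal 1) L"
  proof (rule maximalidealI[OF ideal_order_ideal proper])
    fix J assume "ideal J L" "order_ideal 1 \<subseteq> J" "J \<subseteq> carrier L"
    then show "J = order_ideal 1 \<or> J = carrier L" using ideal_not_subset_order_ideal_1 by blast
  qed
  fix J assume "maximalideal J L"
  then interpret J: maximalideal J L .
  have "J \<subseteq> order_ideal 1" using ideal_not_subset_order_ideal_1[OF J.is_ideal] J.I_notcarr by blast
  then show "J = order_ideal 1" using J.I_maximal[OF ideal_order_ideal] order_ideal_carrier proper by blast
qed

lemma prod_var: "finite e \<Longrightarrow> (\<Prod>x\<in>e. var x :: ('v, 'k) mpoly) = Poly_Mapping.single (edge_exponent e) 1"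
  by (induction e rule: finite_induct) (auto simp: edge_exponent_def var_def mult_single)

section \<open>Powers of the edge ideal and homogeneous components\<close>

definition gens :: "(('v, 'k) mpoly \<times> ('v, 'k) mpoly) set set" where
  "gens = (\<lambda>e. \<iota> (Poly_Mapping.single (edge_exponent e) 1)) ` E"

lemma edge_ideal_eq: "I = Idl\<^bsub>L\<^esub> gens"
proof -
  have "(\<lambda>e. fr (\<Prod>x\<in>e. var x) 1) ` E = gens"
    unfolding gens_def by (intro image_cong refl) (simp add: prod_var finite_edge)
  then show ?thesis unfolding edge_ideal_def node_poly_ring_eq by simp
qed

lemma edge_exponent_X: "e \<in> E \<Longrightarrow> edge_exponent e \<in> X"
  using edge_exponent_in_monoid edge_monoid_subset by blast

lemma gens_order_ideal: "gens \<subseteq> order_ideal m"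
  unfolding gens_def using edge_exponent_X one_D
  by (auto intro!: order_ideal_I simp: order_ge_def tdeg_edge_exponent)

lemma gens_carrier: "gens \<subseteq> carrier L"
  using gens_order_ideal order_ideal_carrier by blast

sublocale gr: graded_setup L I
proof (intro graded_setup.intro)
  show "cring L" by (rule L.is_cring)
  show "ideal I L" unfolding edge_ideal_eq by (rule L.genideal_ideal[OF gens_carrier])
qed

lemma ip_order_ideal: "gr.ip t \<subseteq> order_ideal (m * t)"
proof (induction t)
  case 0
  then show ?case by (simp add: gr.ip_0 order_ideal_0)
next
  case (Suc t)
  have IO: "I \<subseteq> order_ideal m" unfolding edge_ideal_eq by (rule L.genideal_minimal[OF ideal_order_ideal gens_order_ideal])
  show ?case
  proof
    fix x assume "x \<in> gr.ip (Suc t)"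
    then have "x \<in> gr.ip t \<cdot>\<^bsub>L\<^esub> I" by (simp add: gr.ip_Suc)
    then show "x \<in> order_ideal (m * Suc t)"
    proof (induction x rule: ideal_prod.induct)
      case (prod i j)
      then have "i \<otimes>\<^bsub>L\<^esub> j \<in> order_ideal (m * t + m)" using Suc IO by (intro order_ideal_mult) auto
      then show ?case by (simp add: add.commute)
    qed (rule order_ideal_add)
  qed
qed

text \<open>Since \<open>m * (t + 1) > m * t\<close>, passing to cosets modulo
  \<open>I^(t+1)\<close> in degree \<open>t\<close> changes nothing in order
  \<open>m * t\<close>.\<close>

lemma ip_Suc_order_ideal: "gr.ip (Suc t) \<subseteq> order_ideal (Suc (m * t))"
  using ip_order_ideal[of "Suc t"] order_ideal_mono[of "Suc (m * t)" "m * Suc t"] m_ge by fastforce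

definition hcomp :: "nat \<Rightarrow> ('v, 'k) mpoly \<Rightarrow> ('v, 'k) mpoly" where
  "hcomp d p = (\<Sum>u\<in>{u \<in> Poly_Mapping.keys p. tdeg u = d}. Poly_Mapping.single u (Poly_Mapping.lookup p u))"

lemma lookup_hcomp: "Poly_Mapping.lookup (hcomp d p) u = (if tdeg u = d then Poly_Mapping.lookup p u else 0)"
  by (auto simp: hcomp_def lookup_sum lookup_single when_def in_keys_iff)

lemma keys_hcomp: "Poly_Mapping.keys (hcomp d p) = {u \<in> Poly_Mapping.keys p. tdeg u = d}"
  by (auto simp: in_keys_iff lookup_hcomp split: if_splits)

lemma hcomp_add: "hcomp d (p + q) = hcomp d p + hcomp d q"
  by (rule poly_mapping_eqI) (simp add: lookup_hcomp lookup_add)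

lemma hcomp_sum: "hcomp d (sum f U) = (\<Sum>i\<in>U. hcomp d (f i))"
  by (rule poly_mapping_eqI) (simp add: lookup_hcomp lookup_sum)

lemma hcomp_single: "hcomp d (Poly_Mapping.single u c) = (if tdeg u = d then Poly_Mapping.single u c else 0)"
  by (rule poly_mapping_eqI) (auto simp: lookup_hcomp lookup_single when_def)

lemma tdeg_M: "u \<in> M \<Longrightarrow> \<exists>a. tdeg u = m * a"
  using tdeg_edge_sum by (auto simp: edge_monoid_def)

text \<open>Degrees in \<open>M\<close> are multiples of \<open>m\<close>, so the Cauchy product
  over all degrees keeps only the terms with degrees \<open>m * i\<close> and
  \<open>m * (n - i)\<close>.\<close>

lemma hcomp_mult:
  assumes "Poly_Mapping.keys p \<subseteq> M" "Poly_Mapping.keys q \<subseteq> M"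
  shows "hcomp (m * n) (p * q) = (\<Sum>i\<le>n. hcomp (m * i) p * hcomp (m * (n - i)) q)"
proof -
  let ?P = "Poly_Mapping.keys p" and ?Q = "Poly_Mapping.keys q"
  let ?p = "\<lambda>u. Poly_Mapping.single u (Poly_Mapping.lookup p u)"
  let ?q = "\<lambda>u. Poly_Mapping.single u (Poly_Mapping.lookup q u)"
  have single: "hcomp (m * n) (?p u * ?q v) = (\<Sum>i\<le>n. hcomp (m * i) (?p u) * hcomp (m * (n - i)) (?q v))"
    if uv: "u \<in> ?P" "v \<in> ?Q" for u v
  proof -
    obtain a b where ab: "tdeg u = m * a" "tdeg v = m * b" using tdeg_M assms uv by blast
    have m0: "m \<noteq> 0" using m_ge by simp
    have eq: "hcomp (m * i) (?p u) * hcomp (m * (n - i)) (?q v) = (if i = a then (if b = n - a then ?p u * ?q v else 0) else 0)"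
      for i using m0 by (auto simp: hcomp_single ab)
    have "(\<Sum>i\<le>n. hcomp (m * i) (?p u) * hcomp (m * (n - i)) (?q v)) =
        (if a \<le> n then (if b = n - a then ?p u * ?q v else 0) else 0)"
      unfolding eq by (simp add: sum.delta')
    moreover have "hcomp (m * n) (?p u * ?q v) = (if a + b = n then ?p u * ?q v else 0)"
      using m0 by (simp add: mult_single hcomp_single tdeg_add ab flip: distrib_left)
    ultimately show ?thesis by auto
  qed
  have "hcomp (m * n) (p * q) = hcomp (m * n) ((\<Sum>u\<in>?P. ?p u) * (\<Sum>v\<in>?Q. ?q v))"
    using poly_mapping_sum_single[of p] poly_mapping_sum_single[of q] by simp
  also have "\<dots> = (\<Sum>u\<in>?P. \<Sum>v\<in>?Q. \<Sum>i\<le>n. hcomp (m * i) (?p u) * hcomp (m * (n - i)) (?q v))"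
    by (simp add: sum_product hcomp_sum single)
  also have "\<dots> = (\<Sum>u\<in>?P. \<Sum>i\<le>n. \<Sum>v\<in>?Q. hcomp (m * i) (?p u) * hcomp (m * (n - i)) (?q v))"
    by (intro sum.cong refl sum.swap)
  also have "\<dots> = (\<Sum>i\<le>n. \<Sum>u\<in>?P. \<Sum>v\<in>?Q. hcomp (m * i) (?p u) * hcomp (m * (n - i)) (?q v))"
    by (rule sum.swap)
  also have "\<dots> = (\<Sum>i\<le>n. hcomp (m * i) (\<Sum>u\<in>?P. ?p u) * hcomp (m * (n - i)) (\<Sum>v\<in>?Q. ?q v))"
    by (simp add: sum_product hcomp_sum)
  also have "\<dots> = (\<Sum>i\<le>n. hcomp (m * i) p * hcomp (m * (n - i)) q)"
    using poly_mapping_sum_single[of p] poly_mapping_sum_single[of q] by simp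
  finally show ?thesis .
qed

section \<open>The map from the monoid algebra to the special fiber\<close>

abbreviation "A \<equiv> monoid_algebra K M"
lemma carrier_A [simp]: "carrier A = {p. Poly_Mapping.keys p \<subseteq> M}"
  by (rule monoid_algebra_simps(1))

abbreviation "G \<equiv> assoc_graded L I"
abbreviation "\<MM> \<equiv> Idl\<^bsub>G\<^esub> (gr_of L I ` max_ideal L)"

text \<open>A monomial of \<open>M\<close> of degree \<open>m * t\<close> is a product of
  \<open>t\<close> edges and lies in \<open>I^t\<close>; it is placed in degree \<open>t\<close> of
  the Rees ring. In effect the grading is divided by \<open>m\<close>.\<close>

definition \<theta> :: "('v, 'k) mpoly \<Rightarrow> nat \<Rightarrow> (('v, 'k) mpoly \<times> ('v, 'k) mpoly) set" where
  "\<theta> p = (\<lambda>t. \<iota> (hcomp (m * t) p))"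

definition special_fiber_map :: "('v, 'k) mpoly \<Rightarrow> (nat \<Rightarrow> (('v, 'k) mpoly \<times> ('v, 'k) mpoly) set set) set" where
  "special_fiber_map p = \<MM> +>\<^bsub>G\<^esub> gr.gr (\<theta> p)"

sublocale A: cring A
  by (rule cring_monoid_algebra[OF add_submonoid_edge_monoid])

sublocale \<iota>: ring_hom_ring A0 L \<iota>
  by (rule ring_hom_ringI2[OF A0.ring_axioms L.ring_axioms \<iota>_hom])

lemma keys_M_supp: "Poly_Mapping.keys p \<subseteq> M \<Longrightarrow> supp p"
  using edge_monoid_subset by (auto simp: supp_def)

lemma supp_hcomp: "supp p \<Longrightarrow> supp (hcomp d p)"
  by (auto simp: supp_def keys_hcomp)

lemma \<iota>_add: "supp p \<Longrightarrow> supp q \<Longrightarrow> \<iota> (p + q) = \<iota> p \<oplus>\<^bsub>L\<^esub> \<iota> q"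
  using \<iota>.hom_add[of p q] by simp

lemma \<iota>_mult: "supp p \<Longrightarrow> supp q \<Longrightarrow> \<iota> (p * q) = \<iota> p \<otimes>\<^bsub>L\<^esub> \<iota> q"
  using \<iota>.hom_mult[of p q] by simp

lemma \<iota>_0: "\<iota> 0 = \<zero>\<^bsub>L\<^esub>"
  by (simp add: L_zero)

lemma \<iota>_closed: "supp p \<Longrightarrow> \<iota> p \<in> carrier L"
  using \<iota>.hom_closed[of p] by simp

lemma \<iota>_sum:
  assumes "finite U" "\<And>i. i \<in> U \<Longrightarrow> supp (f i)"
  shows "\<iota> (sum f U) = (\<Oplus>\<^bsub>L\<^esub>i\<in>U. \<iota> (f i))"
proof -
  have "finsum A0 f U = sum f U"
    using assms by (intro finsum_monoid_algebra[OF add_submonoid_X]) (auto simp: supp_def)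
  then show ?thesis using \<iota>.hom_finsum[of f U] assms by (simp add: Pi_iff o_def)
qed

lemma \<iota>_edge_sum: "edge_sum E t u \<Longrightarrow> \<iota> (Poly_Mapping.single u 1) \<in> gr.ip t"
proof (induction rule: edge_sum.induct)
  case zero
  then show ?case by (simp add: gr.ip_0 \<iota>_closed)
next
  case (step t u e)
  have uX: "u \<in> X" using step(1) edge_monoid_subset by (auto simp: edge_monoid_def)
  have "\<iota> (Poly_Mapping.single (edge_exponent e) 1) \<in> I"
    unfolding edge_ideal_eq using L.genideal_self[OF gens_carrier] step(2) by (auto simp: gens_def)
  then have "\<iota> (Poly_Mapping.single u 1) \<otimes>\<^bsub>L\<^esub> \<iota> (Poly_Mapping.single (edge_exponent e) 1) \<in> gr.ip (Suc t)"
    using step.IH by (simp add: gr.ip_Suc ideal_prod.prod)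
  then show ?case
    using \<iota>_mult[of "Poly_Mapping.single u 1" "Poly_Mapping.single (edge_exponent e) 1"]
      edge_exponent_X[OF step(2)] uX by (simp add: mult_single)
qed

lemma \<theta>_rees:
  assumes p: "Poly_Mapping.keys p \<subseteq> M" shows "\<theta> p \<in> gr.rees"
proof -
  have supp: "supp p" by (rule keys_M_supp[OF p])
  have ip: "\<theta> p t \<in> gr.ip t" for t
  proof -
    let ?U = "{u \<in> Poly_Mapping.keys p. tdeg u = m * t}"
    have "\<iota> (Poly_Mapping.single u (Poly_Mapping.lookup p u)) \<in> gr.ip t" if u: "u \<in> ?U" for u
    proof -
      obtain s where s: "edge_sum E s u" using u p by (auto simp: edge_monoid_def)
      then have "s = t" using tdeg_edge_sum[OF s] u m_ge by simp
      then have "\<iota> (Poly_Mapping.single u 1) \<in> gr.ip t" using \<iota>_edge_sum s by simp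
      then have "\<iota> (Poly_Mapping.single 0 (Poly_Mapping.lookup p u)) \<otimes>\<^bsub>L\<^esub> \<iota> (Poly_Mapping.single u 1) \<in> gr.ip t"
        using ideal.I_l_closed[OF gr.ip_ideal] \<iota>_closed by simp
      moreover have "u \<in> X" using u supp supp_keys by auto
      ultimately show ?thesis
        using \<iota>_mult[of "Poly_Mapping.single 0 (Poly_Mapping.lookup p u)" "Poly_Mapping.single u 1"]
        by (simp add: mult_single)
    qed
    moreover have "\<theta> p t = (\<Oplus>\<^bsub>L\<^esub>u\<in>?U. \<iota> (Poly_Mapping.single u (Poly_Mapping.lookup p u)))"
      unfolding \<theta>_def hcomp_def using supp by (intro \<iota>_sum supp_single) (auto dest: supp_keys)
    ultimately show ?thesis using gr.ip_finsum[of ?U] by simp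
  qed
  \<comment> \<open>A crude bound suffices: as \<open>m\<close> is positive, a \<open>t\<close>
    above the sum of all degrees in \<open>p\<close> makes \<open>m * t\<close> exceed each of
    them.\<close>
  have "bound \<zero>\<^bsub>L\<^esub> (\<Sum>u\<in>Poly_Mapping.keys p. tdeg u) (\<theta> p)"
  proof
    fix t assume t: "(\<Sum>u\<in>Poly_Mapping.keys p. tdeg u) < t"
    have "tdeg u \<noteq> m * t" if "u \<in> Poly_Mapping.keys p" for u
    proof -
      have "tdeg u \<le> (\<Sum>u\<in>Poly_Mapping.keys p. tdeg u)" using that by (intro member_le_sum) auto
      also have "\<dots> < m * t" using t m_ge by (metis One_nat_def Suc_1 Suc_leD less_le_trans mult_le_mono1 nat_mult_1)
      finally show ?thesis by simp
    qed
    then have "hcomp (m * t) p = 0" by (intro poly_mapping_eqI) (auto simp: lookup_hcomp in_keys_iff)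
    then show "\<theta> p t = \<zero>\<^bsub>L\<^esub>" by (simp add: \<theta>_def \<iota>_0)
  qed
  then show ?thesis using ip gr.ip_mem_carrier unfolding gr.rees_def by (blast intro: mem_upI)
qed

lemma \<theta>_hom: "\<theta> \<in> ring_hom A gr.rees_ring"
proof (rule ring_hom_memI)
  show "\<theta> p \<in> carrier gr.rees_ring" if "p \<in> carrier A" for p
    using that \<theta>_rees by (simp add: gr.carrier_rees_ring)
  have "hcomp (m * t) 1 = (if t = 0 then 1 else 0)" for t
    using m_ge hcomp_single[of "m * t" 0 1] by auto
  then have "\<iota> (hcomp (m * t) 1) = (if t = 0 then \<one>\<^bsub>L\<^esub> else \<zero>\<^bsub>L\<^esub>)" for t
    by (simp add: L_one L_zero)
  then show "\<theta> \<one>\<^bsub>A\<^esub> = \<one>\<^bsub>gr.rees_ring\<^esub>"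
    by (simp add: \<theta>_def gr.rees_ring_def)
  fix p q assume "p \<in> carrier A" "q \<in> carrier A"
  then have pq: "Poly_Mapping.keys p \<subseteq> M" "Poly_Mapping.keys q \<subseteq> M" by simp_all
  have supp: "supp (hcomp d p)" "supp (hcomp d q)" for d
    using pq keys_M_supp supp_hcomp by auto
  show "\<theta> (p \<oplus>\<^bsub>A\<^esub> q) = \<theta> p \<oplus>\<^bsub>gr.rees_ring\<^esub> \<theta> q"
    by (simp add: \<theta>_def gr.rees_ring_def hcomp_add \<iota>_add supp)
  show "\<theta> (p \<otimes>\<^bsub>A\<^esub> q) = \<theta> p \<otimes>\<^bsub>gr.rees_ring\<^esub> \<theta> q"
    by (simp add: \<theta>_def gr.rees_ring_def hcomp_mult[OF pq] \<iota>_sum \<iota>_mult supp supp_mult)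
qed

sublocale G: cring G
  by (rule gr.cring_assoc_graded)

lemma gr_of_mon: "gr_of L I r = gr.gr (gr.mon r 0)"
  unfolding gr.gr_of_ip gr.gr_def ..

lemma mon0_rees: "r \<in> carrier L \<Longrightarrow> gr.mon r 0 \<in> gr.rees"
  by (rule gr.mon_rees) (simp add: gr.ip_0)

lemma gr_of_carrier: "gr_of L I ` max_ideal L \<subseteq> carrier G"
  unfolding max_ideal_local_ring gr_of_mon using mon0_rees order_ideal_carrier gr.gr_image by blast

sublocale MM: ideal \<MM> G
  by (rule G.genideal_ideal[OF gr_of_carrier])

abbreviation "F \<equiv> special_fiber L I"

lemma F_eq: "F = G Quot \<MM>"
  by (simp add: special_fiber_def)

lemma cring_F: "cring F"
  unfolding F_eq by (rule MM.quotient_is_cring[OF G.is_cring])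

lemma rees_to_fiber_hom: "(\<lambda>z. \<MM> +>\<^bsub>G\<^esub> gr.gr z) \<in> ring_hom gr.rees_ring F"
  using ring_hom_trans[OF gr.gr_hom MM.rcos_ring_hom] unfolding F_eq comp_def .

lemma special_fiber_map_hom: "special_fiber_map \<in> ring_hom A F"
proof -
  have "(\<lambda>z. \<MM> +>\<^bsub>G\<^esub> gr.gr z) \<circ> \<theta> = special_fiber_map"
    by (simp add: fun_eq_iff special_fiber_map_def)
  then show ?thesis using ring_hom_trans[OF \<theta>_hom rees_to_fiber_hom] by simp
qed

text \<open>In a Rees element the coefficient of degree \<open>t\<close> has order at least
  \<open>m * t\<close>; here it is strictly larger throughout. Unlike \<open>\<MM>\<close> this set
  is explicit, and by \<open>homogeneous_order\<close> it meets the image of \<open>\<theta>\<close>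
  only in 0.\<close>

definition higher_order :: "(nat \<Rightarrow> (('v, 'k) mpoly \<times> ('v, 'k) mpoly) set) set" where
  "higher_order = {a \<in> gr.rees. \<forall>t. a t \<in> order_ideal (Suc (m * t))}"

text \<open>The other factor contributes order at least \<open>m * i\<close> in degree
  \<open>i\<close>, because \<open>I^i\<close> has that order. The surplus of one is therefore
  preserved in every term of a product.\<close>

lemma higher_order_ideal: "ideal higher_order gr.rees_ring"
proof -
  interpret R: cring gr.rees_ring by (rule gr.cring_rees)
  have zero: "\<zero>\<^bsub>L\<^esub> \<in> order_ideal d" for d using ideal_order_ideal by (meson additive_subgroup.zero_closed ideal.axioms(1))
  have order_ideal_finsum: "(\<Oplus>\<^bsub>L\<^esub>i\<in>U. f i) \<in> order_ideal d" if "finite U" "\<And>i. i \<in> U \<Longrightarrow> f i \<in> order_ideal d" for U :: "nat set" and f d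
    using that
  proof (induction U rule: finite_induct)
    case (insert i U)
    then show ?case using order_ideal_carrier[of d] by (subst L.finsum_insert) (auto intro: order_ideal_add)
  qed (simp add: zero)
  have closed: "x \<otimes>\<^bsub>gr.rees_ring\<^esub> a \<in> higher_order" if a: "a \<in> higher_order" and x: "x \<in> gr.rees" for a x
  proof -
    have "x \<otimes>\<^bsub>gr.rees_ring\<^esub> a \<in> gr.rees"
      using a x R.m_closed by (simp add: higher_order_def gr.carrier_rees_ring)
    moreover have "(x \<otimes>\<^bsub>gr.rees_ring\<^esub> a) t \<in> order_ideal (Suc (m * t))" for t
    proof -
      have "x i \<otimes>\<^bsub>L\<^esub> a (t - i) \<in> order_ideal (Suc (m * t))" if "i \<le> t" for i
      proof -
        have "x i \<in> order_ideal (m * i)" using x ip_order_ideal by (auto simp: gr.rees_def)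
        moreover have "a (t - i) \<in> order_ideal (Suc (m * (t - i)))" using a by (simp add: higher_order_def)
        moreover have "m * i + Suc (m * (t - i)) = Suc (m * t)" using that by (simp flip: distrib_left)
        ultimately show ?thesis using order_ideal_mult by metis
      qed
      then show ?thesis unfolding gr.rees_ring_def using order_ideal_finsum[of "{..t}"] by simp
    qed
    ultimately show ?thesis by (simp add: higher_order_def)
  qed
  show ?thesis
  proof (rule idealI)
    show "ring gr.rees_ring" by (rule R.ring_axioms)
    show "subgroup higher_order (add_monoid gr.rees_ring)"
    proof (rule subgroup.intro)
      show "higher_order \<subseteq> carrier (add_monoid gr.rees_ring)"
        by (auto simp: higher_order_def gr.carrier_rees_ring)
      show "x \<otimes>\<^bsub>add_monoid gr.rees_ring\<^esub> y \<in> higher_order" if "x \<in> higher_order" "y \<in> higher_order" for x y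
      proof -
        have "x \<oplus>\<^bsub>gr.rees_ring\<^esub> y \<in> gr.rees"
          using that R.a_closed by (simp add: higher_order_def gr.carrier_rees_ring)
        moreover have "(x \<oplus>\<^bsub>gr.rees_ring\<^esub> y) t = x t \<oplus>\<^bsub>L\<^esub> y t" for t by (simp add: gr.rees_ring_def)
        ultimately show ?thesis using that by (auto simp: higher_order_def intro: order_ideal_add)
      qed
      have "\<zero>\<^bsub>gr.rees_ring\<^esub> \<in> gr.rees" using R.zero_closed by (simp add: gr.carrier_rees_ring)
      moreover have "\<zero>\<^bsub>gr.rees_ring\<^esub> t = \<zero>\<^bsub>L\<^esub>" for t by (simp add: gr.rees_ring_def)
      ultimately show "\<one>\<^bsub>add_monoid gr.rees_ring\<^esub> \<in> higher_order"
        by (simp add: higher_order_def zero)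
      show "inv\<^bsub>add_monoid gr.rees_ring\<^esub> x \<in> higher_order" if x: "x \<in> higher_order" for x
      proof -
        have xr: "x \<in> carrier gr.rees_ring" using x by (simp add: higher_order_def gr.carrier_rees_ring)
        \<comment> \<open>Writing the negative as a product with minus one reduces it to absorption,
          which is already known.\<close>
        then have "\<ominus>\<^bsub>gr.rees_ring\<^esub> x = \<ominus>\<^bsub>gr.rees_ring\<^esub> \<one>\<^bsub>gr.rees_ring\<^esub> \<otimes>\<^bsub>gr.rees_ring\<^esub> x"
          by (simp add: R.l_minus)
        moreover have "\<ominus>\<^bsub>gr.rees_ring\<^esub> \<one>\<^bsub>gr.rees_ring\<^esub> \<in> gr.rees"
          using R.a_inv_closed[OF R.one_closed] by (simp add: gr.carrier_rees_ring)
        ultimately show ?thesis unfolding a_inv_def[symmetric] using closed[OF x] by metis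
      qed
    qed
    fix a x assume ax: "a \<in> higher_order" "x \<in> carrier gr.rees_ring"
    then show "x \<otimes>\<^bsub>gr.rees_ring\<^esub> a \<in> higher_order" using closed by (simp add: gr.carrier_rees_ring)
    moreover have "a \<in> carrier gr.rees_ring" using ax by (simp add: higher_order_def gr.carrier_rees_ring)
    ultimately show "a \<otimes>\<^bsub>gr.rees_ring\<^esub> x \<in> higher_order" using ax R.m_comm by metis
  qed
qed

text \<open>By minimality only the generators of \<open>\<MM>\<close> matter. They sit in degree 0,
  where the required order is 1, which is the order of elements of the maximal ideal.\<close>

lemma MM_subset: "\<MM> \<subseteq> gr.gr ` higher_order"
proof (rule G.genideal_minimal)
  show "ideal (gr.gr ` higher_order) G"
    using gr.cring_rees gr.gr_image
    by (intro ideal_image_surj[OF _ G.ring_axioms gr.gr_hom _ higher_order_ideal])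
      (simp_all add: cring_def gr.carrier_rees_ring)
  have zero: "\<zero>\<^bsub>L\<^esub> \<in> order_ideal d" for d using ideal_order_ideal by (meson additive_subgroup.zero_closed ideal.axioms(1))
  have "gr.mon r 0 \<in> higher_order" if "r \<in> order_ideal 1" for r
    using that mon0_rees order_ideal_carrier[of 1] zero by (auto simp: higher_order_def)
  then show "gr_of L I ` max_ideal L \<subseteq> gr.gr ` higher_order"
    unfolding max_ideal_local_ring gr_of_mon by blast
qed

text \<open>An element of the kernel has all its homogeneous components of order greater than their
  degree, so they vanish.\<close>

lemma special_fiber_map_inj: "inj_on special_fiber_map (carrier A)"
proof -
  interpret F: cring F by (rule cring_F)
  interpret h: ring_hom_ring A F special_fiber_map
    by (rule ring_hom_ringI2[OF A.ring_axioms F.ring_axioms special_fiber_map_hom])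
  show ?thesis
  proof (rule h.trivial_ker_imp_inj, rule equalityI)
    show "a_kernel A F special_fiber_map \<subseteq> {\<zero>\<^bsub>A\<^esub>}"
    proof
      fix p assume "p \<in> a_kernel A F special_fiber_map"
      then have "p \<in> carrier A \<and> special_fiber_map p = \<zero>\<^bsub>F\<^esub>"
        unfolding a_kernel_def' mem_Collect_eq .
      then have p: "Poly_Mapping.keys p \<subseteq> M" and "special_fiber_map p = \<zero>\<^bsub>F\<^esub>"
        by simp_all
      then have "\<MM> +>\<^bsub>G\<^esub> gr.gr (\<theta> p) = \<MM>"
        by (simp add: special_fiber_map_def F_eq FactRing_def)
      moreover have "gr.gr (\<theta> p) \<in> carrier G" using \<theta>_rees[OF p] gr.gr_image by blast
      ultimately have "gr.gr (\<theta> p) \<in> \<MM>" using MM.rcos_const_imp_mem by blast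
      then obtain a where a: "a \<in> higher_order" "gr.gr (\<theta> p) = gr.gr a" using MM_subset by blast
      have "hcomp (m * t) p = 0" for t
      proof (rule homogeneous_order)
        show "supp (hcomp (m * t) p)" by (rule supp_hcomp[OF keys_M_supp[OF p]])
        show "tdeg u = m * t" if "u \<in> Poly_Mapping.keys (hcomp (m * t) p)" for u
          using that by (simp add: keys_hcomp)
        have carr: "\<theta> p t \<in> carrier L" "a t \<in> carrier L"
          using \<theta>_rees[OF p] a(1) by (auto simp: gr.rees_def higher_order_def)
        interpret J: ideal "gr.ip (Suc t)" L by (rule gr.ip_ideal)
        have "\<theta> p t \<in> gr.ip (Suc t) +>\<^bsub>L\<^esub> \<theta> p t"
          using carr J.zero_closed by (auto simp: a_r_coset_def' intro!: bexI[of _ "\<zero>\<^bsub>L\<^esub>"])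
        also have "gr.ip (Suc t) +>\<^bsub>L\<^esub> \<theta> p t = gr.ip (Suc t) +>\<^bsub>L\<^esub> a t"
          using a(2) by (simp add: gr.gr_def fun_eq_iff)
        \<comment> \<open>The coset equation leaves an error \<open>h\<close> in
          \<open>I^(t+1)\<close>, which has order above \<open>m * t\<close> just like
          \<open>a t\<close>.\<close>
        finally obtain h where "h \<in> gr.ip (Suc t)" "\<theta> p t = h \<oplus>\<^bsub>L\<^esub> a t"
          by (auto simp: a_r_coset_def')
        then show "\<iota> (hcomp (m * t) p) \<in> order_ideal (Suc (m * t))"
          using subsetD[OF ip_Suc_order_ideal] a(1) order_ideal_add by (auto simp: \<theta>_def higher_order_def)
      qed
      \<comment> \<open>Every monomial of \<open>p\<close> has degree divisible by \<open>m\<close>,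
        so these components exhaust \<open>p\<close>.\<close>
      then have "Poly_Mapping.lookup p u = 0" for u
        using tdeg_M p by (metis in_keys_iff lookup_hcomp lookup_zero subsetD)
      then show "p \<in> {\<zero>\<^bsub>A\<^esub>}" by (simp add: poly_mapping_eqI)
    qed
    show "{\<zero>\<^bsub>A\<^esub>} \<subseteq> a_kernel A F special_fiber_map"
      using h.hom_zero A.zero_closed unfolding a_kernel_def' by blast
  qed
qed

section \<open>Surjectivity and the resulting isomorphism\<close>

lemma \<theta>_single:
  assumes "tdeg u = m * i"
  shows "\<theta> (Poly_Mapping.single u c) = gr.mon (\<iota> (Poly_Mapping.single u c)) i"
  using m_ge by (auto simp: \<theta>_def hcomp_single assms \<iota>_0 fun_eq_iff)

lemma constant_plus_maximal:
  assumes "r \<in> carrier L"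
  obtains c \<mu> where "r = \<iota> (Poly_Mapping.single 0 c) \<oplus>\<^bsub>L\<^esub> \<mu>" "\<mu> \<in> order_ideal 1"
proof -
  obtain a s where as: "r = fr a s" "supp a" "s \<in> D" using assms by (rule carrierE)
  \<comment> \<open>The value of the fraction at the origin; the residue field of \<open>L\<close>
    is the coefficient field.\<close>
  let ?c = "Poly_Mapping.lookup a 0 / Poly_Mapping.lookup s 0"
  let ?k = "Poly_Mapping.single 0 ?c :: ('v, 'k) mpoly"
  let ?b = "a + - (?k * s)"
  have supp: "supp ?k" "supp s" using as supp_D by auto
  then have "supp ?b" using as(2) supp_mult[of ?k s] by (intro supp_add) simp_all
  note supp = supp this
  have "Poly_Mapping.lookup ?b 0 = 0"
    using as(3) by (simp add: lookup_add lookup_minus lookup_scalar_mult denom_iff)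
  then have "fr ?b s \<in> order_ideal 1" using as supp order_ge_1_iff by (intro order_ideal_I) auto
  moreover have "r = \<iota> ?k \<oplus>\<^bsub>L\<^esub> fr ?b s"
    unfolding as(1) using supp as one_D by (simp add: fr_add)
  ultimately show ?thesis using that by blast
qed

text \<open>By the induction principle for the Rees ring only two kinds of elements need a preimage:
  in degree 0 a fraction equals a constant modulo the maximal ideal, and in degree 1 a generator
  comes from its edge monomial.\<close>

lemma special_fiber_map_surj: "special_fiber_map ` carrier A = carrier F"
proof
  interpret F: cring F by (rule cring_F)
  interpret Rees: cring gr.rees_ring by (rule gr.cring_rees)
  define \<psi> where "\<psi> z = \<MM> +>\<^bsub>G\<^esub> gr.gr z" for z
  interpret \<psi>: ring_hom_ring gr.rees_ring F \<psi>
    unfolding \<psi>_def by (rule ring_hom_ringI2[OF Rees.ring_axioms F.ring_axioms rees_to_fiber_hom])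
  interpret h: ring_hom_ring A F special_fiber_map
    by (rule ring_hom_ringI2[OF A.ring_axioms F.ring_axioms special_fiber_map_hom])
  show "special_fiber_map ` carrier A \<subseteq> carrier F" using h.hom_closed by blast
  let ?T = "{z \<in> gr.rees. \<psi> z \<in> special_fiber_map ` carrier A}"
  have im_add: "x \<oplus>\<^bsub>F\<^esub> y \<in> special_fiber_map ` carrier A"
    and im_mult: "x \<otimes>\<^bsub>F\<^esub> y \<in> special_fiber_map ` carrier A"
    if "x \<in> special_fiber_map ` carrier A" "y \<in> special_fiber_map ` carrier A" for x y
    using that by (auto simp flip: h.hom_add h.hom_mult simp del: carrier_A monoid_algebra_simps)
  have \<theta>: "\<psi> (\<theta> p) \<in> special_fiber_map ` carrier A" if "Poly_Mapping.keys p \<subseteq> M" for p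
    using that by (auto simp: \<psi>_def special_fiber_map_def)
  have M0: "0 \<in> M" using add_submonoid_edge_monoid by (auto simp: add_submonoid_def)
  have "gr.rees \<subseteq> ?T"
  proof (rule gr.rees_generated[OF edge_ideal_eq gens_carrier])
    fix x y assume xy: "x \<in> ?T" "y \<in> ?T"
    then have c: "x \<in> carrier gr.rees_ring" "y \<in> carrier gr.rees_ring" by (simp_all add: gr.carrier_rees_ring)
    show "x \<oplus>\<^bsub>gr.rees_ring\<^esub> y \<in> ?T"
      using xy c Rees.a_closed[OF c] im_add \<psi>.hom_add[OF c] by (simp add: gr.carrier_rees_ring)
    show "x \<otimes>\<^bsub>gr.rees_ring\<^esub> y \<in> ?T"
      using xy c Rees.m_closed[OF c] im_mult \<psi>.hom_mult[OF c] by (simp add: gr.carrier_rees_ring)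
  next
    fix r assume r: "r \<in> carrier L"
    then obtain c \<mu> where c: "r = \<iota> (Poly_Mapping.single 0 c) \<oplus>\<^bsub>L\<^esub> \<mu>" "\<mu> \<in> order_ideal 1"
      by (rule constant_plus_maximal)
    let ?k = "Poly_Mapping.single 0 c :: ('v, 'k) mpoly"
    have \<mu>: "\<mu> \<in> carrier L" using c(2) order_ideal_carrier by blast
    have k: "\<iota> ?k \<in> carrier L" by (simp add: \<iota>_closed)
    have "gr.mon r 0 = gr.mon (\<iota> ?k) 0 \<oplus>\<^bsub>gr.rees_ring\<^esub> gr.mon \<mu> 0"
      unfolding c(1) using k \<mu> by (intro gr.mon_add) (simp_all add: gr.ip_0)
    then have "\<psi> (gr.mon r 0) = \<psi> (gr.mon (\<iota> ?k) 0) \<oplus>\<^bsub>F\<^esub> \<psi> (gr.mon \<mu> 0)"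
      using mon0_rees k \<mu> by (simp only: \<psi>.hom_add gr.carrier_rees_ring)
    also have "gr.mon (\<iota> ?k) 0 = \<theta> ?k" by (rule \<theta>_single[symmetric]) simp
    \<comment> \<open>The sequence with \<open>\<mu>\<close> in degree 0 represents one of the
      generators of \<open>\<MM>\<close>.\<close>
    also have "\<psi> (gr.mon \<mu> 0) = \<zero>\<^bsub>F\<^esub>"
    proof -
      have "gr_of L I \<mu> \<in> \<MM>" using c(2) G.genideal_self[OF gr_of_carrier] by (auto simp: max_ideal_local_ring)
      then have "\<MM> +>\<^bsub>G\<^esub> gr_of L I \<mu> = \<MM>" using MM.is_ideal G.a_rcos_zero by blast
      then show ?thesis by (simp add: \<psi>_def gr_of_mon F_eq FactRing_def)
    qed
    also have "\<psi> (\<theta> ?k) \<oplus>\<^bsub>F\<^esub> \<zero>\<^bsub>F\<^esub> = \<psi> (\<theta> ?k)"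
      using \<theta>_rees[of ?k] M0 by (intro F.r_zero \<psi>.hom_closed) (auto simp: gr.carrier_rees_ring)
    finally have "\<psi> (gr.mon r 0) = \<psi> (\<theta> ?k)" .
    then show "gr.mon r 0 \<in> ?T" using \<theta>[of ?k] M0 mon0_rees[OF r] by simp
  next
    fix b assume "b \<in> gens"
    then obtain e where e: "e \<in> E" "b = \<iota> (Poly_Mapping.single (edge_exponent e) 1)" by (auto simp: gens_def)
    let ?p = "Poly_Mapping.single (edge_exponent e) 1 :: ('v, 'k) mpoly"
    have "gr.mon b 1 = \<theta> ?p" unfolding e(2) by (rule \<theta>_single[symmetric]) (simp add: tdeg_edge_exponent e(1))
    moreover have "Poly_Mapping.keys ?p \<subseteq> M" using edge_exponent_in_monoid[OF e(1)] by simp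
    ultimately show "gr.mon b 1 \<in> ?T" using \<theta> \<theta>_rees by simp
  qed
  moreover have "carrier F \<subseteq> \<psi> ` gr.rees"
  proof
    fix y assume "y \<in> carrier F"
    then obtain g where g: "g \<in> carrier G" "y = \<MM> +>\<^bsub>G\<^esub> g" by (auto simp: F_eq FactRing_def A_RCOSETS_def')
    then obtain z where "z \<in> gr.rees" "g = gr.gr z" using gr.gr_image by (metis imageE)
    then show "y \<in> \<psi> ` gr.rees" using g by (auto simp: \<psi>_def)
  qed
  ultimately show "carrier F \<subseteq> special_fiber_map ` carrier A" by blast
qed

lemma analytic_spread_eq: "analytic_spread L I = krull_dim A"
proof -
  have "special_fiber_map \<in> ring_iso A F"
    using special_fiber_map_hom special_fiber_map_inj special_fiber_map_surj
    by (simp add: ring_iso_def bij_betw_def del: carrier_A)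
  then show ?thesis
    unfolding analytic_spread_def using krull_dim_iso[OF A.is_cring cring_F] by metis
qed

lemma krull_dim_edge_monoid_algebra:
  "krull_dim A = enat (card V - card (pivot_classes V E) + card (components V E))"
proof -
  let ?r = "card V - card (pivot_classes V E) + card (components V E)"
  obtain s where s: "\<And>u v. u \<in> M \<Longrightarrow> v \<in> M \<Longrightarrow>
      (\<And>i. i < ?r \<Longrightarrow> Poly_Mapping.lookup u (s i) = Poly_Mapping.lookup v (s i)) \<Longrightarrow> u = v"
    "\<And>j. j < ?r \<Longrightarrow> \<exists>u\<in>M. \<exists>v\<in>M.
      (\<forall>i<j. Poly_Mapping.lookup u (s i) = Poly_Mapping.lookup v (s i)) \<and>
      Poly_Mapping.lookup u (s j) \<noteq> Poly_Mapping.lookup v (s j)"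
    using coordinate_system by blast
  show ?thesis
  proof (rule antisym)
    show "krull_dim A \<le> enat ?r"
      by (rule krull_dim_monoid_algebra_le[OF add_submonoid_edge_monoid s(1)])
    show "enat ?r \<le> krull_dim A"
      by (rule krull_dim_monoid_algebra_ge[OF add_submonoid_edge_monoid s(2)])
  qed
qed

end

theorem proposition6p1:
  fixes K :: "'k::field itself"
    and V :: "'v set" and E :: "'v set set"
    and m n p c :: nat
  assumes "hypergraph V E"
    and "no_isolated_nodes V E"
    and "\<And>C. C \<in> components V E \<Longrightarrow> card C \<le> card (edges_in E C)"
    and "m \<ge> 2"
    and "uniform m E"
    and "\<And>C. C \<in> components V E \<Longrightarrow> properly_connected m (edges_in E C)"
    and "n = card V"
    and "c = card (components V E)"
    and "p = card (pivot_classes V E)"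
  shows "analytic_spread (node_local_ring K V) (edge_ideal K V E) = enat (n - p + c)"
proof -
  interpret edge_ring V E m K
    using assms(1,2,4-6) by unfold_locales (auto simp: hypergraph_def)
  show ?thesis
    unfolding assms(7-9) using analytic_spread_eq krull_dim_edge_monoid_algebra by simp
qed

end
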